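(* Let $\Omega\subset\mathbb{R}^d$ be a domain satisfying the segment condition. Let $n,r\ge 0$ be integers, let $\ell\ge\min\{n,r\}$ be an integer, and set $m=\min\{n,\ell\}$. Let $\{I_k,W_k,P_k\}$ be a sequence of approximation schemes on $\Omega$ and $h_k>0$ a sequence with $h_k\to 0$. Suppose there are constants $\tau>0$, $c>0$ and $s$ with $2s>d+m+1$, all independent of $k$, such that for every $k$: (i) $\{I_k,W_k,P_k\}$ is $n$-consistent; (ii) $P_k$ has $h_k$-density bounded by $\tau$; (iii) $\{I_k,W_k,P_k\}$ has polynomial decay of order $(r,s)$ for the constants $c$ and $h_k$. Let $1\le p<\infty$ and $j=\min\{n,r\}$. Then for every $u\in W^{j,p}(\Omega)$ there exists a sequence $u_k\in X_k$ such that $u_k\to u$ in $W^{j,p}(\Omega)$.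
   Context: A domain is an open and bounded subset of $\mathbb{R}^d$. $\Omega$ satisfies the segment condition if for every $x\in\partial\Omega$ there exist a neighborhood $U_x$ of $x$ and a vector $y_x\ne 0$ such that for every $z\in\bar\Omega\cap U_x$ the point $z+ty_x$ belongs to $\Omega$ for all $0<t<1$. An approximation scheme $\{I,W,P\}$ on $\Omega$ consists of a finite index set $I$, a collection $W=\{w_a: a\in I\}$ of functions $w_a:\Omega\to\mathbb{R}$ (shape functions) and a finite point set $P=\{x_a: a\in I\}\subset\mathbb{R}^d$ indexed one-to-one by $I$. $X_k$ denotes the finite-dimensional linear span of the shape functions in $W_k$. $n$-consistency: $x^\alpha=\sum_{a\in I}x_a^\alpha w_a(x)$ for all $x\in\Omega$ and all multiindices $\alpha$ with $|\alpha|\le n$. $P$ has $h$-density bounded by $\tau$ if $\#(P\cap\bar B(x,h))\le\tau$ for every $x\in\mathbb{R}^d$, where $\bar B(x,h)$ is the closed ball. The scheme has polynomial decay of order $(r,s)$ for constants $c>0$ and $h>0$ if every $w_a\in C^r(\Omega)$ and $$\sup_{|\alpha|\le r}\ \sup_{x\in\Omega}\ \sup_{a\in I}\Big(1+\Big|\frac{x-x_a}{h}\Big|^2\Big)^s h^{|\alpha|}|D^\alpha w_a(x)|<c.$$ *)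

theory Defs
  imports "HOL-Analysis.Analysis"
begin

section \<open>Multiindices and classical partial derivatives\<close>

type_synonym 'd mindex = "'d \<Rightarrow> nat"

definition mdeg :: "'d::finite mindex \<Rightarrow> nat" where
  "mdeg \<alpha> = (\<Sum>i\<in>UNIV. \<alpha> i)"

definition mpow :: "real ^ 'd::finite \<Rightarrow> 'd mindex \<Rightarrow> real" where
  "mpow x \<alpha> = (\<Prod>i\<in>UNIV. (x $ i) ^ \<alpha> i)"

lemma finite_mdeg_le: "finite {\<alpha> :: 'd::finite mindex. mdeg \<alpha> \<le> j}"
proof (rule finite_subset)
  show "{\<alpha> :: 'd mindex. mdeg \<alpha> \<le> j} \<subseteq> Pi\<^sub>E UNIV (\<lambda>_. {..j})"
    unfolding mdeg_def by (force intro: order_trans[OF member_le_sum])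
  show "finite (Pi\<^sub>E UNIV (\<lambda>_::'d. {..j}))"
    by (intro finite_PiE) auto
qed

definition partial_deriv :: "'d::finite \<Rightarrow> (real ^ 'd \<Rightarrow> real) \<Rightarrow> real ^ 'd \<Rightarrow> real" where
  "partial_deriv i f x = deriv (\<lambda>t. f (x + t *\<^sub>R axis i 1)) 0"

text \<open>The operator \<open>D\<^sup>\<alpha>\<close> composes the pure powers of the partial derivatives along one fixed
  enumeration of the coordinates.  For functions of class \<open>C\<^sup>r\<close> and \<open>|\<alpha>| \<le> r\<close> the choice of
  the enumeration is immaterial.\<close>

definition coords :: "'d::finite list" where
  "coords = (SOME is. distinct is \<and> set is = UNIV)"

definition mderiv :: "'d::finite mindex \<Rightarrow> (real ^ 'd \<Rightarrow> real) \<Rightarrow> real ^ 'd \<Rightarrow> real" where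
  "mderiv \<alpha> f = foldr (\<lambda>i. partial_deriv i ^^ \<alpha> i) coords f"

text \<open>Only meant for open \<open>S\<close>: then the partial derivatives at points of \<open>S\<close> depend on the
  values of \<open>f\<close> on \<open>S\<close> alone.  Functions on \<open>\<Omega>\<close> are represented by total functions whose
  values outside \<open>\<Omega>\<close> play no role.\<close>

primrec Cr_on :: "nat \<Rightarrow> (real ^ 'd::finite) set \<Rightarrow> (real ^ 'd \<Rightarrow> real) \<Rightarrow> bool" where
  "Cr_on 0 S f \<longleftrightarrow> continuous_on S f"
| "Cr_on (Suc r) S f \<longleftrightarrow> continuous_on S f \<and>
     (\<forall>i. (\<forall>x\<in>S. (\<lambda>t. f (x + t *\<^sub>R axis i 1)) field_differentiable at 0) \<and>
          Cr_on r S (partial_deriv i f))"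

section \<open>Sobolev spaces\<close>

definition test_functions :: "(real ^ 'd::finite) set \<Rightarrow> (real ^ 'd \<Rightarrow> real) set" where
  "test_functions \<Omega> = {\<phi>. (\<forall>k. Cr_on k UNIV \<phi>) \<and>
     compact (closure {x. \<phi> x \<noteq> 0}) \<and> closure {x. \<phi> x \<noteq> 0} \<subseteq> \<Omega>}"

definition locally_integrable :: "(real ^ 'd::finite) set \<Rightarrow> (real ^ 'd \<Rightarrow> real) \<Rightarrow> bool" where
  "locally_integrable \<Omega> f \<longleftrightarrow> (\<forall>K. compact K \<and> K \<subseteq> \<Omega> \<longrightarrow> integrable (lebesgue_on K) f)"

definition has_weak_deriv ::
  "(real ^ 'd::finite) set \<Rightarrow> 'd mindex \<Rightarrow> (real ^ 'd \<Rightarrow> real) \<Rightarrow> (real ^ 'd \<Rightarrow> real) \<Rightarrow> bool" where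
  "has_weak_deriv \<Omega> \<alpha> u v \<longleftrightarrow> locally_integrable \<Omega> u \<and> locally_integrable \<Omega> v \<and>
     (\<forall>\<phi>\<in>test_functions \<Omega>.
        (\<integral>x. u x * mderiv \<alpha> \<phi> x \<partial>lebesgue_on \<Omega>) =
        (- 1) ^ mdeg \<alpha> * (\<integral>x. v x * \<phi> x \<partial>lebesgue_on \<Omega>))"

text \<open>Weak derivatives are unique only up to null sets; the choice does not affect the norm
  below.\<close>

definition weak_deriv ::
  "(real ^ 'd::finite) set \<Rightarrow> 'd mindex \<Rightarrow> (real ^ 'd \<Rightarrow> real) \<Rightarrow> real ^ 'd \<Rightarrow> real" where
  "weak_deriv \<Omega> \<alpha> u = (SOME v. has_weak_deriv \<Omega> \<alpha> u v)"

definition Lp_functions :: "(real ^ 'd::finite) set \<Rightarrow> real \<Rightarrow> (real ^ 'd \<Rightarrow> real) set" where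
  "Lp_functions \<Omega> p = {f. f \<in> borel_measurable (lebesgue_on \<Omega>) \<and>
     integrable (lebesgue_on \<Omega>) (\<lambda>x. \<bar>f x\<bar> powr p)}"

definition sobolev :: "(real ^ 'd::finite) set \<Rightarrow> nat \<Rightarrow> real \<Rightarrow> (real ^ 'd \<Rightarrow> real) set" where
  "sobolev \<Omega> j p = {u \<in> Lp_functions \<Omega> p.
     \<forall>\<alpha>. mdeg \<alpha> \<le> j \<longrightarrow> (\<exists>v\<in>Lp_functions \<Omega> p. has_weak_deriv \<Omega> \<alpha> u v)}"

definition sobolev_norm ::
  "(real ^ 'd::finite) set \<Rightarrow> nat \<Rightarrow> real \<Rightarrow> (real ^ 'd \<Rightarrow> real) \<Rightarrow> real" where
  "sobolev_norm \<Omega> j p u =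
     (\<Sum>\<alpha> | mdeg \<alpha> \<le> j. \<integral>x. \<bar>weak_deriv \<Omega> \<alpha> u x\<bar> powr p \<partial>lebesgue_on \<Omega>) powr (1 / p)"

definition tendsto_sobolev ::
  "(real ^ 'd::finite) set \<Rightarrow> nat \<Rightarrow> real \<Rightarrow>
   (nat \<Rightarrow> real ^ 'd \<Rightarrow> real) \<Rightarrow> (real ^ 'd \<Rightarrow> real) \<Rightarrow> bool" where
  "tendsto_sobolev \<Omega> j p U u \<longleftrightarrow> u \<in> sobolev \<Omega> j p \<and> (\<forall>k. U k \<in> sobolev \<Omega> j p) \<and>
     (\<lambda>k. sobolev_norm \<Omega> j p (\<lambda>x. U k x - u x)) \<longlonglongrightarrow> 0"

section \<open>Domains and approximation schemes\<close>

text \<open>Domains are neither required to be connected nor to be nonempty.\<close>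

definition is_domain :: "(real ^ 'd::finite) set \<Rightarrow> bool" where
  "is_domain \<Omega> \<longleftrightarrow> open \<Omega> \<and> bounded \<Omega>"

definition segment_condition :: "(real ^ 'd::finite) set \<Rightarrow> bool" where
  "segment_condition \<Omega> \<longleftrightarrow>
     (\<forall>x\<in>frontier \<Omega>. \<exists>U y. open U \<and> x \<in> U \<and> y \<noteq> 0 \<and>
        (\<forall>z\<in>closure \<Omega> \<inter> U. \<forall>t. 0 < t \<and> t < 1 \<longrightarrow> z + t *\<^sub>R y \<in> \<Omega>))"

text \<open>An approximation scheme is given by its index set \<open>I\<close>, the shape functions
  \<open>w a\<close> and the nodes \<open>X a\<close> for \<open>a \<in> I\<close>.\<close>

definition approx_scheme :: "'i set \<Rightarrow> ('i \<Rightarrow> real ^ 'd::finite \<Rightarrow> real) \<Rightarrow> ('i \<Rightarrow> real ^ 'd) \<Rightarrow> bool" where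
  "approx_scheme I w X \<longleftrightarrow> finite I \<and> inj_on X I"

definition shape_span :: "'i set \<Rightarrow> ('i \<Rightarrow> real ^ 'd::finite \<Rightarrow> real) \<Rightarrow> (real ^ 'd \<Rightarrow> real) set" where
  "shape_span I w = {(\<lambda>x. \<Sum>a\<in>I. b a * w a x) | b. True}"

definition consistent ::
  "nat \<Rightarrow> (real ^ 'd::finite) set \<Rightarrow> 'i set \<Rightarrow> ('i \<Rightarrow> real ^ 'd \<Rightarrow> real) \<Rightarrow> ('i \<Rightarrow> real ^ 'd) \<Rightarrow> bool" where
  "consistent n \<Omega> I w X \<longleftrightarrow>
     (\<forall>x\<in>\<Omega>. \<forall>\<alpha>. mdeg \<alpha> \<le> n \<longrightarrow> mpow x \<alpha> = (\<Sum>a\<in>I. mpow (X a) \<alpha> * w a x))"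

definition density_bounded :: "real \<Rightarrow> real \<Rightarrow> (real ^ 'd::finite) set \<Rightarrow> bool" where
  "density_bounded h \<tau> P \<longleftrightarrow> (\<forall>x. real (card (P \<inter> cball x h)) \<le> \<tau>)"

text \<open>The supremum is taken in the extended nonnegative reals, so an unbounded family is never
  below \<open>c\<close>, and the supremum of an empty family is \<open>0\<close>.\<close>

definition polynomial_decay ::
  "nat \<Rightarrow> real \<Rightarrow> real \<Rightarrow> real \<Rightarrow> (real ^ 'd::finite) set \<Rightarrow>
   'i set \<Rightarrow> ('i \<Rightarrow> real ^ 'd \<Rightarrow> real) \<Rightarrow> ('i \<Rightarrow> real ^ 'd) \<Rightarrow> bool" where
  "polynomial_decay r s c h \<Omega> I w X \<longleftrightarrow>
     (\<forall>a\<in>I. Cr_on r \<Omega> (w a)) \<and>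
     (SUP \<alpha>\<in>{\<alpha>. mdeg \<alpha> \<le> r}. SUP x\<in>\<Omega>. SUP a\<in>I.
        ennreal ((1 + (norm ((x - X a) /\<^sub>R h))\<^sup>2) powr s * h ^ mdeg \<alpha> * \<bar>mderiv \<alpha> (w a) x\<bar>))
       < ennreal c"

end

theory Submission
  imports Defs
begin

text \<open>The span of the shape functions reproduces polynomials of degree at most \<open>n\<close>, so it approximates
every function that is locally close to its Taylor polynomials, and such functions are dense in
the Sobolev space.  The proof combines these two facts.

\<^emph>\<open>Approximation of a smooth function\<close> (\<open>scheme_pointwise_error\<close>).  Let \<open>\<Phi>\<close> be smooth on the whole
space with bounded derivatives, and put \<open>U x = (\<Sum>a. \<Phi> (X a) * w a x)\<close>.  Fix \<open>x\<close> and let \<open>T\<close> be the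
Taylor polynomial of \<open>\<Phi>\<close> of degree \<open>j\<close> at \<open>x\<close>.  Differentiating the consistency identity for \<open>T\<close> at
\<open>x\<close> gives \<open>D\<^sup>\<alpha> U x - D\<^sup>\<alpha> \<Phi> x = (\<Sum>a. (\<Phi> (X a) - T (X a)) * D\<^sup>\<alpha> (w a) x)\<close>.  The remainder is at most a
multiple of \<open>|x - X a|\<^bsup>j+1\<^esup>\<close> for near and far nodes alike (\<open>taylor_remainder\<close>), so the polynomial decay
bounds each summand, for \<open>h \<le> 1\<close>, by a multiple of \<open>h\<close> times the power of \<open>1 + |(x - X a)/h|\<^sup>2\<close> with
exponent \<open>(j+1)/2 - s\<close>.  As \<open>2s - (j+1) > d\<close>, the density bound makes the sum of these powers bounded independently of \<open>x\<close> and
\<open>h\<close> (\<open>density_sum_bound\<close>).  Hence all derivatives up to order \<open>j\<close> converge uniformly on \<open>\<Omega>\<close>, at rate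
\<open>O(h)\<close>.

\<^emph>\<open>Density of smooth functions\<close> (\<open>sobolev_smooth_approximable\<close>).  Smooth cut-off functions split a
Sobolev function into finitely many pieces, each supported where the segment condition holds with
one fixed vector \<open>y\<close>.  Such a piece is translated a little along \<open>y\<close> and mollified.  The translation
moves the ball over which the mollifier averages into \<open>\<Omega>\<close>, so that the weak derivatives of the piece
turn into derivatives of the mollified function, and these converge in \<open>L\<^sup>p\<close> by continuity of
translations (\<open>mollify\<close>).

Since the Sobolev norm in the statement is computed from arbitrarily chosen weak derivatives, weak
derivatives must also be shown to be unique almost everywhere (\<open>weak_deriv_unique\<close>), and functions of
class \<open>C\<^sup>r\<close> to have their partial derivatives as weak ones (\<open>wderiv_classical\<close>).  The sequence \<open>U\<close> is
finally obtained by choosing an almost optimal approximation from each span.\<close>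

section \<open>Calculus of partial derivatives\<close>

lemma pderiv_works:
  "(\<lambda>t. f (x + t *\<^sub>R axis i 1)) field_differentiable at 0 \<Longrightarrow>
   ((\<lambda>t. f (x + t *\<^sub>R axis i 1)) has_field_derivative partial_deriv i f x) (at 0)"
  unfolding partial_deriv_def by (simp add: DERIV_deriv_iff_field_differentiable)

lemma partial_deriv_eqI:
  "((\<lambda>t. f (x + t *\<^sub>R axis i 1)) has_field_derivative d) (at 0) \<Longrightarrow> partial_deriv i f x = d"
  unfolding partial_deriv_def by (rule DERIV_imp_deriv)

lemma eventually_axis_in_open:
  fixes S :: "(real ^ 'd::finite) set"
  assumes "open S" "x \<in> S"
  shows "eventually (\<lambda>t::real. x + t *\<^sub>R axis i 1 \<in> S) (nhds 0)"
proof -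
  have "((\<lambda>t::real. x + t *\<^sub>R axis i 1) \<longlongrightarrow> x + 0 *\<^sub>R axis i 1) (nhds 0)"
    by (intro tendsto_add tendsto_const tendsto_scaleR filterlim_ident)
  then show ?thesis using assms by (simp add: topological_tendstoD)
qed

text \<open>Partial derivatives at a point of an open set are local, which is why functions on \<open>\<Omega>\<close> may be
represented by total functions.\<close>

lemma pderiv_cong:
  fixes S :: "(real ^ 'd::finite) set"
  assumes "open S" "x \<in> S" "\<And>y. y \<in> S \<Longrightarrow> f y = g y"
  shows "((\<lambda>t. f (x + t *\<^sub>R axis i 1)) has_field_derivative d) (at 0) \<longleftrightarrow>
         ((\<lambda>t. g (x + t *\<^sub>R axis i 1)) has_field_derivative d) (at 0)"
  by (rule DERIV_cong_ev) (auto intro: eventually_mono[OF eventually_axis_in_open[OF assms(1,2)]] assms(3))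

lemma partial_deriv_cong:
  fixes S :: "(real ^ 'd::finite) set"
  assumes "open S" "x \<in> S" "\<And>y. y \<in> S \<Longrightarrow> f y = g y"
  shows "partial_deriv i f x = partial_deriv i g x"
  unfolding partial_deriv_def
  by (rule deriv_cong_ev) (auto intro: eventually_mono[OF eventually_axis_in_open[OF assms(1,2)]] assms(3))

lemma Cr_on_imp_continuous: "Cr_on r S f \<Longrightarrow> continuous_on S f"
  by (cases r) auto

lemma Cr_on_SucD:
  assumes "Cr_on (Suc r) S f"
  shows "x \<in> S \<Longrightarrow> ((\<lambda>t. f (x + t *\<^sub>R axis i 1)) has_field_derivative partial_deriv i f x) (at 0)"
    and "Cr_on r S (partial_deriv i f)"
  using assms by (auto intro!: pderiv_works)

lemma Cr_on_cong:
  assumes "open S" "\<And>y. y \<in> S \<Longrightarrow> f y = g y" "Cr_on r S f"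
  shows "Cr_on r S g"
  using assms(2,3)
proof (induction r arbitrary: f g)
  case 0
  then show ?case using continuous_on_cong[of S S f g] by simp
next
  case (Suc r)
  have 1: "continuous_on S g" using Suc.prems continuous_on_cong[of S S f g] by simp
  have 2: "((\<lambda>t. g (x + t *\<^sub>R axis i 1)) has_field_derivative partial_deriv i f x) (at 0)" if "x \<in> S" for i x
    using Cr_on_SucD(1)[OF Suc.prems(2) that] pderiv_cong[of S x f g, OF assms(1) that Suc.prems(1)] by blast
  have "Cr_on r S (partial_deriv i g)" for i
    by (rule Suc.IH[of "partial_deriv i f"])
       (use Suc.prems Cr_on_SucD(2) partial_deriv_eqI[OF 2] in auto)
  then show ?case using 1 2 by (auto simp: field_differentiable_def)
qed

text \<open>The main way to establish \<open>Cr_on\<close>: any candidate functions may be given for the partial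
derivatives, so that the inductions below never unfold \<open>partial_deriv\<close>.\<close>

lemma Cr_on_SucI:
  assumes "open S" "continuous_on S f"
    and "\<And>i x. x \<in> S \<Longrightarrow> ((\<lambda>t. f (x + t *\<^sub>R axis i 1)) has_field_derivative g i x) (at 0)"
    and "\<And>i. Cr_on r S (g i)"
  shows "Cr_on (Suc r) S f"
proof -
  have "Cr_on r S (partial_deriv i f)" for i
    by (rule Cr_on_cong[OF assms(1) _ assms(4)[of i]]) (use partial_deriv_eqI[OF assms(3)] in auto)
  then show ?thesis using assms(2,3) by (auto simp: field_differentiable_def)
qed

lemma Cr_on_Suc_imp: "Cr_on (Suc r) S f \<Longrightarrow> Cr_on r S f"
  by (induction r arbitrary: f) auto

lemma Cr_on_mono: "Cr_on r S f \<Longrightarrow> q \<le> r \<Longrightarrow> Cr_on q S f"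
  by (induction r) (auto simp: le_Suc_eq simp del: Cr_on.simps dest: Cr_on_Suc_imp)

lemma Cr_on_const: assumes "open S" shows "Cr_on r S (\<lambda>x. c)"
proof (induction r arbitrary: c)
  case (Suc r)
  show ?case by (rule Cr_on_SucI[OF assms, of _ "\<lambda>i x. 0"]) (auto intro: Suc)
qed auto

lemma Cr_on_add:
  assumes "open S" "Cr_on r S f" "Cr_on r S g"
  shows "Cr_on r S (\<lambda>x. f x + g x)"
  using assms(2,3)
proof (induction r arbitrary: f g)
  case (Suc r)
  show ?case
    by (rule Cr_on_SucI[OF assms(1), of _ "\<lambda>i x. partial_deriv i f x + partial_deriv i g x"])
       (use Suc in \<open>auto intro!: continuous_intros DERIV_add pderiv_works\<close>)
qed (auto intro: continuous_intros)

lemma Cr_on_mult: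
  assumes "open S" "Cr_on r S f" "Cr_on r S g"
  shows "Cr_on r S (\<lambda>x. f x * g x)"
  using assms(2,3)
proof (induction r arbitrary: f g)
  case (Suc r)
  show ?case
  proof (rule Cr_on_SucI[OF assms(1), of _ "\<lambda>i x. partial_deriv i f x * g x + partial_deriv i g x * f x"])
    fix i x assume "x \<in> S"
    then show "((\<lambda>t. f (x + t *\<^sub>R axis i 1) * g (x + t *\<^sub>R axis i 1)) has_field_derivative
        partial_deriv i f x * g x + partial_deriv i g x * f x) (at 0)"
      using DERIV_mult[OF Cr_on_SucD(1)[OF Suc.prems(1), of x i] Cr_on_SucD(1)[OF Suc.prems(2), of x i]] by simp
  next
    show "Cr_on r S (\<lambda>x. partial_deriv i f x * g x + partial_deriv i g x * f x)" for i
      using Suc.prems Suc.IH Cr_on_Suc_imp[OF Suc.prems(1)] Cr_on_Suc_imp[OF Suc.prems(2)]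
      by (intro Cr_on_add assms(1) Suc.IH) auto
  qed (use Suc in \<open>auto intro!: continuous_intros\<close>)
qed (auto intro: continuous_intros)

lemma Cr_on_cmult: "open S \<Longrightarrow> Cr_on r S f \<Longrightarrow> Cr_on r S (\<lambda>x. c * f x)"
  by (intro Cr_on_mult Cr_on_const)

lemma Cr_on_sum: "open S \<Longrightarrow> (\<And>a. a \<in> A \<Longrightarrow> Cr_on r S (f a)) \<Longrightarrow> Cr_on r S (\<lambda>x. \<Sum>a\<in>A. f a x)"
  by (induction A rule: infinite_finite_induct) (auto intro: Cr_on_add Cr_on_const)

lemma Cr_on_prod: "open S \<Longrightarrow> (\<And>a. a \<in> A \<Longrightarrow> Cr_on r S (f a)) \<Longrightarrow> Cr_on r S (\<lambda>x. \<Prod>a\<in>A. f a x)"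
  by (induction A rule: infinite_finite_induct) (auto intro: Cr_on_mult Cr_on_const)

lemma Cr_on_inverse:
  assumes "open S" "Cr_on r S f" "\<And>x. x \<in> S \<Longrightarrow> f x \<noteq> 0"
  shows "Cr_on r S (\<lambda>x. inverse (f x))"
  using assms(2,3)
proof (induction r arbitrary: f)
  case (Suc r)
  show ?case
  proof (rule Cr_on_SucI[OF assms(1), of _ "\<lambda>i x. (-1) * (inverse (f x) * partial_deriv i f x * inverse (f x))"])
    fix i x assume "x \<in> S"
    then show "((\<lambda>t. inverse (f (x + t *\<^sub>R axis i 1))) has_field_derivative
        (-1) * (inverse (f x) * partial_deriv i f x * inverse (f x))) (at 0)"
      using DERIV_inverse'[OF Cr_on_SucD(1)[OF Suc.prems(1), of x i]] Suc.prems(2) by simp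
  next
    show "Cr_on r S (\<lambda>x. (-1) * (inverse (f x) * partial_deriv i f x * inverse (f x)))" for i
      using Suc.prems Suc.IH[OF Cr_on_Suc_imp[OF Suc.prems(1)]]
      by (intro Cr_on_cmult Cr_on_mult assms(1)) auto
  qed (use Suc in \<open>auto intro!: continuous_intros\<close>)
qed (auto intro: continuous_intros)

lemma Cr_on_affine:
  assumes "Cr_on r UNIV f"
  shows "Cr_on r UNIV (\<lambda>x. f (c *\<^sub>R x + a))"
  using assms
proof (induction r arbitrary: f)
  case 0
  then show ?case by (auto intro!: continuous_on_compose2[of UNIV f] continuous_intros)
next
  case (Suc r)
  show ?case
  proof (rule Cr_on_SucI[of _ _ "\<lambda>i x. c * partial_deriv i f (c *\<^sub>R x + a)"])
    show "continuous_on UNIV (\<lambda>x. f (c *\<^sub>R x + a))"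
      using Cr_on_imp_continuous[OF Suc.prems]
      by (auto intro!: continuous_on_compose2[of UNIV f] continuous_intros)
    fix i x
    have *: "((\<lambda>t. c * t) has_field_derivative c) (at 0)" by (auto intro!: derivative_eq_intros)
    show "((\<lambda>t. f (c *\<^sub>R (x + t *\<^sub>R axis i 1) + a)) has_field_derivative
        c * partial_deriv i f (c *\<^sub>R x + a)) (at 0)"
      using DERIV_chain2[where f="\<lambda>t. f ((c *\<^sub>R x + a) + t *\<^sub>R axis i 1)" and g="\<lambda>t. c * t" and x=0 and Da="partial_deriv i f (c *\<^sub>R x + a)", OF _ *]
        Cr_on_SucD(1)[OF Suc.prems, of "c *\<^sub>R x + a" i]
      by (simp add: algebra_simps)
  next
    show "Cr_on r UNIV (\<lambda>x. c * partial_deriv i f (c *\<^sub>R x + a))" for i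
      by (intro Cr_on_cmult Suc.IH Cr_on_SucD(2)[OF Suc.prems]) auto
  qed auto
qed

definition smooth :: "(real ^ 'd::finite \<Rightarrow> real) \<Rightarrow> bool" where
  "smooth f \<longleftrightarrow> (\<forall>k. Cr_on k UNIV f)"

lemma smooth_partial: "smooth f \<Longrightarrow> smooth (partial_deriv i f)"
  unfolding smooth_def using Cr_on_SucD(2) by blast

lemma smooth_deriv:
  "smooth f \<Longrightarrow> ((\<lambda>t. f (x + t *\<^sub>R axis i 1)) has_field_derivative partial_deriv i f x) (at 0)"
  unfolding smooth_def using Cr_on_SucD(1) by blast

lemma smooth_continuous: "smooth f \<Longrightarrow> continuous_on A f"
  unfolding smooth_def using Cr_on_imp_continuous continuous_on_subset by blast

lemma smooth_const: "smooth (\<lambda>x. c)" by (simp add: smooth_def Cr_on_const)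
lemma smooth_add: "smooth f \<Longrightarrow> smooth g \<Longrightarrow> smooth (\<lambda>x. f x + g x)" by (simp add: smooth_def Cr_on_add)
lemma smooth_mult: "smooth f \<Longrightarrow> smooth g \<Longrightarrow> smooth (\<lambda>x. f x * g x)" by (simp add: smooth_def Cr_on_mult)
lemma smooth_cmult: "smooth f \<Longrightarrow> smooth (\<lambda>x. c * f x)" by (simp add: smooth_def Cr_on_cmult)
lemma smooth_diff: "smooth f \<Longrightarrow> smooth g \<Longrightarrow> smooth (\<lambda>x. f x - g x)"
  using smooth_add[of f "\<lambda>x. (-1) * g x"] smooth_cmult[of g "-1"] by simp
lemma smooth_sum: "(\<And>a. a \<in> A \<Longrightarrow> smooth (f a)) \<Longrightarrow> smooth (\<lambda>x. \<Sum>a\<in>A. f a x)"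
  by (simp add: smooth_def Cr_on_sum)
lemma smooth_prod: "(\<And>a. a \<in> A \<Longrightarrow> smooth (f a)) \<Longrightarrow> smooth (\<lambda>x. \<Prod>a\<in>A. f a x)"
  by (simp add: smooth_def Cr_on_prod)
lemma smooth_affine: "smooth f \<Longrightarrow> smooth (\<lambda>x. f (c *\<^sub>R x + a))" by (simp add: smooth_def Cr_on_affine)
lemma smooth_inverse: "smooth f \<Longrightarrow> (\<And>x. f x \<noteq> 0) \<Longrightarrow> smooth (\<lambda>x. inverse (f x))"
  by (simp add: smooth_def Cr_on_inverse)

lemma partial_deriv_mult:
  assumes "smooth f" "smooth g"
  shows "partial_deriv i (\<lambda>x. f x * g x) = (\<lambda>x. partial_deriv i f x * g x + partial_deriv i g x * f x)"
  by (rule ext, rule partial_deriv_eqI)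
     (use DERIV_mult[OF smooth_deriv[OF assms(1)] smooth_deriv[OF assms(2)], of _ i _ i] in simp)

lemma partial_deriv_cmult:
  assumes "smooth f"
  shows "partial_deriv i (\<lambda>x. c * f x) = (\<lambda>x. c * partial_deriv i f x)"
  by (rule ext, rule partial_deriv_eqI) (intro DERIV_cmult smooth_deriv assms)

lemma partial_deriv_translate:
  "partial_deriv i (\<lambda>x. f (x + a)) = (\<lambda>x. partial_deriv i f (x + a))"
  unfolding partial_deriv_def by (simp add: algebra_simps)

section \<open>Symmetry of partial derivatives\<close>

lemma DERIV_axis_shift:
  assumes "((\<lambda>u. f ((x + t *\<^sub>R axis i 1) + u *\<^sub>R axis i 1)) has_field_derivative d) (at 0)"
  shows "((\<lambda>t. f (x + t *\<^sub>R axis i (1::real))) has_field_derivative d) (at t)"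
proof -
  have "((\<lambda>u. f ((x + t *\<^sub>R axis i 1) + u *\<^sub>R axis i 1)) has_field_derivative d) (at (t - t))"
    using assms by simp
  from DERIV_chain2[where f="\<lambda>u. f ((x + t *\<^sub>R axis i 1) + u *\<^sub>R axis i 1)" and g="\<lambda>u. u - t" and x=t and Db=1 and s=UNIV, OF this] show ?thesis
    using DERIV_diff[OF DERIV_ident DERIV_const[of t "at t"]] by (simp add: algebra_simps)
qed

lemma smooth_DERIV_axis:
  assumes "smooth f"
  shows "((\<lambda>t. f (x + t *\<^sub>R axis i 1)) has_field_derivative partial_deriv i f (x + t *\<^sub>R axis i 1)) (at t)"
  by (rule DERIV_axis_shift) (rule smooth_deriv[OF assms])

text \<open>The mean value theorem in both variables turns the second difference over a square into a mixed
derivative at a point of the square.  The left-hand side is symmetric in \<open>i\<close> and \<open>j\<close>, the right-hand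
side is not: this is the source of the symmetry of mixed derivatives.\<close>

lemma second_difference:
  assumes f: "smooth f" and s: "s > 0"
  shows "\<exists>a b. 0 < a \<and> a < s \<and> 0 < b \<and> b < s \<and>
    f (x + s *\<^sub>R axis i 1 + s *\<^sub>R axis j 1) - f (x + s *\<^sub>R axis i 1) - f (x + s *\<^sub>R axis j 1) + f x
     = s * (s * partial_deriv j (partial_deriv i f) (x + a *\<^sub>R axis i 1 + b *\<^sub>R axis j 1))"
proof -
  define g where "g t = f ((x + s *\<^sub>R axis j 1) + t *\<^sub>R axis i 1) - f (x + t *\<^sub>R axis i 1)" for t
  define g' where "g' t = partial_deriv i f ((x + s *\<^sub>R axis j 1) + t *\<^sub>R axis i 1) - partial_deriv i f (x + t *\<^sub>R axis i 1)" for t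
  have "(g has_field_derivative g' t) (at t)" for t
    unfolding g_def g'_def by (intro DERIV_diff smooth_DERIV_axis f)
  then obtain a where a: "0 < a" "a < s" "g s - g 0 = (s - 0) * g' a"
    using MVT2[of 0 s g g'] s by auto
  define k where "k t = partial_deriv i f ((x + a *\<^sub>R axis i 1) + t *\<^sub>R axis j 1)" for t
  define k' where "k' t = partial_deriv j (partial_deriv i f) ((x + a *\<^sub>R axis i 1) + t *\<^sub>R axis j 1)" for t
  have "(k has_field_derivative k' t) (at t)" for t
    unfolding k_def k'_def by (intro smooth_DERIV_axis smooth_partial f)
  then obtain b where b: "0 < b" "b < s" "k s - k 0 = (s - 0) * k' b"
    using MVT2[of 0 s k k'] s by auto
  have "g' a = k s - k 0" by (simp add: g'_def k_def algebra_simps)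
  then have "g s - g 0 = s * (s * k' b)" using a b by simp
  then show ?thesis using a(1,2) b(1,2)
    by (intro exI[of _ a] exI[of _ b]) (auto simp: g_def k'_def algebra_simps)
qed

lemma partial_deriv_commute:
  assumes f: "smooth f"
  shows "partial_deriv i (partial_deriv j f) = partial_deriv j (partial_deriv i f)"
proof
  fix x
  let ?A = "partial_deriv j (partial_deriv i f)" and ?B = "partial_deriv i (partial_deriv j f)"
  define s where "s n = inverse (real (Suc n))" for n
  have s0: "s n > 0" for n by (simp add: s_def)
  have sl: "s \<longlonglongrightarrow> 0" unfolding s_def by (rule LIMSEQ_inverse_real_of_nat)
  from second_difference[OF f s0, where x=x and i=i and j=j] obtain a b where ab:
    "0 < a n" "a n < s n" "0 < b n" "b n < s n"
    "f (x + s n *\<^sub>R axis i 1 + s n *\<^sub>R axis j 1) - f (x + s n *\<^sub>R axis i 1) - f (x + s n *\<^sub>R axis j 1) + f x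
     = s n * (s n * ?A (x + a n *\<^sub>R axis i 1 + b n *\<^sub>R axis j 1))" for n
    by metis
  from second_difference[OF f s0, where x=x and i=j and j=i] obtain a' b' where ab':
    "0 < a' n" "a' n < s n" "0 < b' n" "b' n < s n"
    "f (x + s n *\<^sub>R axis j 1 + s n *\<^sub>R axis i 1) - f (x + s n *\<^sub>R axis j 1) - f (x + s n *\<^sub>R axis i 1) + f x
     = s n * (s n * ?B (x + a' n *\<^sub>R axis j 1 + b' n *\<^sub>R axis i 1))" for n
    by metis
  have eq: "?A (x + a n *\<^sub>R axis i 1 + b n *\<^sub>R axis j 1) = ?B (x + a' n *\<^sub>R axis j 1 + b' n *\<^sub>R axis i 1)" for n
  proof -
    have "s n * (s n * ?A (x + a n *\<^sub>R axis i 1 + b n *\<^sub>R axis j 1)) =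
          s n * (s n * ?B (x + a' n *\<^sub>R axis j 1 + b' n *\<^sub>R axis i 1))"
      unfolding ab(5)[symmetric] ab'(5)[symmetric] by (simp add: add_ac)
    then show ?thesis using s0[of n] by simp
  qed
  have lim: "c \<longlonglongrightarrow> 0" if "\<And>n. 0 < c n" "\<And>n. c n < s n" for c :: "nat \<Rightarrow> real"
    by (rule tendsto_sandwich[OF _ _ tendsto_const sl]) (use that in \<open>auto intro!: always_eventually less_imp_le\<close>)
  have cont: "isCont ?A z" "isCont ?B z" for z
    using smooth_continuous[of _ UNIV] smooth_partial f by (meson continuous_on_eq_continuous_at open_UNIV UNIV_I)+
  have l: "(\<lambda>n. x + a n *\<^sub>R axis i 1 + b n *\<^sub>R axis j 1) \<longlonglongrightarrow> x + 0 *\<^sub>R axis i 1 + 0 *\<^sub>R axis j 1"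
    by (intro tendsto_intros lim ab)
  have l': "(\<lambda>n. x + a' n *\<^sub>R axis j 1 + b' n *\<^sub>R axis i 1) \<longlonglongrightarrow> x + 0 *\<^sub>R axis j 1 + 0 *\<^sub>R axis i 1"
    by (intro tendsto_intros lim ab')
  have "(\<lambda>n. ?A (x + a n *\<^sub>R axis i 1 + b n *\<^sub>R axis j 1)) \<longlonglongrightarrow> ?A x"
    using isCont_tendsto_compose[OF cont(1) l] by simp
  moreover have "(\<lambda>n. ?A (x + a n *\<^sub>R axis i 1 + b n *\<^sub>R axis j 1)) \<longlonglongrightarrow> ?B x"
    unfolding eq using isCont_tendsto_compose[OF cont(2) l'] by simp
  ultimately show "?B x = ?A x" using LIMSEQ_unique by blast
qed

section \<open>Iterated partial derivatives along words\<close>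

text \<open>Words of coordinates are easier to induct on than multiindices.  The operator \<open>mderiv \<alpha>\<close> is the
special case of the word \<open>mword \<alpha>\<close> below, and for smooth functions only the multiset of letters matters.\<close>

definition pderivs :: "'d list \<Rightarrow> (real ^ 'd::finite \<Rightarrow> real) \<Rightarrow> real ^ 'd \<Rightarrow> real" where
  "pderivs W f = foldr partial_deriv W f"

lemma pderivs_simps [simp]: "pderivs [] f = f" "pderivs (i # W) f = partial_deriv i (pderivs W f)"
  by (simp_all add: pderivs_def)

lemma pderivs_append: "pderivs (V @ W) f = pderivs V (pderivs W f)"
  by (simp add: pderivs_def)

definition mword :: "'d::finite mindex \<Rightarrow> 'd list" where
  "mword \<alpha> = concat (map (\<lambda>i. replicate (\<alpha> i) i) coords)"

lemma coords: "distinct (coords :: 'd::finite list)" "set (coords :: 'd list) = UNIV"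
proof -
  have "\<exists>is. distinct is \<and> set is = (UNIV :: 'd set)"
    using finite_distinct_list[OF finite_class.finite_UNIV] by metis
  from someI_ex[OF this] show "distinct (coords :: 'd::finite list)" "set (coords :: 'd list) = UNIV"
    by (auto simp: coords_def)
qed

lemma mderiv_eq: "mderiv \<alpha> f = pderivs (mword \<alpha>) f"
proof -
  have r: "pderivs (replicate n i) g = (partial_deriv i ^^ n) g" for n and i :: 'a and g
    by (induction n) auto
  have "foldr (\<lambda>i. partial_deriv i ^^ \<alpha> i) is f = pderivs (concat (map (\<lambda>i. replicate (\<alpha> i) i) is)) f" for "is"
    by (induction "is") (auto simp: pderivs_append r)
  then show ?thesis by (simp add: mderiv_def mword_def)
qed

lemma count_mword: "count (mset (mword \<alpha>)) i = \<alpha> i"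
proof -
  have "distinct is \<Longrightarrow> count (mset (concat (map (\<lambda>i. replicate (\<alpha> i) i) is))) i = (if i \<in> set is then \<alpha> i else 0)" for "is"
    by (induction "is") auto
  from this[OF coords(1)] show ?thesis by (simp add: mword_def coords)
qed

lemma length_mword: "length (mword \<alpha>) = mdeg \<alpha>"
proof -
  have "length (mword \<alpha>) = size (mset (mword \<alpha>))" by simp
  also have "\<dots> = (\<Sum>i\<in>UNIV. count (mset (mword \<alpha>)) i)"
    by (subst size_multiset_overloaded_eq, rule sum.mono_neutral_left) (auto simp: not_in_iff)
  finally show ?thesis by (simp add: count_mword mdeg_def)
qed

lemma mset_mword: "mset (mword (count (mset W))) = mset W"
  by (rule multiset_eqI) (simp only: count_mword)

lemma mdeg_count: "mdeg (count (mset W)) = length W"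
  by (metis length_mword mset_mword size_mset)

lemma smooth_pderivs: "smooth f \<Longrightarrow> smooth (pderivs W f)"
  by (induction W) (auto intro: smooth_partial)

lemma pderivs_swap:
  assumes "smooth f" shows "pderivs (V @ [i]) f = pderivs (i # V) f"
  using assms
proof (induction V)
  case (Cons j V)
  then show ?case using partial_deriv_commute[OF smooth_pderivs[OF Cons.prems]] by simp
qed auto

lemma pderivs_perm:
  assumes "smooth f" "mset V = mset W" shows "pderivs V f = pderivs W f"
  using assms(2)
proof (induction V arbitrary: W)
  case (Cons i V)
  then have "i \<in> set W" by (metis list.set_intros(1) set_mset_mset)
  then obtain A B where W: "W = A @ i # B" by (meson split_list)
  then have "mset V = mset (A @ B)" using Cons.prems by simp
  then have "pderivs V f = pderivs (A @ B) f" by (rule Cons.IH)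
  then have "pderivs (i # V) f = pderivs (i # A) (pderivs B f)" by (simp add: pderivs_append)
  also have "\<dots> = pderivs (A @ [i]) (pderivs B f)"
    using pderivs_swap[OF smooth_pderivs[OF assms(1)], of A i B] by simp
  also have "\<dots> = pderivs W f" by (simp add: W pderivs_append)
  finally show ?case .
qed auto

lemma Cr_on_pderivs: "Cr_on r S f \<Longrightarrow> q + length W \<le> r \<Longrightarrow> Cr_on q S (pderivs W f)"
proof (induction W arbitrary: q)
  case (Cons i W)
  have "Cr_on (Suc q) S (pderivs W f)" using Cons.prems by (intro Cons.IH) auto
  then show ?case by (simp add: Cr_on_SucD(2))
qed (auto intro: Cr_on_mono)

lemma pderivs_cong:
  assumes "open S" "\<And>y. y \<in> S \<Longrightarrow> f y = g y" "x \<in> S"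
  shows "pderivs W f x = pderivs W g x"
  using assms(3)
  by (induction W arbitrary: x) (auto intro: partial_deriv_cong[OF assms(1)] assms(2))

lemma pderivs_add_on:
  assumes "open S" "Cr_on r S f" "Cr_on r S g" "length W \<le> r" "x \<in> S"
  shows "pderivs W (\<lambda>x. f x + g x) x = pderivs W f x + pderivs W g x"
  using assms(4,5)
proof (induction W arbitrary: x)
  case (Cons i W)
  have C: "Cr_on 1 S (pderivs W f)" "Cr_on 1 S (pderivs W g)"
    using Cons.prems assms by (auto simp del: Cr_on.simps One_nat_def intro!: Cr_on_pderivs)
  have "pderivs (i # W) (\<lambda>x. f x + g x) x = partial_deriv i (\<lambda>x. pderivs W f x + pderivs W g x) x"
    unfolding pderivs_simps
    by (rule partial_deriv_cong[OF assms(1) Cons.prems(2)]) (use Cons in auto)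
  also have "\<dots> = pderivs (i # W) f x + pderivs (i # W) g x"
    unfolding pderivs_simps
    by (rule partial_deriv_eqI, intro DERIV_add) (use C Cons.prems in \<open>auto intro!: pderiv_works\<close>)
  finally show ?case .
qed auto

lemma pderivs_cmult_on:
  assumes "open S" "Cr_on r S f" "length W \<le> r" "x \<in> S"
  shows "pderivs W (\<lambda>x. c * f x) x = c * pderivs W f x"
  using assms(3,4)
proof (induction W arbitrary: x)
  case (Cons i W)
  have C: "Cr_on 1 S (pderivs W f)"
    using Cons.prems assms by (auto simp del: Cr_on.simps One_nat_def intro!: Cr_on_pderivs)
  have "pderivs (i # W) (\<lambda>x. c * f x) x = partial_deriv i (\<lambda>x. c * pderivs W f x) x"
    unfolding pderivs_simps
    by (rule partial_deriv_cong[OF assms(1) Cons.prems(2)]) (use Cons in auto)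
  also have "\<dots> = c * pderivs (i # W) f x"
    unfolding pderivs_simps
    by (rule partial_deriv_eqI, intro DERIV_cmult) (use C Cons.prems in \<open>auto intro!: pderiv_works\<close>)
  finally show ?case .
qed auto

lemma pderivs_const0: "pderivs W (\<lambda>x. 0) = (\<lambda>x. 0)"
proof (induction W)
  case (Cons i W)
  then show ?case by (auto simp: partial_deriv_def)
qed auto

text \<open>Used for the shape functions, which are only of class \<open>C\<^sup>r\<close> on \<open>\<Omega>\<close>.\<close>

lemma pderivs_sum_on:
  assumes "open S" "\<And>a. a \<in> A \<Longrightarrow> Cr_on r S (f a)" "length W \<le> r" "x \<in> S"
  shows "pderivs W (\<lambda>x. \<Sum>a\<in>A. b a * f a x) x = (\<Sum>a\<in>A. b a * pderivs W (f a) x)"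
  using assms(2)
proof (induction A rule: infinite_finite_induct)
  case (insert a A)
  have "pderivs W (\<lambda>x. \<Sum>a\<in>insert a A. b a * f a x) x =
    pderivs W (\<lambda>x. b a * f a x + (\<Sum>a\<in>A. b a * f a x)) x"
    using insert.hyps by simp
  also have "\<dots> = pderivs W (\<lambda>x. b a * f a x) x + pderivs W (\<lambda>x. \<Sum>a\<in>A. b a * f a x) x"
    by (rule pderivs_add_on[OF assms(1) _ _ assms(3,4)])
       (auto intro!: Cr_on_sum Cr_on_cmult assms(1) insert.prems)
  also have "\<dots> = b a * pderivs W (f a) x + (\<Sum>a\<in>A. b a * pderivs W (f a) x)"
    using insert by (subst pderivs_cmult_on[OF assms(1) insert.prems assms(3,4)]) auto
  finally show ?case using insert.hyps by simp
qed (auto simp: pderivs_const0)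

lemma pderivs_add: "smooth f \<Longrightarrow> smooth g \<Longrightarrow> pderivs W (\<lambda>x. f x + g x) x = pderivs W f x + pderivs W g x"
  unfolding smooth_def using pderivs_add_on[of UNIV _ f g W x] by auto

lemma pderivs_translate: "pderivs W (\<lambda>x. f (x + a)) = (\<lambda>x. pderivs W f (x + a))"
  by (induction W) (auto simp: partial_deriv_translate)

lemma pderivs_zero_off:
  assumes "closed K" "\<And>y. y \<notin> K \<Longrightarrow> f y = 0" "x \<notin> K"
  shows "pderivs W f x = 0"
  using pderivs_cong[of "-K" f "\<lambda>x. 0" x W] assms by (simp add: pderivs_const0 open_Compl)

section \<open>Smooth bump functions\<close>

text \<open>The functions \<open>t\<^sup>-\<^sup>k exp (-1/t)\<close>, extended by zero.  The family is closed under differentiation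
up to linear combinations (\<open>flat_deriv\<close>), so smoothness of all its members follows by one induction.\<close>

definition flat :: "nat \<Rightarrow> real \<Rightarrow> real" where
  "flat k t = (if t > 0 then inverse t ^ k * exp (- inverse t) else 0)"

lemma flat_tendsto: "(flat k \<longlongrightarrow> 0) (at 0)"
proof -
  have "((\<lambda>t::real. inverse t ^ k / exp (inverse t)) \<longlongrightarrow> 0) (at_right 0)"
    by (rule filterlim_compose[OF tendsto_power_div_exp_0 filterlim_inverse_at_top_right])
  then have "(flat k \<longlongrightarrow> 0) (at_right 0)"
    by (rule Lim_transform_eventually)
       (auto simp: flat_def exp_minus divide_inverse eventually_at_filter)
  moreover have "(flat k \<longlongrightarrow> 0) (at_left 0)"
    by (rule Lim_transform_eventually[OF tendsto_const])
       (auto simp: flat_def eventually_at_filter)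
  ultimately show ?thesis by (simp add: filterlim_split_at)
qed

lemma flat_deriv: "(flat k has_field_derivative flat (k + 2) t - real k * flat (k + 1) t) (at t)"
proof (cases t "0::real" rule: linorder_cases)
  case less
  have "((\<lambda>t. 0) has_field_derivative 0) (at t)" by simp
  moreover have "eventually (\<lambda>u. flat k u = 0) (nhds t)"
    using eventually_nhds_in_open[of "{..<0}" t] less by (auto simp: flat_def elim!: eventually_mono)
  ultimately have "(flat k has_field_derivative 0) (at t)"
    using DERIV_cong_ev[of t t "flat k" "\<lambda>t. 0" 0 0] by simp
  then show ?thesis using less by (simp add: flat_def)
next
  case equal
  have "((\<lambda>h. (flat k (0 + h) - flat k 0) / h) \<longlongrightarrow> 0) (at 0)"
    by (rule Lim_transform_eventually[OF flat_tendsto[of "Suc k"]])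
       (auto simp: flat_def eventually_at_filter field_simps)
  then show ?thesis using equal by (simp add: has_field_derivative_iff flat_def)
next
  case greater
  let ?g = "\<lambda>t::real. inverse t ^ k * exp (- inverse t)"
  have 1: "((\<lambda>t::real. inverse t ^ k) has_field_derivative - (real k * inverse t ^ (k + 1))) (at t)"
    using DERIV_power[OF DERIV_inverse[of t], of k] greater
    by (cases k) (auto simp: field_simps power2_eq_square)
  have 2: "((\<lambda>t::real. exp (- inverse t)) has_field_derivative exp (- inverse t) * inverse t ^ 2) (at t)"
    using greater by (auto intro!: derivative_eq_intros simp: field_simps power2_eq_square)
  have "(?g has_field_derivative flat (k + 2) t - real k * flat (k + 1) t) (at t)"
    using DERIV_mult[OF 1 2] greater by (simp add: flat_def power_add power2_eq_square algebra_simps)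
  moreover have "eventually (\<lambda>u. flat k u = ?g u) (nhds t)"
    using eventually_nhds_in_open[of "{0<..}" t] greater by (auto simp: flat_def elim!: eventually_mono)
  ultimately show ?thesis
    using DERIV_cong_ev[of t t "flat k" ?g, OF refl _ refl] by blast
qed

lemma Cr_on_flat: "Cr_on r UNIV (\<lambda>x::real^'d::finite. flat k (x $ i))"
proof (induction r arbitrary: k)
  case 0
  have "continuous_on UNIV (flat k)"
    using flat_deriv DERIV_isCont continuous_at_imp_continuous_on by blast
  then show ?case by (auto intro!: continuous_on_compose2[of UNIV "flat k"] continuous_intros)
next
  case (Suc r)
  have c: "continuous_on UNIV (\<lambda>x::real^'d. flat k (x $ i))"
    using Cr_on_imp_continuous[OF Suc.IH] .
  show ?case
  proof (rule Cr_on_SucI[of _ _ "\<lambda>l x. (if l = i then 1 else 0) * (flat (k + 2) (x $ i) + (- real k) * flat (k + 1) (x $ i))"])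
    fix l and x :: "real^'d"
    have *: "((\<lambda>t. x $ i + t * axis l 1 $ i) has_field_derivative axis l 1 $ i) (at 0)"
      by (auto intro!: derivative_eq_intros)
    show "((\<lambda>t. flat k ((x + t *\<^sub>R axis l 1) $ i)) has_field_derivative
      (if l = i then 1 else 0) * (flat (k + 2) (x $ i) + (- real k) * flat (k + 1) (x $ i))) (at 0)"
      using DERIV_chain2[OF flat_deriv *, of k] by (cases "l = i") (auto simp: axis_def)
  next
    show "Cr_on r UNIV (\<lambda>x. (if l = i then 1 else 0) * (flat (k + 2) (x $ i) + (- real k) * flat (k + 1) (x $ i)))" for l
      by (intro Cr_on_cmult Cr_on_add Suc.IH) auto
  qed (auto simp: c)
qed

lemma smooth_flat: "smooth (\<lambda>x. flat k (c * x $ i + b))"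
  using smooth_affine[of "\<lambda>x. flat k (x $ i)" c "\<chi> i. b"] Cr_on_flat by (auto simp: smooth_def)

definition smooth_step :: "real \<Rightarrow> real" where
  "smooth_step t = flat 0 t * inverse (flat 0 t + flat 0 (1 - t))"

lemma flat_nonneg: "flat k t \<ge> 0" by (simp add: flat_def)
lemma flat_pos: "t > 0 \<Longrightarrow> flat k t > 0" by (simp add: flat_def)

lemma smooth_step_denom: "flat 0 t + flat 0 (1 - t) > 0"
  using flat_nonneg[of 0 t] flat_nonneg[of 0 "1 - t"] flat_pos[of t 0] flat_pos[of "1 - t" 0] by linarith

lemma smooth_smooth_step: "smooth (\<lambda>x. smooth_step (c * x $ i + b))"
proof -
  have "smooth (\<lambda>x. flat 0 (- c * x $ i + (1 - b)))" by (rule smooth_flat)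
  moreover have "(\<lambda>x. flat 0 (1 - (c * x $ i + b))) = (\<lambda>x. flat 0 (- c * x $ i + (1 - b)))"
    by (simp add: algebra_simps)
  ultimately show ?thesis
    unfolding smooth_step_def
    by (intro smooth_mult smooth_inverse smooth_add smooth_flat) (use smooth_step_denom in \<open>auto simp: less_imp_neq[symmetric]\<close>)
qed

lemma smooth_step_bounds: "0 \<le> smooth_step t" "smooth_step t \<le> 1"
  using smooth_step_denom[of t] flat_nonneg[of 0 t] flat_nonneg[of 0 "1 - t"]
  by (auto simp: smooth_step_def field_simps)

lemma smooth_step_eq: "t \<ge> 1 \<Longrightarrow> smooth_step t = 1" "t \<le> 0 \<Longrightarrow> smooth_step t = 0"
  using flat_pos[of t 0] by (auto simp: smooth_step_def flat_def)

text \<open>A plateau function in each coordinate, multiplied over the coordinates.  The plateau is two copies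
of the smooth step back to back.  Its width is the radius divided by twice the dimension, because the
Euclidean norm is estimated by the sum of the coordinates.\<close>

lemma smooth_bump:
  fixes a :: "real ^ 'd::finite"
  assumes "r > 0"
  obtains \<psi> \<rho> where "smooth \<psi>" "\<And>x. 0 \<le> \<psi> x" "\<And>x. \<psi> x \<le> 1" "\<rho> > 0" "\<And>x. x \<in> ball a \<rho> \<Longrightarrow> \<psi> x = 1"
    "\<And>x. x \<notin> cball a r \<Longrightarrow> \<psi> x = 0"
proof -
  define \<delta> where "\<delta> = r / (2 * CARD('d))"
  have \<delta>: "\<delta> > 0" using assms by (simp add: \<delta>_def)
  define \<psi> where "\<psi> x = (\<Prod>i\<in>UNIV. smooth_step ((-1/\<delta>) * x $ i + (2 + a $ i / \<delta>)) *
     smooth_step ((1/\<delta>) * x $ i + (2 - a $ i / \<delta>)))" for x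
  have "smooth \<psi>" unfolding \<psi>_def by (intro smooth_prod smooth_mult smooth_smooth_step)
  moreover have "0 \<le> \<psi> x" for x unfolding \<psi>_def by (intro prod_nonneg ballI mult_nonneg_nonneg smooth_step_bounds)
  moreover have "\<psi> x \<le> 1" for x unfolding \<psi>_def
    by (intro prod_le_1 conjI mult_nonneg_nonneg mult_le_one smooth_step_bounds)
  moreover have "\<psi> x = 1" if "x \<in> ball a \<delta>" for x
  proof -
    have "\<bar>x $ i - a $ i\<bar> \<le> \<delta>" for i
      using that component_le_norm_cart[of "x - a" i] by (simp add: dist_norm norm_minus_commute)
    then have "\<bar>(x $ i - a $ i) / \<delta>\<bar> \<le> 1" for i using \<delta> by simp
    then have "(-1/\<delta>) * x $ i + (2 + a $ i / \<delta>) \<ge> 1 \<and> (1/\<delta>) * x $ i + (2 - a $ i / \<delta>) \<ge> 1" for i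
      by (simp add: abs_le_iff diff_divide_distrib) (smt (verit))
    then show ?thesis unfolding \<psi>_def by (intro prod.neutral) (simp add: smooth_step_eq)
  qed
  moreover have "\<psi> x = 0" if "x \<notin> cball a r" for x
  proof -
    have "\<exists>i. \<bar>x $ i - a $ i\<bar> \<ge> 2 * \<delta>"
    proof (rule ccontr)
      assume "\<not> (\<exists>i. \<bar>x $ i - a $ i\<bar> \<ge> 2 * \<delta>)"
      then have "(\<Sum>i\<in>UNIV. \<bar>(x - a) $ i\<bar>) \<le> (\<Sum>i\<in>(UNIV::'d set). 2 * \<delta>)"
        by (intro sum_mono) (auto simp: not_le less_imp_le)
      then have "norm (x - a) \<le> r" using norm_le_l1_cart[of "x - a"] by (simp add: \<delta>_def)
      then show False using that by (simp add: dist_norm norm_minus_commute)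
    qed
    then obtain i where "\<bar>x $ i - a $ i\<bar> \<ge> 2 * \<delta>" ..
    then have "\<bar>(x $ i - a $ i) / \<delta>\<bar> \<ge> 2" using \<delta> by (simp add: field_simps)
    then have "(-1/\<delta>) * x $ i + (2 + a $ i / \<delta>) \<le> 0 \<or> (1/\<delta>) * x $ i + (2 - a $ i / \<delta>) \<le> 0"
      by (simp add: abs_if diff_divide_distrib split: if_splits)
    then have "smooth_step ((-1/\<delta>) * x $ i + (2 + a $ i / \<delta>)) = 0 \<or> smooth_step ((1/\<delta>) * x $ i + (2 - a $ i / \<delta>)) = 0"
      using smooth_step_eq(2) by blast
    then show ?thesis unfolding \<psi>_def by (intro prod_zero bexI[of _ i]) (simp_all only: mult_eq_0_iff UNIV_I finite_class.finite_UNIV)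
  qed
  ultimately show thesis using that \<delta> by blast
qed

section \<open>Test functions and mollifiers\<close>

text \<open>The path from \<open>x0\<close> to \<open>y\<close> changes one coordinate at a time, so only partial derivatives enter.  It
stays in the ball around \<open>x0\<close> through \<open>y\<close>, so the bound \<open>B\<close> is only required there; the Taylor
estimate depends on this.\<close>

lemma smooth_lipschitz_bound:
  fixes f :: "real ^ 'd::finite \<Rightarrow> real" and B :: real
  assumes f: "smooth f" and B: "\<And>i z. norm (z - x0) \<le> norm (y - x0) \<Longrightarrow> \<bar>partial_deriv i f z\<bar> \<le> B"
  shows "\<bar>f y - f x0\<bar> \<le> CARD('d) * B * norm (y - x0)"
proof -
  define z where "z A = (\<chi> i. if i \<in> A then y $ i else x0 $ i)" for A
  have B0: "B \<ge> 0" using B[of x0 undefined] by simp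
  have "\<bar>f (z A) - f x0\<bar> \<le> (\<Sum>i\<in>A. B * \<bar>y $ i - x0 $ i\<bar>)" if "finite A" for A
    using that
  proof (induction A)
    case empty
    have "z {} = x0" by (simp add: z_def vec_eq_iff)
    then show ?case by simp
  next
    case (insert i A)
    let ?s = "y $ i - x0 $ i"
    have zi: "z (insert i A) = z A + ?s *\<^sub>R axis i 1"
      using insert.hyps by (auto simp: z_def vec_eq_iff axis_def)
    have "\<bar>f (z A + ?s *\<^sub>R axis i 1) - f (z A + 0 *\<^sub>R axis i 1)\<bar> \<le> B * norm (?s - 0)"
      unfolding real_norm_def[symmetric]
    proof (rule field_differentiable_bound[of "closed_segment 0 ?s" "\<lambda>t. f (z A + t *\<^sub>R axis i 1)"
         "\<lambda>t. partial_deriv i f (z A + t *\<^sub>R axis i 1)"])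
      fix t assume t: "t \<in> closed_segment 0 ?s"
      show "((\<lambda>t. f (z A + t *\<^sub>R axis i 1)) has_field_derivative partial_deriv i f (z A + t *\<^sub>R axis i 1))
        (at t within closed_segment 0 ?s)"
        using smooth_DERIV_axis[OF f] has_field_derivative_at_within by blast
      have "\<bar>t\<bar> \<le> \<bar>?s\<bar>" using t by (auto simp: closed_segment_eq_real_ivl split: if_splits)
      then have "norm (z A + t *\<^sub>R axis i 1 - x0) \<le> norm (y - x0)"
        using insert.hyps
        by (intro norm_le_componentwise_cart) (auto simp: z_def axis_def)
      then show "norm (partial_deriv i f (z A + t *\<^sub>R axis i 1)) \<le> B" using B by simp
    qed auto
    then show ?case using insert by (simp add: zi)
  qed
  from this[of UNIV] have "\<bar>f y - f x0\<bar> \<le> (\<Sum>i\<in>UNIV. B * \<bar>y $ i - x0 $ i\<bar>)"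
    by (simp add: z_def)
  also have "\<dots> \<le> (\<Sum>i\<in>(UNIV::'d set). B * norm (y - x0))"
    using B0 component_le_norm_cart[of "y - x0"] by (intro sum_mono mult_left_mono) auto
  finally show ?thesis by simp
qed

lemma test_functions_iff:
  "\<phi> \<in> test_functions \<Omega> \<longleftrightarrow> smooth \<phi> \<and> (\<exists>K. compact K \<and> K \<subseteq> \<Omega> \<and> (\<forall>x. x \<notin> K \<longrightarrow> \<phi> x = 0))"
proof safe
  assume "\<phi> \<in> test_functions \<Omega>"
  then show "smooth \<phi>" "\<exists>K. compact K \<and> K \<subseteq> \<Omega> \<and> (\<forall>x. x \<notin> K \<longrightarrow> \<phi> x = 0)"
    unfolding test_functions_def smooth_def
    using closure_subset[of "{x. \<phi> x \<noteq> 0}"] by (auto intro!: exI[of _ "closure {x. \<phi> x \<noteq> 0}"])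
next
  fix K assume \<phi>: "smooth \<phi>" "compact K" "K \<subseteq> \<Omega>" "\<forall>x. x \<notin> K \<longrightarrow> \<phi> x = 0"
  then have "closure {x. \<phi> x \<noteq> 0} \<subseteq> K"
    by (intro closure_minimal) (auto simp: compact_imp_closed)
  then show "\<phi> \<in> test_functions \<Omega>"
    using \<phi> compact_Int_closed[of K "closure {x. \<phi> x \<noteq> 0}"]
    by (auto simp: test_functions_def smooth_def Int_absorb1)
qed

lemma test_smooth: "\<phi> \<in> test_functions \<Omega> \<Longrightarrow> smooth \<phi>"
  by (simp add: test_functions_iff)

lemma test_pderivs: "\<phi> \<in> test_functions \<Omega> \<Longrightarrow> pderivs W \<phi> \<in> test_functions \<Omega>"
  unfolding test_functions_iff using pderivs_zero_off compact_imp_closed smooth_pderivs by metis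

lemma test_partial: "\<phi> \<in> test_functions \<Omega> \<Longrightarrow> partial_deriv i \<phi> \<in> test_functions \<Omega>"
  using test_pderivs[of \<phi> \<Omega> "[i]"] by simp

lemma test_mult: "smooth \<psi> \<Longrightarrow> \<phi> \<in> test_functions \<Omega> \<Longrightarrow> (\<lambda>x. \<psi> x * \<phi> x) \<in> test_functions \<Omega>"
  unfolding test_functions_iff using smooth_mult by (metis mult_zero_right)

lemma test_UNIV: "\<phi> \<in> test_functions \<Omega> \<Longrightarrow> \<phi> \<in> test_functions UNIV"
  by (auto simp: test_functions_iff)

lemma continuous_compact_support_bounded:
  fixes f :: "'a::euclidean_space \<Rightarrow> real"
  assumes "continuous_on K f" "compact K" "\<And>x. x \<notin> K \<Longrightarrow> f x = 0"
  obtains B where "B \<ge> 0" "\<And>x. \<bar>f x\<bar> \<le> B"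
proof -
  have "bounded (f ` K)" using assms by (intro compact_imp_bounded compact_continuous_image)
  then obtain B where B: "\<And>x. x \<in> K \<Longrightarrow> \<bar>f x\<bar> \<le> B" by (auto simp: bounded_iff)
  have "\<bar>f x\<bar> \<le> max B 0" for x using B[of x] assms(3)[of x] by (cases "x \<in> K") auto
  then show thesis using that[of "max B 0"] by auto
qed

lemma integrable_continuous_compact_support:
  fixes f :: "'a::euclidean_space \<Rightarrow> real"
  assumes "continuous_on UNIV f" "compact K" "\<And>x. x \<notin> K \<Longrightarrow> f x = 0"
  shows "integrable lebesgue f"
proof -
  have "(\<lambda>x. indicator K x *\<^sub>R f x) = f" using assms(3) by (force simp: indicator_def)
  then have "integrable lborel f"
    using borel_integrable_compact[OF assms(2) continuous_on_subset[OF assms(1)]] by auto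
  then show ?thesis using integrable_completion borel_measurable_integrable by blast
qed

lemma test_bounded: assumes "\<phi> \<in> test_functions \<Omega>" obtains B where "B \<ge> 0" "\<And>x. \<bar>\<phi> x\<bar> \<le> B"
  using assms unfolding test_functions_iff
  by (metis continuous_compact_support_bounded smooth_continuous)

lemma test_integrable: "\<phi> \<in> test_functions \<Omega> \<Longrightarrow> integrable lebesgue \<phi>"
  unfolding test_functions_iff using integrable_continuous_compact_support smooth_continuous by metis

lemma test_lipschitz:
  assumes "\<phi> \<in> test_functions \<Omega>"
  obtains L where "L \<ge> 0" "\<And>x y. \<bar>\<phi> x - \<phi> y\<bar> \<le> L * norm (x - y)"
proof -
  have "\<exists>B\<ge>0. \<forall>x. \<bar>partial_deriv i \<phi> x\<bar> \<le> B" for i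
    using test_bounded[OF test_partial[OF assms]] by metis
  then obtain B where B: "\<And>i. B i \<ge> 0" "\<And>i x. \<bar>partial_deriv i \<phi> x\<bar> \<le> B i" by metis
  have *: "\<bar>partial_deriv i \<phi> x\<bar> \<le> (\<Sum>i\<in>UNIV. B i)" for i x
    using B(2)[of i x] member_le_sum[of i UNIV B] B(1) by (simp add: order_trans)
  have "\<bar>\<phi> x - \<phi> y\<bar> \<le> CARD('a) * (\<Sum>i\<in>UNIV. B i) * norm (x - y)" for x y
    using smooth_lipschitz_bound[OF test_smooth[OF assms] *, of x y] by simp
  then show thesis using that[of "CARD('a) * (\<Sum>i\<in>UNIV. B i)"] B(1) by (simp add: sum_nonneg)
qed

text \<open>The centre \<open>a\<close> is arbitrary because the translation along the segment vector is built into the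
kernel.\<close>

lemma mollifier_exists:
  fixes a :: "real ^ 'd::finite"
  assumes "r > 0"
  obtains \<kappa> where "\<kappa> \<in> test_functions UNIV" "\<And>x. \<kappa> x \<ge> 0" "integral\<^sup>L lebesgue \<kappa> = 1"
    "\<And>x. x \<notin> cball a r \<Longrightarrow> \<kappa> x = 0"
proof -
  obtain \<psi> \<rho> where \<psi>: "smooth \<psi>" "\<And>x. 0 \<le> \<psi> x" "\<rho> > 0" "\<And>x. x \<in> ball a \<rho> \<Longrightarrow> \<psi> x = 1"
    "\<And>x. x \<notin> cball a r \<Longrightarrow> \<psi> x = 0"
    using smooth_bump[OF assms, of a] by metis
  have t: "\<psi> \<in> test_functions UNIV" using \<psi> by (auto simp: test_functions_iff intro!: exI[of _ "cball a r"])
  have "integral\<^sup>L lebesgue (indicator (ball a \<rho>)) \<le> integral\<^sup>L lebesgue \<psi>"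
    using \<psi> by (intro integral_mono test_integrable[OF t] integrable_real_indicator)
      (auto simp: indicator_def emeasure_lborel_ball_finite[simplified])
  moreover have "integral\<^sup>L lebesgue (indicator (ball a \<rho>) :: _ \<Rightarrow> real) > 0"
    using content_ball_pos[OF \<psi>(3), of a] by simp
  ultimately have pos: "integral\<^sup>L lebesgue \<psi> > 0" by linarith
  show thesis
  proof (rule that[of "\<lambda>x. inverse (integral\<^sup>L lebesgue \<psi>) * \<psi> x"])
    show "(\<lambda>x. inverse (integral\<^sup>L lebesgue \<psi>) * \<psi> x) \<in> test_functions UNIV"
      using test_mult[OF smooth_const t] .
  qed (use pos \<psi> in auto)
qed

section \<open>Approximation and mollification in Lp\<close>

lemma powr_add_le:
  fixes a b p :: real
  assumes "p \<ge> 1"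
  shows "\<bar>a + b\<bar> powr p \<le> 2 powr p * (\<bar>a\<bar> powr p + \<bar>b\<bar> powr p)"
proof -
  have "\<bar>a + b\<bar> powr p \<le> (2 * max \<bar>a\<bar> \<bar>b\<bar>) powr p"
    using assms by (intro powr_mono2) auto
  also have "\<dots> = 2 powr p * (max \<bar>a\<bar> \<bar>b\<bar>) powr p" by (simp add: powr_mult)
  also have "(max \<bar>a\<bar> \<bar>b\<bar>) powr p \<le> \<bar>a\<bar> powr p + \<bar>b\<bar> powr p" by (simp add: max_def)
  finally show ?thesis by (simp add: mult_left_mono)
qed

lemma nn_integral_powr_add_le:
  assumes "p \<ge> 1" "f \<in> borel_measurable M" "g \<in> borel_measurable M"
    and "(\<integral>\<^sup>+x. \<bar>f x\<bar> powr p \<partial>M) \<le> ennreal a" "(\<integral>\<^sup>+x. \<bar>g x\<bar> powr p \<partial>M) \<le> ennreal b" "a \<ge> 0" "b \<ge> 0"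
  shows "(\<integral>\<^sup>+x. \<bar>f x + g x\<bar> powr p \<partial>M) \<le> ennreal (2 powr p * (a + b))"
proof -
  note assms(2,3)[measurable]
  have "(\<integral>\<^sup>+x. \<bar>f x + g x\<bar> powr p \<partial>M) \<le> (\<integral>\<^sup>+x. ennreal (2 powr p) * (ennreal (\<bar>f x\<bar> powr p) + ennreal (\<bar>g x\<bar> powr p)) \<partial>M)"
    using powr_add_le[OF assms(1)]
    by (intro nn_integral_mono) (simp add: ennreal_mult[symmetric] ennreal_plus[symmetric] ennreal_leI del: ennreal_plus)
  also have "\<dots> = ennreal (2 powr p) * ((\<integral>\<^sup>+x. \<bar>f x\<bar> powr p \<partial>M) + (\<integral>\<^sup>+x. \<bar>g x\<bar> powr p \<partial>M))"
    by (simp add: nn_integral_cmult nn_integral_add)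
  also have "\<dots> \<le> ennreal (2 powr p) * (ennreal a + ennreal b)"
    by (intro mult_left_mono add_mono assms) auto
  also have "\<dots> = ennreal (2 powr p * (a + b))"
    using assms by (simp add: ennreal_mult[symmetric] ennreal_plus[symmetric] del: ennreal_plus)
  finally show ?thesis .
qed

lemma le_one_plus_powr:
  fixes t p :: real assumes "p \<ge> 1" "t \<ge> 0" shows "t \<le> 1 + t powr p"
proof (cases "t \<le> 1")
  case False
  then have "t powr 1 \<le> t powr p" using assms by (intro powr_mono) auto
  then show ?thesis using False by simp
qed (use assms in \<open>auto intro: add_increasing2\<close>)

text \<open>Convexity of \<open>t powr p\<close> on the closed half-line, in the form that yields Jensen's inequality by
integration.\<close>

lemma powr_above_tangent:
  fixes a t p :: real
  assumes "p \<ge> 1" "a \<ge> 0" "t \<ge> 0"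
  shows "t powr p \<ge> a powr p + p * a powr (p - 1) * (t - a)"
proof -
  consider "a = 0" | "a > 0" "t = 0" | "a > 0" "t > 0" using assms by linarith
  then show ?thesis
  proof cases
    case 2
    have "a powr (p - 1) * a = a powr p" using 2 by (simp add: powr_diff)
    then show ?thesis using 2 assms by (simp add: algebra_simps)
  next
    case 3
    have "t powr p - a powr p \<ge> (p * a powr (p - 1)) * (t - a)"
    proof (rule convex_on_imp_above_tangent[OF powr_convex[OF assms(1)]])
      show "((\<lambda>x. x powr p) has_field_derivative p * a powr (p - 1)) (at a within {0<..})"
        using 3 by (auto intro!: derivative_eq_intros)
    qed (use 3 in \<open>auto simp: interior_open\<close>)
    then show ?thesis by simp
  qed simp
qed

lemma nn_integral_translate:
  fixes h :: "'a::euclidean_space \<Rightarrow> ennreal"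
  assumes [measurable]: "h \<in> borel_measurable borel"
  shows "(\<integral>\<^sup>+x. h (x + v) \<partial>lborel) = (\<integral>\<^sup>+x. h x \<partial>lborel)"
  using nn_integral_distr[of "(+) v" lborel borel h] lborel_distr_plus[of v] by (simp add: add.commute)

lemma integral_translate:
  fixes h :: "'a::euclidean_space \<Rightarrow> real"
  assumes [measurable]: "h \<in> borel_measurable borel"
  shows "(\<integral>x. h (x + v) \<partial>lborel) = (\<integral>x. h x \<partial>lborel)"
  using integral_distr[of "(+) v" lborel borel h] lborel_distr_plus[of v] by (simp add: add.commute)

lemma integrable_translate:
  fixes h :: "'a::euclidean_space \<Rightarrow> real"
  assumes [measurable]: "h \<in> borel_measurable borel"
  shows "integrable lborel (\<lambda>x. h (x + v)) \<longleftrightarrow> integrable lborel h"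
  using integrable_distr_eq[of "(+) v" lborel borel h] lborel_distr_plus[of v] by (simp add: add.commute)

text \<open>Truncation in the range and in the domain, with dominated convergence.\<close>

lemma Lp_approx_bounded:
  fixes f :: "'a::euclidean_space \<Rightarrow> real"
  assumes p: "p \<ge> 1" and f[measurable]: "f \<in> borel_measurable borel"
    and int: "integrable lborel (\<lambda>x. \<bar>f x\<bar> powr p)" and \<epsilon>: "\<epsilon> > 0"
  obtains h :: "'a \<Rightarrow> real" and n :: nat where "h \<in> borel_measurable borel" "\<And>x. \<bar>h x\<bar> \<le> n" "\<And>x. norm x > n \<Longrightarrow> h x = 0"
    "(\<integral>\<^sup>+x. \<bar>f x - h x\<bar> powr p \<partial>lborel) \<le> ennreal \<epsilon>"
proof -
  define h where "h n x = (if norm x \<le> real n \<and> \<bar>f x\<bar> \<le> real n then f x else 0)" for n :: nat and x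
  have [measurable]: "h n \<in> borel_measurable borel" for n unfolding h_def by measurable
  have "(\<lambda>n. \<integral>x. \<bar>f x - h n x\<bar> powr p \<partial>lborel) \<longlonglongrightarrow> (\<integral>x. 0 \<partial>(lborel::'a measure))"
  proof (rule integral_dominated_convergence[where w="\<lambda>x. \<bar>f x\<bar> powr p"])
    show "AE x in lborel. (\<lambda>n. \<bar>f x - h n x\<bar> powr p) \<longlonglongrightarrow> 0"
    proof (rule AE_I2, rule tendsto_eventually)
      fix x
      obtain n0 :: nat where n0: "max (norm x) \<bar>f x\<bar> \<le> n0" using real_arch_simple by blast
      show "eventually (\<lambda>n. \<bar>f x - h n x\<bar> powr p = 0) sequentially"
        using eventually_ge_at_top[of n0] by eventually_elim (use n0 in \<open>auto simp: h_def\<close>)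
    qed
    show "AE x in lborel. norm (\<bar>f x - h n x\<bar> powr p) \<le> \<bar>f x\<bar> powr p" for n
      by (auto simp: h_def)
  qed (use int in auto)
  then have "\<forall>\<^sub>F n in sequentially. (\<integral>x. \<bar>f x - h n x\<bar> powr p \<partial>lborel) < \<epsilon>"
    using \<epsilon> by (intro order_tendstoD(2)[of _ 0]) auto
  then obtain n where n: "(\<integral>x. \<bar>f x - h n x\<bar> powr p \<partial>lborel) < \<epsilon>"
    by (auto simp: eventually_sequentially)
  have "integrable lborel (\<lambda>x. \<bar>f x - h n x\<bar> powr p)"
    by (rule Bochner_Integration.integrable_bound[OF int]) (auto simp: h_def)
  then have "(\<integral>\<^sup>+x. \<bar>f x - h n x\<bar> powr p \<partial>lborel) \<le> ennreal \<epsilon>"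
    using n by (subst nn_integral_eq_integral) (auto intro: ennreal_leI)
  then show thesis by (intro that[of "h n" n]) (auto simp: h_def)
qed

text \<open>A Lebesgue measurable function is almost everywhere the limit of continuous functions.  After the
truncation these can be clamped and cut off, so that dominated convergence applies.\<close>

lemma Lp_approx_continuous:
  fixes f :: "'a::euclidean_space \<Rightarrow> real"
  assumes p: "p \<ge> 1" and f[measurable]: "f \<in> borel_measurable borel"
    and int: "integrable lborel (\<lambda>x. \<bar>f x\<bar> powr p)" and \<epsilon>: "\<epsilon> > 0"
  obtains g R where "continuous_on UNIV g" "\<And>x. norm x > R \<Longrightarrow> g x = 0" "R \<ge> 0"
    "(\<integral>\<^sup>+x. \<bar>f x - g x\<bar> powr p \<partial>lborel) \<le> ennreal \<epsilon>"
proof -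
  define e where "e = \<epsilon> / (2 * 2 powr p)"
  have e: "e > 0" using \<epsilon> by (simp add: e_def)
  obtain h :: "'a \<Rightarrow> real" and M :: nat where h[measurable]: "h \<in> borel_measurable borel"
    and hM: "\<And>x. \<bar>h x\<bar> \<le> M" "\<And>x. norm x > M \<Longrightarrow> h x = 0"
    and hf: "(\<integral>\<^sup>+x. \<bar>f x - h x\<bar> powr p \<partial>lborel) \<le> ennreal e"
    using Lp_approx_bounded[OF p f int e] by metis
  have "h measurable_on UNIV"
    by (rule lebesgue_measurable_imp_measurable_on_real) (auto intro: measurable_completion)
  then obtain N g where N: "negligible N" and g: "\<And>n. continuous_on UNIV (g n)"
    and lim: "\<And>x. x \<notin> N \<Longrightarrow> (\<lambda>n. g n x) \<longlonglongrightarrow> h x"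
    by (auto simp: measurable_on_def)
  (* A continuous cut-off, equal to 1 on the ball of radius M, times the clamped sequence. *)
  define k where "k n x = max 0 (min 1 (real M + 1 - norm x)) * max (- real M) (min (real M) (g n x))" for n x
  have kc: "continuous_on UNIV (k n)" for n
    unfolding k_def by (intro continuous_intros g)
  have [measurable]: "k n \<in> borel_measurable borel" for n
    using kc borel_measurable_continuous_onI by blast
  have k0: "k n x = 0" if "norm x > real M + 1" for n x using that by (simp add: k_def)
  have kM: "\<bar>k n x\<bar> \<le> M" for n x
  proof -
    have "\<bar>k n x\<bar> \<le> 1 * real M" unfolding k_def abs_mult by (intro mult_mono) auto
    then show ?thesis by simp
  qed
  have intB: "integrable lborel (\<lambda>x::'a. (2 * real M) powr p * indicator (cball 0 (real M + 1)) x)"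
    by (intro integrable_mult_right integrable_real_indicator) (auto simp: emeasure_lborel_cball_finite[simplified])
  have dom: "\<bar>h x - k n x\<bar> powr p \<le> (2 * real M) powr p * indicator (cball 0 (real M + 1)) x" for n x
  proof (cases "norm x \<le> real M + 1")
    case True
    have "\<bar>h x - k n x\<bar> \<le> 2 * real M" using hM(1)[of x] kM[of n x] by linarith
    then show ?thesis using p True by (auto intro: powr_mono2)
  qed (use hM(2)[of x] k0[of x n] in auto)
  have "(\<lambda>n. \<integral>x. \<bar>h x - k n x\<bar> powr p \<partial>lborel) \<longlonglongrightarrow> (\<integral>x. 0 \<partial>(lborel::'a measure))"
  proof (rule integral_dominated_convergence[OF _ _ intB])
    have "AE x in lebesgue. x \<notin> N" using N by (simp add: negligible_iff_null_sets AE_not_in)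
    then have "AE x in lborel. x \<notin> N" by (simp add: AE_completion_iff)
    then show "AE x in lborel. (\<lambda>n. \<bar>h x - k n x\<bar> powr p) \<longlonglongrightarrow> 0"
    proof eventually_elim
      case (elim x)
      have "(\<lambda>n. k n x) \<longlonglongrightarrow> max 0 (min 1 (real M + 1 - norm x)) * max (- real M) (min (real M) (h x))"
        unfolding k_def by (intro tendsto_intros lim elim)
      moreover have "max 0 (min 1 (real M + 1 - norm x)) * max (- real M) (min (real M) (h x)) = h x"
        using hM(1)[of x] hM(2)[of x] by (cases "norm x \<le> real M") (auto simp: max_def min_def abs_le_iff)
      ultimately have "(\<lambda>n. \<bar>h x - k n x\<bar> powr p) \<longlonglongrightarrow> \<bar>h x - h x\<bar> powr p"
        using p by (intro tendsto_intros) auto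
      then show ?case by simp
    qed
    show "AE x in lborel. norm (\<bar>h x - k n x\<bar> powr p) \<le> (2 * real M) powr p * indicator (cball 0 (real M + 1)) x" for n
      using dom by auto
  qed auto
  then have "\<forall>\<^sub>F n in sequentially. (\<integral>x. \<bar>h x - k n x\<bar> powr p \<partial>lborel) < e"
    using e by (intro order_tendstoD(2)[of _ 0]) auto
  then obtain n where n: "(\<integral>x. \<bar>h x - k n x\<bar> powr p \<partial>lborel) < e"
    by (auto simp: eventually_sequentially)
  have "integrable lborel (\<lambda>x. \<bar>h x - k n x\<bar> powr p)"
    by (rule Bochner_Integration.integrable_bound[OF intB]) (use dom in auto)
  then have hk: "(\<integral>\<^sup>+x. \<bar>h x - k n x\<bar> powr p \<partial>lborel) \<le> ennreal e"
    using n by (subst nn_integral_eq_integral) (auto intro: ennreal_leI)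
  have "(\<integral>\<^sup>+x. \<bar>(f x - h x) + (h x - k n x)\<bar> powr p \<partial>lborel) \<le> ennreal (2 powr p * (e + e))"
    using e by (intro nn_integral_powr_add_le p hf hk) auto
  moreover have "2 powr p * (e + e) = \<epsilon>" by (simp add: e_def)
  ultimately show thesis using that[of "k n" "real M + 1"] kc k0 by simp
qed

text \<open>Clear for a continuous function with bounded support by uniform continuity; the general case
follows by approximation, since translations preserve the integral.\<close>

lemma Lp_translation_continuous:
  fixes f :: "'a::euclidean_space \<Rightarrow> real"
  assumes p: "p \<ge> 1" and f[measurable]: "f \<in> borel_measurable borel"
    and int: "integrable lborel (\<lambda>x. \<bar>f x\<bar> powr p)" and \<epsilon>: "\<epsilon> > 0"
  obtains \<rho> where "\<rho> > 0"
    "\<And>v. norm v \<le> \<rho> \<Longrightarrow> (\<integral>\<^sup>+x. \<bar>f (x + v) - f x\<bar> powr p \<partial>lborel) \<le> ennreal \<epsilon>"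
proof -
  define c where "c = 2 powr p"
  have c: "c > 0" by (simp add: c_def)
  (* Two applications of the inequality for sums give the errors e, e, e the total weight c + 2 c^2. *)
  define e where "e = \<epsilon> / (c + 2 * c\<^sup>2)"
  have e: "e > 0" using \<epsilon> c by (simp add: e_def add_pos_pos)
  obtain g R where gc: "continuous_on UNIV g" and g0: "\<And>x. norm x > R \<Longrightarrow> g x = 0" and R: "R \<ge> 0"
    and fg: "(\<integral>\<^sup>+x. \<bar>f x - g x\<bar> powr p \<partial>lborel) \<le> ennreal e"
    using Lp_approx_continuous[OF p f int e] by metis
  have [measurable]: "g \<in> borel_measurable borel" using gc borel_measurable_continuous_onI by blast
  define V where "V = measure lborel (cball (0::'a) (R + 1))"
  define \<eta> where "\<eta> = (e / (V + 1)) powr (1 / p)"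
  have V: "V \<ge> 0" by (simp add: V_def)
  have \<eta>: "\<eta> > 0" "\<eta> powr p = e / (V + 1)" using e V p by (auto simp: \<eta>_def powr_powr)
  have "uniformly_continuous_on (cball 0 (R + 2)) g"
    by (rule compact_uniformly_continuous) (auto intro: continuous_on_subset[OF gc])
  then obtain d where d: "d > 0" "\<And>x y. x \<in> cball 0 (R + 2) \<Longrightarrow> y \<in> cball 0 (R + 2) \<Longrightarrow> dist x y < d \<Longrightarrow> dist (g x) (g y) < \<eta>"
    unfolding uniformly_continuous_on_def using \<eta>(1) by metis
  define \<rho> where "\<rho> = min 1 (d / 2)"
  show thesis
  proof (rule that)
    show "\<rho> > 0" using d by (simp add: \<rho>_def)
    fix v :: 'a assume v: "norm v \<le> \<rho>"
    have gg: "\<bar>g (x + v) - g x\<bar> powr p \<le> \<eta> powr p * indicator (cball 0 (R + 1)) x" for x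
    proof (cases "norm x \<le> R + 1")
      case True
      have "x + v \<in> cball 0 (R + 2)" using True v norm_triangle_ineq[of x v] by (simp add: \<rho>_def)
      then have "dist (g (x + v)) (g x) < \<eta>" using True v d(1) by (intro d(2)) (simp_all add: \<rho>_def dist_norm)
      then show ?thesis using True p by (auto simp: dist_real_def intro!: powr_mono2)
    next
      case False
      have "norm (x + v) > R" using False v norm_triangle_ineq4[of "x + v" v] by (simp add: \<rho>_def)
      then show ?thesis using False g0[of x] g0[of "x + v"] by simp
    qed
    have "(\<integral>\<^sup>+x. \<bar>g (x + v) - g x\<bar> powr p \<partial>lborel) \<le> (\<integral>\<^sup>+x. ennreal (\<eta> powr p) * indicator (cball (0::'a) (R + 1)) x \<partial>lborel)"
    proof (rule nn_integral_mono)
      fix x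
      show "ennreal (\<bar>g (x + v) - g x\<bar> powr p) \<le> ennreal (\<eta> powr p) * indicator (cball 0 (R + 1)) x"
        using gg[of x] by (cases "norm x \<le> R + 1") (auto intro: ennreal_leI)
    qed
    also have "\<dots> = ennreal (\<eta> powr p) * emeasure lborel (cball (0::'a) (R + 1))"
      by (simp add: nn_integral_cmult_indicator)
    also have "\<dots> = ennreal (\<eta> powr p * V)"
      unfolding V_def by (subst emeasure_eq_ennreal_measure) (use emeasure_lborel_cball_finite[of "0::'a" "R + 1"] in \<open>auto simp: ennreal_mult\<close>)
    also have "\<dots> \<le> ennreal e"
      using V e unfolding \<eta> by (intro ennreal_leI) (simp add: field_simps)
    finally have ggi: "(\<integral>\<^sup>+x. \<bar>g (x + v) - g x\<bar> powr p \<partial>lborel) \<le> ennreal e" .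
    have fgv: "(\<integral>\<^sup>+x. \<bar>f (x + v) - g (x + v)\<bar> powr p \<partial>lborel) \<le> ennreal e"
      using fg nn_integral_translate[of "\<lambda>x. ennreal (\<bar>f x - g x\<bar> powr p)" v] by simp
    have gf: "(\<integral>\<^sup>+x. \<bar>g x - f x\<bar> powr p \<partial>lborel) \<le> ennreal e"
      using fg by (simp add: abs_minus_commute)
    have "(\<integral>\<^sup>+x. \<bar>(f (x + v) - g (x + v)) + ((g (x + v) - g x) + (g x - f x))\<bar> powr p \<partial>lborel)
        \<le> ennreal (c * (e + c * (e + e)))"
      unfolding c_def using e by (intro nn_integral_powr_add_le p fgv ggi gf) auto
    moreover have "c * (e + c * (e + e)) = (c + 2 * c\<^sup>2) * e" by (simp add: algebra_simps power2_eq_square)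
    moreover have "(c + 2 * c\<^sup>2) * e = \<epsilon>"
      using c unfolding e_def by (simp add: add_pos_pos less_imp_neq[symmetric])
    ultimately show "(\<integral>\<^sup>+x. \<bar>f (x + v) - f x\<bar> powr p \<partial>lborel) \<le> ennreal \<epsilon>" by simp
  qed
qed

text \<open>Integrate the tangent inequality at the mean value \<open>a\<close> against the weight.\<close>

lemma weighted_jensen_powr:
  fixes \<kappa> F :: "'a \<Rightarrow> real"
  assumes p: "p \<ge> 1" and \<kappa>: "\<And>x. \<kappa> x \<ge> 0" "integrable M \<kappa>" "integral\<^sup>L M \<kappa> = 1"
    and F: "integrable M (\<lambda>x. \<kappa> x * F x)" "integrable M (\<lambda>x. \<kappa> x * \<bar>F x\<bar> powr p)"
  shows "\<bar>\<integral>x. \<kappa> x * F x \<partial>M\<bar> powr p \<le> (\<integral>x. \<kappa> x * \<bar>F x\<bar> powr p \<partial>M)"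
proof -
  define a where "a = (\<integral>x. \<kappa> x * \<bar>F x\<bar> \<partial>M)"
  have i: "integrable M (\<lambda>x. \<kappa> x * \<bar>F x\<bar>)"
    using integrable_abs[OF F(1)] \<kappa>(1) by (simp add: abs_mult)
  have a0: "a \<ge> 0" unfolding a_def by (intro integral_nonneg_AE) (auto simp: \<kappa>)
  have "\<bar>\<integral>x. \<kappa> x * F x \<partial>M\<bar> \<le> a"
    using integral_abs_bound[of M "\<lambda>x. \<kappa> x * F x"] \<kappa>(1) by (simp add: a_def abs_mult)
  then have "\<bar>\<integral>x. \<kappa> x * F x \<partial>M\<bar> powr p \<le> a powr p" using p by (intro powr_mono2) auto
  also have "a powr p = (\<integral>x. (a powr p - p * a powr (p - 1) * a) * \<kappa> x + (p * a powr (p - 1)) * (\<kappa> x * \<bar>F x\<bar>) \<partial>M)"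
    using \<kappa> i by (simp add: a_def[symmetric])
  also have "\<dots> \<le> (\<integral>x. \<kappa> x * \<bar>F x\<bar> powr p \<partial>M)"
  proof (rule integral_mono)
    fix x
    have "a powr p + p * a powr (p - 1) * (\<bar>F x\<bar> - a) \<le> \<bar>F x\<bar> powr p"
      by (rule powr_above_tangent) (use p a0 in auto)
    from mult_left_mono[OF this \<kappa>(1)[of x]]
    show "(a powr p - p * a powr (p - 1) * a) * \<kappa> x + (p * a powr (p - 1)) * (\<kappa> x * \<bar>F x\<bar>) \<le> \<kappa> x * \<bar>F x\<bar> powr p"
      by (simp add: algebra_simps)
  qed (use \<kappa> i F in auto)
  finally show ?thesis .
qed

lemma test_borel: "\<kappa> \<in> test_functions \<Omega> \<Longrightarrow> \<kappa> \<in> borel_measurable borel"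
  by (rule borel_measurable_continuous_onI) (simp add: smooth_continuous test_smooth)

lemma test_integrable_lborel: "\<kappa> \<in> test_functions \<Omega> \<Longrightarrow> integrable lborel \<kappa>"
  using test_integrable[of \<kappa> \<Omega>] test_borel[of \<kappa> \<Omega>] by (simp add: integrable_completion)

text \<open>Jensen's inequality for the probability density \<open>\<kappa>\<close> bounds the error at \<open>x\<close> by the average of
\<open>|f (x + v) - f x|\<^sup>p\<close>; exchanging the integrals leaves an average of translation errors.  Tonelli's
theorem needs a product of Borel measures, hence the restriction to Borel functions.\<close>

lemma mollify_borel:
  fixes f :: "real ^ 'd::finite \<Rightarrow> real"
  assumes p: "p \<ge> 1" and f[measurable]: "f \<in> borel_measurable borel"
    and int: "integrable lborel (\<lambda>x. \<bar>f x\<bar> powr p)"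
    and \<kappa>: "\<kappa> \<in> test_functions UNIV" "\<And>x. \<kappa> x \<ge> 0" "integral\<^sup>L lborel \<kappa> = 1"
    and close: "\<And>v. \<kappa> v \<noteq> 0 \<Longrightarrow> (\<integral>\<^sup>+x. \<bar>f (x + v) - f x\<bar> powr p \<partial>lborel) \<le> ennreal \<epsilon>"
    and \<epsilon>: "\<epsilon> > 0"
  shows "(\<integral>\<^sup>+x. \<bar>(\<integral>z. \<kappa> (z - x) * f z \<partial>lborel) - f x\<bar> powr p \<partial>lborel) \<le> ennreal \<epsilon>"
proof -
  have [measurable]: "\<kappa> \<in> borel_measurable borel" using test_borel[OF \<kappa>(1)] .
  obtain B where B: "B \<ge> 0" "\<And>x. \<bar>\<kappa> x\<bar> \<le> B" using test_bounded[OF \<kappa>(1)] by blast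
  have \<kappa>i: "integrable lborel \<kappa>" using test_integrable_lborel[OF \<kappa>(1)] .
  have intv: "integrable lborel (\<lambda>v. \<bar>f (x + v)\<bar> powr p)" for x
    using integrable_translate[of "\<lambda>v. \<bar>f v\<bar> powr p" x] int by (simp add: add.commute)
  have pointwise: "ennreal (\<bar>(\<integral>z. \<kappa> (z - x) * f z \<partial>lborel) - f x\<bar> powr p) \<le>
     (\<integral>\<^sup>+v. ennreal (\<kappa> v) * ennreal (\<bar>f (x + v) - f x\<bar> powr p) \<partial>lborel)" for x
  proof -
    have i1: "integrable lborel (\<lambda>v. \<kappa> v * f (x + v))"
    proof (rule Bochner_Integration.integrable_bound)
      show "integrable lborel (\<lambda>v. \<kappa> v + B * \<bar>f (x + v)\<bar> powr p)"
        using \<kappa>i intv by auto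
      show "AE v in lborel. norm (\<kappa> v * f (x + v)) \<le> norm (\<kappa> v + B * \<bar>f (x + v)\<bar> powr p)"
      proof (rule AE_I2)
        fix v
        have "\<kappa> v * \<bar>f (x + v)\<bar> \<le> \<kappa> v * (1 + \<bar>f (x + v)\<bar> powr p)"
          by (intro mult_left_mono le_one_plus_powr p \<kappa>) auto
        also have "\<dots> \<le> \<kappa> v + B * \<bar>f (x + v)\<bar> powr p"
          using B(2)[of v] \<kappa>(2)[of v] by (auto simp: algebra_simps intro!: mult_right_mono)
        finally show "norm (\<kappa> v * f (x + v)) \<le> norm (\<kappa> v + B * \<bar>f (x + v)\<bar> powr p)"
          using \<kappa>(2)[of v] B(1) by (simp add: abs_mult)
      qed
    qed simp
    have "(\<integral>z. \<kappa> (z - x) * f z \<partial>lborel) = (\<integral>v. \<kappa> v * f (x + v) \<partial>lborel)"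
      using integral_translate[of "\<lambda>z. \<kappa> (z - x) * f z" x] by (simp add: add.commute)
    also have "\<dots> - f x = (\<integral>v. \<kappa> v * (f (x + v) - f x) \<partial>lborel)"
      using i1 \<kappa>i \<kappa>(3) by (simp add: right_diff_distrib)
    finally have eq: "(\<integral>z. \<kappa> (z - x) * f z \<partial>lborel) - f x = (\<integral>v. \<kappa> v * (f (x + v) - f x) \<partial>lborel)" .
    have i2: "integrable lborel (\<lambda>v. \<kappa> v * (f (x + v) - f x))"
      using i1 \<kappa>i by (simp add: right_diff_distrib)
    have i3: "integrable lborel (\<lambda>v. \<kappa> v * \<bar>f (x + v) - f x\<bar> powr p)"
    proof (rule Bochner_Integration.integrable_bound)
      show "integrable lborel (\<lambda>v. 2 powr p * (B * \<bar>f (x + v)\<bar> powr p + \<bar>f x\<bar> powr p * \<kappa> v))"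
        using \<kappa>i intv by auto
      show "AE v in lborel. norm (\<kappa> v * \<bar>f (x + v) - f x\<bar> powr p) \<le> norm (2 powr p * (B * \<bar>f (x + v)\<bar> powr p + \<bar>f x\<bar> powr p * \<kappa> v))"
      proof (rule AE_I2)
        fix v
        have "\<kappa> v * \<bar>f (x + v) - f x\<bar> powr p \<le> \<kappa> v * (2 powr p * (\<bar>f (x + v)\<bar> powr p + \<bar>f x\<bar> powr p))"
          using powr_add_le[OF p, of "f (x + v)" "- f x"] by (intro mult_left_mono \<kappa>) auto
        also have "\<dots> = 2 powr p * (\<kappa> v * \<bar>f (x + v)\<bar> powr p + \<bar>f x\<bar> powr p * \<kappa> v)" by (simp add: algebra_simps)
        also have "\<dots> \<le> 2 powr p * (B * \<bar>f (x + v)\<bar> powr p + \<bar>f x\<bar> powr p * \<kappa> v)"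
          using B(2)[of v] \<kappa>(2)[of v] by (intro mult_left_mono add_mono mult_right_mono) auto
        finally show "norm (\<kappa> v * \<bar>f (x + v) - f x\<bar> powr p) \<le> norm (2 powr p * (B * \<bar>f (x + v)\<bar> powr p + \<bar>f x\<bar> powr p * \<kappa> v))"
          using \<kappa>(2)[of v] B(1) by (simp add: abs_mult)
      qed
    qed simp
    have "\<bar>(\<integral>z. \<kappa> (z - x) * f z \<partial>lborel) - f x\<bar> powr p \<le> (\<integral>v. \<kappa> v * \<bar>f (x + v) - f x\<bar> powr p \<partial>lborel)"
      unfolding eq by (rule weighted_jensen_powr[OF p \<kappa>(2) \<kappa>i \<kappa>(3) i2 i3])
    then show ?thesis
      by (subst ennreal_mult[symmetric]) (auto simp: \<kappa> nn_integral_eq_integral[OF i3] intro: ennreal_leI)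
  qed
  have "(\<integral>\<^sup>+x. \<bar>(\<integral>z. \<kappa> (z - x) * f z \<partial>lborel) - f x\<bar> powr p \<partial>lborel) \<le>
    (\<integral>\<^sup>+x. \<integral>\<^sup>+v. ennreal (\<kappa> v) * ennreal (\<bar>f (x + v) - f x\<bar> powr p) \<partial>lborel \<partial>lborel)"
    by (rule nn_integral_mono) (rule pointwise)
  also have "\<dots> = (\<integral>\<^sup>+v. \<integral>\<^sup>+x. ennreal (\<kappa> v) * ennreal (\<bar>f (x + v) - f x\<bar> powr p) \<partial>lborel \<partial>lborel)"
    by (rule lborel_pair.Fubini') measurable
  also have "\<dots> = (\<integral>\<^sup>+v. ennreal (\<kappa> v) * (\<integral>\<^sup>+x. ennreal (\<bar>f (x + v) - f x\<bar> powr p) \<partial>lborel) \<partial>lborel)"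
    by (simp add: nn_integral_cmult)
  also have "\<dots> \<le> (\<integral>\<^sup>+v. ennreal (\<kappa> v) * ennreal \<epsilon> \<partial>lborel)"
  proof (rule nn_integral_mono)
    fix v show "ennreal (\<kappa> v) * (\<integral>\<^sup>+x. ennreal (\<bar>f (x + v) - f x\<bar> powr p) \<partial>lborel) \<le> ennreal (\<kappa> v) * ennreal \<epsilon>"
      using close[of v] by (cases "\<kappa> v = 0") (auto intro: mult_left_mono)
  qed
  also have "\<dots> = (\<integral>\<^sup>+v. ennreal (\<kappa> v) \<partial>lborel) * ennreal \<epsilon>" by (simp add: nn_integral_multc)
  also have "\<dots> = ennreal \<epsilon>" using \<kappa> \<kappa>i by (simp add: nn_integral_eq_integral)
  finally show ?thesis .
qed

lemma integral_lborel_lebesgue: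
  fixes h :: "'a::euclidean_space \<Rightarrow> real"
  assumes "h \<in> borel_measurable borel"
  shows "integral\<^sup>L lebesgue h = integral\<^sup>L lborel h"
  using assms by (simp add: integral_completion)

text \<open>The kernel is not centred: any kernel supported near the origin will do.  The convention
\<open>\<kappa> (z - x)\<close> avoids reflections, so derivatives in \<open>z\<close> of the kernel are translates of derivatives of
\<open>\<kappa>\<close>.\<close>

lemma mollify:
  fixes f :: "real ^ 'd::finite \<Rightarrow> real"
  assumes p: "p \<ge> 1" and f: "f \<in> borel_measurable lebesgue"
    and int: "integrable lebesgue (\<lambda>x. \<bar>f x\<bar> powr p)" and \<epsilon>: "\<epsilon> > 0"
  obtains \<rho> where "\<rho> > 0"
    "\<And>\<kappa> :: real ^ 'd \<Rightarrow> real. \<lbrakk>\<kappa> \<in> test_functions UNIV; \<And>x. \<kappa> x \<ge> 0; integral\<^sup>L lebesgue \<kappa> = 1; \<And>v. norm v > \<rho> \<Longrightarrow> \<kappa> v = 0\<rbrakk> \<Longrightarrow>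
       (\<integral>\<^sup>+x. \<bar>(\<integral>z. \<kappa> (z - x) * f z \<partial>lebesgue) - f x\<bar> powr p \<partial>lebesgue) \<le> ennreal \<epsilon>"
proof -
  obtain g where g[measurable]: "g \<in> borel_measurable borel" and fg: "AE x in lborel. f x = g x"
    using completion_ex_borel_measurable_real[OF f] by auto
  have fg': "AE x in lebesgue. f x = g x" using fg by (rule AE_completion)
  have gl[measurable]: "g \<in> borel_measurable lebesgue" by (auto intro: measurable_completion)
  note f[measurable]
  have "integrable lebesgue (\<lambda>x. \<bar>g x\<bar> powr p)"
    using int by (rule integrable_cong_AE_imp) (use fg' in \<open>auto elim: AE_mp\<close>)
  then have gi: "integrable lborel (\<lambda>x. \<bar>g x\<bar> powr p)" by (simp add: integrable_completion)
  obtain \<rho> where \<rho>: "\<rho> > 0" "\<And>v. norm v \<le> \<rho> \<Longrightarrow> (\<integral>\<^sup>+x. \<bar>g (x + v) - g x\<bar> powr p \<partial>lborel) \<le> ennreal \<epsilon>"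
    using Lp_translation_continuous[OF p g gi \<epsilon>] by metis
  show thesis
  proof (rule that[OF \<rho>(1)])
    fix \<kappa> :: "real ^ 'd \<Rightarrow> real" assume \<kappa>: "\<kappa> \<in> test_functions UNIV" "\<And>x. \<kappa> x \<ge> 0" "integral\<^sup>L lebesgue \<kappa> = 1" "\<And>v. norm v > \<rho> \<Longrightarrow> \<kappa> v = 0"
    have [measurable]: "\<kappa> \<in> borel_measurable borel" using test_borel[OF \<kappa>(1)] .
    have km: "(\<lambda>z. \<kappa> (z - x)) \<in> borel_measurable borel" for x by measurable
    have km'[measurable]: "(\<lambda>z. \<kappa> (z - x)) \<in> borel_measurable lebesgue" for x
      using km[of x] by (auto intro: measurable_completion)
    have conv: "(\<integral>z. \<kappa> (z - x) * f z \<partial>lebesgue) = (\<integral>z. \<kappa> (z - x) * g z \<partial>lborel)" for x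
    proof -
      have "(\<integral>z. \<kappa> (z - x) * f z \<partial>lebesgue) = (\<integral>z. \<kappa> (z - x) * g z \<partial>lebesgue)"
        by (rule integral_cong_AE) (use fg' in \<open>auto elim: AE_mp\<close>)
      then show ?thesis by (simp add: integral_lborel_lebesgue)
    qed
    have "(\<integral>\<^sup>+x. \<bar>(\<integral>z. \<kappa> (z - x) * f z \<partial>lebesgue) - f x\<bar> powr p \<partial>lebesgue) =
      (\<integral>\<^sup>+x. \<bar>(\<integral>z. \<kappa> (z - x) * g z \<partial>lborel) - g x\<bar> powr p \<partial>lebesgue)"
      by (rule nn_integral_cong_AE) (use fg' in \<open>auto simp: conv elim: AE_mp\<close>)
    also have "\<dots> = (\<integral>\<^sup>+x. \<bar>(\<integral>z. \<kappa> (z - x) * g z \<partial>lborel) - g x\<bar> powr p \<partial>lborel)"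
      by (rule nn_integral_completion)
    also have "\<dots> \<le> ennreal \<epsilon>"
    proof (rule mollify_borel[OF p g gi \<kappa>(1,2) _ _ \<epsilon>])
      show "integral\<^sup>L lborel \<kappa> = 1" using \<kappa>(3) by (simp add: integral_lborel_lebesgue)
      show "(\<integral>\<^sup>+x. \<bar>g (x + v) - g x\<bar> powr p \<partial>lborel) \<le> ennreal \<epsilon>" if "\<kappa> v \<noteq> 0" for v
        using \<rho>(2)[of v] \<kappa>(4)[of v] that by force
    qed
    finally show "(\<integral>\<^sup>+x. \<bar>(\<integral>z. \<kappa> (z - x) * f z \<partial>lebesgue) - f x\<bar> powr p \<partial>lebesgue) \<le> ennreal \<epsilon>" .
  qed
qed

section \<open>Mollified functions are smooth\<close>

lemma test_translate:
  assumes "\<phi> \<in> test_functions UNIV"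
  shows "(\<lambda>z. \<phi> (z - x)) \<in> test_functions UNIV"
proof -
  obtain K where K: "compact K" "\<forall>z. z \<notin> K \<longrightarrow> \<phi> z = 0" using assms by (auto simp: test_functions_iff)
  have "smooth (\<lambda>z. \<phi> (z - x))" using smooth_affine[OF test_smooth[OF assms], of 1 "-x"] by simp
  moreover have "\<phi> (z - x) = 0" if "z \<notin> (+) x ` K" for z
    using that K(2)[rule_format, of "z - x"] by force
  ultimately show ?thesis using compact_translation[OF K(1), of x] by (auto simp: test_functions_iff)
qed

lemma integrable_test_mult:
  assumes "\<phi> \<in> test_functions UNIV" "integrable lebesgue f"
  shows "integrable lebesgue (\<lambda>z. \<phi> z * f z)"
proof -
  obtain B where B: "B \<ge> 0" "\<And>x. \<bar>\<phi> x\<bar> \<le> B" using test_bounded[OF assms(1)] by blast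
  have [measurable]: "\<phi> \<in> borel_measurable lebesgue" using test_borel[OF assms(1)] by (auto intro: measurable_completion)
  note borel_measurable_integrable[OF assms(2), measurable]
  show ?thesis
    by (rule Bochner_Integration.integrable_bound[of _ "\<lambda>z. B * f z"])
       (use assms(2) B in \<open>auto simp: abs_mult intro!: mult_right_mono\<close>)
qed

definition mconv :: "(real ^ 'd::finite \<Rightarrow> real) \<Rightarrow> (real ^ 'd \<Rightarrow> real) \<Rightarrow> real ^ 'd \<Rightarrow> real" where
  "mconv \<kappa> f x = (\<integral>z. \<kappa> (z - x) * f z \<partial>lebesgue)"

lemma mconv_integrable:
  "\<kappa> \<in> test_functions UNIV \<Longrightarrow> integrable lebesgue f \<Longrightarrow> integrable lebesgue (\<lambda>z. \<kappa> (z - x) * f z)"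
  using integrable_test_mult[OF test_translate] .

lemma mconv_bounded:
  assumes "\<kappa> \<in> test_functions UNIV" "integrable lebesgue f"
  obtains B where "\<And>x. \<bar>mconv \<kappa> f x\<bar> \<le> B"
proof -
  obtain B where B: "B \<ge> 0" "\<And>x. \<bar>\<kappa> x\<bar> \<le> B" using test_bounded[OF assms(1)] by blast
  have "\<bar>mconv \<kappa> f x\<bar> \<le> (\<integral>z. B * \<bar>f z\<bar> \<partial>lebesgue)" for x
  proof -
    have "\<bar>mconv \<kappa> f x\<bar> \<le> (\<integral>z. \<bar>\<kappa> (z - x) * f z\<bar> \<partial>lebesgue)"
      unfolding mconv_def by (rule integral_abs_bound)
    also have "\<dots> \<le> (\<integral>z. B * \<bar>f z\<bar> \<partial>lebesgue)"
      using integrable_abs[OF mconv_integrable[OF assms, of x]] assms(2) B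
      by (intro integral_mono) (auto simp: abs_mult intro: mult_right_mono)
    finally show ?thesis .
  qed
  then show thesis using that by blast
qed

lemma mconv_continuous:
  assumes "\<kappa> \<in> test_functions UNIV" "integrable lebesgue f"
  shows "continuous_on UNIV (mconv \<kappa> f)"
proof -
  obtain L where L: "L \<ge> 0" "\<And>x y. \<bar>\<kappa> x - \<kappa> y\<bar> \<le> L * norm (x - y)" using test_lipschitz[OF assms(1)] by blast
  have "(L * (\<integral>z. \<bar>f z\<bar> \<partial>lebesgue))-lipschitz_on UNIV (mconv \<kappa> f)"
  proof (rule lipschitz_onI)
    fix x y
    have "mconv \<kappa> f x - mconv \<kappa> f y = (\<integral>z. \<kappa> (z - x) * f z - \<kappa> (z - y) * f z \<partial>lebesgue)"
      unfolding mconv_def using mconv_integrable[OF assms] by simp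
    also have "\<bar>\<dots>\<bar> \<le> (\<integral>z. \<bar>\<kappa> (z - x) * f z - \<kappa> (z - y) * f z\<bar> \<partial>lebesgue)"
      by (rule integral_abs_bound)
    also have "\<dots> \<le> (\<integral>z. (L * dist x y) * \<bar>f z\<bar> \<partial>lebesgue)"
    proof (rule integral_mono)
      show "integrable lebesgue (\<lambda>z. \<bar>\<kappa> (z - x) * f z - \<kappa> (z - y) * f z\<bar>)"
        using mconv_integrable[OF assms] by simp
      show "integrable lebesgue (\<lambda>z. (L * dist x y) * \<bar>f z\<bar>)" using assms(2) by simp
      fix z
      have "\<bar>\<kappa> (z - x) - \<kappa> (z - y)\<bar> \<le> L * dist x y"
        using L(2)[of "z - x" "z - y"] by (simp add: dist_norm norm_minus_commute)
      then show "\<bar>\<kappa> (z - x) * f z - \<kappa> (z - y) * f z\<bar> \<le> (L * dist x y) * \<bar>f z\<bar>"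
        by (metis abs_mult left_diff_distrib abs_ge_zero mult_right_mono)
    qed
    finally show "dist (mconv \<kappa> f x) (mconv \<kappa> f y) \<le> L * (\<integral>z. \<bar>f z\<bar> \<partial>lebesgue) * dist x y"
      by (simp add: dist_real_def mult_ac)
  qed (use L in \<open>auto intro!: mult_nonneg_nonneg integral_nonneg_AE\<close>)
  then show ?thesis by (rule lipschitz_on_continuous_on)
qed

text \<open>Differentiation under the integral sign: the difference quotients of the kernel are dominated by
its Lipschitz constant.\<close>

lemma mconv_deriv:
  assumes \<kappa>: "\<kappa> \<in> test_functions UNIV" and f: "integrable lebesgue f"
  shows "((\<lambda>t. mconv \<kappa> f (x + t *\<^sub>R axis i 1)) has_field_derivative - mconv (partial_deriv i \<kappa>) f x) (at 0)"
  unfolding has_field_derivative_iff tendsto_at_iff_sequentially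
proof (intro allI impI)
  fix h :: "nat \<Rightarrow> real" assume h: "\<forall>n. h n \<in> UNIV - {0}" "h \<longlonglongrightarrow> 0"
  obtain L where L: "L \<ge> 0" "\<And>x y. \<bar>\<kappa> x - \<kappa> y\<bar> \<le> L * norm (x - y)" using test_lipschitz[OF \<kappa>] by blast
  let ?q = "\<lambda>n z. (\<kappa> (z - (x + h n *\<^sub>R axis i 1)) - \<kappa> (z - x)) / h n * f z"
  have h0: "h n \<noteq> 0" for n using h(1) by auto
  have qint: "integrable lebesgue (?q n)" for n
    using mconv_integrable[OF assms, of "x + h n *\<^sub>R axis i 1"] mconv_integrable[OF assms, of x]
    by (simp add: diff_divide_distrib left_diff_distrib)
  have lim: "(\<lambda>n. integral\<^sup>L lebesgue (?q n)) \<longlonglongrightarrow> (\<integral>z. - partial_deriv i \<kappa> (z - x) * f z \<partial>lebesgue)"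
  proof (rule integral_dominated_convergence[where w="\<lambda>z. L * \<bar>f z\<bar>"])
    show "(\<lambda>z. - partial_deriv i \<kappa> (z - x) * f z) \<in> borel_measurable lebesgue"
      using borel_measurable_integrable[OF mconv_integrable[OF test_partial[OF \<kappa>] f, of i x]] by simp
    show "?q n \<in> borel_measurable lebesgue" for n using qint by (rule borel_measurable_integrable)
    show "integrable lebesgue (\<lambda>z. L * \<bar>f z\<bar>)" using f by simp
    show "AE z in lebesgue. (\<lambda>n. ?q n z) \<longlonglongrightarrow> - partial_deriv i \<kappa> (z - x) * f z"
    proof (rule AE_I2, rule tendsto_mult_right)
      fix z
      have D: "((\<lambda>t. \<kappa> (z - x + t *\<^sub>R axis i 1)) has_field_derivative partial_deriv i \<kappa> (z - x)) (at 0)"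
        by (rule smooth_deriv[OF test_smooth[OF \<kappa>]])
      have "((\<lambda>t. \<kappa> (z - x + (- t) *\<^sub>R axis i 1)) has_field_derivative - partial_deriv i \<kappa> (z - x)) (at 0)"
        using DERIV_chain2[where f="\<lambda>t. \<kappa> (z - x + t *\<^sub>R axis i 1)" and g=uminus and x="0::real" and Db="-1" and s=UNIV]
          D DERIV_minus[OF DERIV_ident, of 0 UNIV] by simp
      then have "((\<lambda>t. (\<kappa> (z - x - t *\<^sub>R axis i 1) - \<kappa> (z - x)) / t) \<longlongrightarrow> - partial_deriv i \<kappa> (z - x)) (at 0)"
        by (simp add: has_field_derivative_iff)
      then show "(\<lambda>n. (\<kappa> (z - (x + h n *\<^sub>R axis i 1)) - \<kappa> (z - x)) / h n) \<longlonglongrightarrow> - partial_deriv i \<kappa> (z - x)"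
        unfolding tendsto_at_iff_sequentially using h by (auto simp: o_def diff_diff_eq)
    qed
    show "AE z in lebesgue. norm (?q n z) \<le> L * \<bar>f z\<bar>" for n
    proof (rule AE_I2)
      fix z
      have "\<bar>\<kappa> (z - (x + h n *\<^sub>R axis i 1)) - \<kappa> (z - x)\<bar> \<le> L * \<bar>h n\<bar>"
        using L(2)[of "z - (x + h n *\<^sub>R axis i 1)" "z - x"] by simp
      then have "\<bar>\<kappa> (z - (x + h n *\<^sub>R axis i 1)) - \<kappa> (z - x)\<bar> / \<bar>h n\<bar> \<le> L"
        using h0[of n] by (simp add: field_simps)
      then show "norm (?q n z) \<le> L * \<bar>f z\<bar>"
        unfolding real_norm_def abs_mult abs_divide by (rule mult_right_mono) simp
    qed
  qed
  have q: "integral\<^sup>L lebesgue (?q n) = (mconv \<kappa> f (x + h n *\<^sub>R axis i 1) - mconv \<kappa> f x) / h n" for n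
    unfolding mconv_def using mconv_integrable[OF assms, of "x + h n *\<^sub>R axis i 1"] mconv_integrable[OF assms, of x]
    by (simp add: left_diff_distrib diff_divide_distrib)
  have "(\<integral>z. - partial_deriv i \<kappa> (z - x) * f z \<partial>lebesgue) = - mconv (partial_deriv i \<kappa>) f x"
    by (simp add: mconv_def)
  with lim show "((\<lambda>t. (mconv \<kappa> f (x + t *\<^sub>R axis i 1) - mconv \<kappa> f (x + 0 *\<^sub>R axis i 1)) / (t - 0)) \<circ> h)
     \<longlonglongrightarrow> - mconv (partial_deriv i \<kappa>) f x"
    unfolding q by (simp add: o_def)
qed

lemma mconv_smooth:
  assumes \<kappa>: "\<kappa> \<in> test_functions UNIV" and f: "integrable lebesgue f"
  shows "smooth (mconv \<kappa> f)"
proof -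
  have "Cr_on r UNIV (mconv \<kappa> f)" if "\<kappa> \<in> test_functions UNIV" for r \<kappa>
    using that
  proof (induction r arbitrary: \<kappa>)
    case (Suc r)
    show ?case
      by (rule Cr_on_SucI[OF open_UNIV mconv_continuous[OF Suc.prems f], of "\<lambda>i x. (-1) * mconv (partial_deriv i \<kappa>) f x"])
         (use mconv_deriv[OF Suc.prems f] in simp, intro Cr_on_cmult Suc.IH test_partial Suc.prems open_UNIV)
  qed (simp add: mconv_continuous f)
  then show ?thesis using \<kappa> by (simp add: smooth_def)
qed

lemma mconv_pderivs:
  assumes \<kappa>: "\<kappa> \<in> test_functions UNIV" and f: "integrable lebesgue f"
  shows "pderivs W (mconv \<kappa> f) = (\<lambda>x. (-1) ^ length W * mconv (pderivs W \<kappa>) f x)"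
proof (induction W)
  case (Cons i W)
  have t: "pderivs W \<kappa> \<in> test_functions UNIV" using test_pderivs[OF \<kappa>] .
  have "partial_deriv i (mconv (pderivs W \<kappa>) f) = (\<lambda>x. - mconv (partial_deriv i (pderivs W \<kappa>)) f x)"
    by (rule ext, rule partial_deriv_eqI, rule mconv_deriv[OF t f])
  then show ?case
    using partial_deriv_cmult[OF mconv_smooth[OF t f], of i "(-1) ^ length W"] by (simp add: Cons.IH)
qed simp

section \<open>Weak derivatives\<close>

text \<open>By translation invariance the difference quotients of \<open>F\<close> have integral zero, and they converge
dominatedly to \<open>G\<close>.\<close>

lemma integral_directional_deriv_zero:
  fixes F :: "real ^ 'd::finite \<Rightarrow> real"
  assumes cont: "continuous_on UNIV F" and K: "compact K" "\<And>x. x \<notin> K \<Longrightarrow> F x = 0"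
    and D: "\<And>x. ((\<lambda>t. F (x + t *\<^sub>R axis i 1)) has_field_derivative G x) (at 0)"
    and B: "\<And>x. \<bar>G x\<bar> \<le> B"
  shows "integral\<^sup>L lebesgue G = 0"
proof -
  define h where "h n = inverse (real (Suc n))" for n
  have h0: "h n > 0" "h n \<le> 1" for n by (auto simp: h_def inverse_le_1_iff)
  have hl: "h \<longlonglongrightarrow> 0" unfolding h_def by (rule LIMSEQ_inverse_real_of_nat)
  have [measurable]: "F \<in> borel_measurable borel" using cont by (rule borel_measurable_continuous_onI)
  define q where "q n x = (F (x + h n *\<^sub>R axis i 1) - F x) / h n" for n x
  have [measurable]: "q n \<in> borel_measurable borel" for n unfolding q_def by measurable
  have lim: "(\<lambda>n. q n x) \<longlonglongrightarrow> G x" for x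
    using D[of x] h0(1) hl unfolding has_field_derivative_iff tendsto_at_iff_sequentially
    by (auto simp: q_def o_def less_imp_neq[symmetric])
  have [measurable]: "G \<in> borel_measurable borel"
    by (rule borel_measurable_LIMSEQ_real[where u=q]) (use lim in auto)
  obtain R where R: "\<And>x. x \<in> K \<Longrightarrow> norm x \<le> R" "R \<ge> 0"
    using compact_imp_bounded[OF K(1)] by (metis bounded_pos less_imp_le)
  have B0: "B \<ge> 0" using B[of 0] by linarith
  have intF: "integrable lborel F"
    using integrable_continuous_compact_support[OF cont K] by (simp add: integrable_completion)
  have qbound: "\<bar>q n x\<bar> \<le> B * indicator (cball 0 (R + 1)) x" for n x
  proof (cases "norm x \<le> R + 1")
    case True
    have "\<bar>F (x + h n *\<^sub>R axis i 1) - F (x + 0 *\<^sub>R axis i 1)\<bar> \<le> B * norm (h n - 0)"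
      unfolding real_norm_def[symmetric]
      by (rule field_differentiable_bound[of UNIV "\<lambda>t. F (x + t *\<^sub>R axis i 1)" "\<lambda>t. G (x + t *\<^sub>R axis i 1)"])
         (use DERIV_axis_shift[of F x, OF D] B in auto)
    then show ?thesis using True h0[of n] by (simp add: q_def field_simps)
  next
    case False
    have "norm x \<le> norm (x + h n *\<^sub>R axis i 1) + norm (h n *\<^sub>R (axis i 1 :: real ^ 'd))"
      using norm_triangle_ineq4[of "x + h n *\<^sub>R axis i 1" "h n *\<^sub>R axis i 1"] by simp
    then have "norm (x + h n *\<^sub>R axis i 1) > R" using False h0[of n] by simp
    then have "F (x + h n *\<^sub>R axis i 1) = 0" "F x = 0" using R(1) K(2) False R(2) by force+
    then show ?thesis using False by (simp add: q_def)
  qed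
  have "(\<lambda>n. integral\<^sup>L lborel (q n)) \<longlonglongrightarrow> integral\<^sup>L lborel G"
  proof (rule integral_dominated_convergence[where w="\<lambda>x. B * indicator (cball 0 (R + 1)) x"])
    show "integrable lborel (\<lambda>x::real^'d. B * indicator (cball 0 (R + 1)) x)"
      by (intro integrable_mult_right integrable_real_indicator) (auto simp: emeasure_lborel_cball_finite[simplified])
  qed (use lim qbound in auto)
  moreover have "integral\<^sup>L lborel (q n) = 0" for n
  proof -
    have "integral\<^sup>L lborel (q n) = ((\<integral>x. F (x + h n *\<^sub>R axis i 1) \<partial>lborel) - integral\<^sup>L lborel F) / h n"
      using intF integrable_translate[of F "h n *\<^sub>R axis i 1"] unfolding q_def by simp
    then show ?thesis using integral_translate[of F "h n *\<^sub>R axis i 1"] by simp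
  qed
  ultimately have "integral\<^sup>L lborel G = 0" using LIMSEQ_unique[OF _ tendsto_const] by force
  then show ?thesis by (simp add: integral_lborel_lebesgue)
qed

lemma continuous_on_zero_extension:
  fixes h :: "'a::t2_space \<Rightarrow> real"
  assumes "open \<Omega>" "continuous_on \<Omega> h" "compact K" "K \<subseteq> \<Omega>" "\<And>x. x \<notin> K \<Longrightarrow> h x = 0"
  shows "continuous_on UNIV h"
proof -
  have "continuous_on (- K) h" using assms(5) continuous_on_cong[of "-K" "-K" h "\<lambda>x. 0"] by auto
  then have "continuous_on (\<Omega> \<union> - K) h"
    using assms by (intro continuous_on_open_Un) (auto simp: compact_imp_closed open_Compl)
  moreover have "\<Omega> \<union> - K = UNIV" using assms(4) by auto
  ultimately show ?thesis by simp
qed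

text \<open>The product \<open>g \<phi>\<close>, extended by zero, is continuous with partial derivatives everywhere, even though
\<open>g\<close> is arbitrary outside \<open>\<Omega>\<close>.\<close>

lemma integration_by_parts:
  assumes \<Omega>: "open \<Omega>" and g: "Cr_on (Suc 0) \<Omega> g" and \<phi>: "\<phi> \<in> test_functions \<Omega>"
  shows "(\<integral>x. g x * partial_deriv i \<phi> x \<partial>lebesgue) = - (\<integral>x. partial_deriv i g x * \<phi> x \<partial>lebesgue)"
proof -
  obtain K where K: "compact K" "K \<subseteq> \<Omega>" "\<And>x. x \<notin> K \<Longrightarrow> \<phi> x = 0"
    using \<phi> by (auto simp: test_functions_iff)
  have K': "x \<notin> K \<Longrightarrow> partial_deriv i \<phi> x = 0" for x
    using pderivs_zero_off[where K=K and f=\<phi> and x=x and W="[i]"] K compact_imp_closed by auto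
  note sm = test_smooth[OF \<phi>] smooth_partial[OF test_smooth[OF \<phi>], of i]
  have gc: "continuous_on \<Omega> g" "continuous_on \<Omega> (partial_deriv i g)" using g by auto
  have c1: "continuous_on UNIV (\<lambda>x. g x * partial_deriv i \<phi> x)"
    by (rule continuous_on_zero_extension[OF \<Omega> _ K(1,2)]) (auto intro!: continuous_intros gc smooth_continuous[OF sm(1)] smooth_continuous[OF sm(2)] simp: K')
  have c2: "continuous_on UNIV (\<lambda>x. partial_deriv i g x * \<phi> x)"
    by (rule continuous_on_zero_extension[OF \<Omega> _ K(1,2)]) (auto intro!: continuous_intros gc smooth_continuous[OF sm(1)] smooth_continuous[OF sm(2)] simp: K)
  have c3: "continuous_on UNIV (\<lambda>x. g x * \<phi> x)"
    by (rule continuous_on_zero_extension[OF \<Omega> _ K(1,2)]) (auto intro!: continuous_intros gc smooth_continuous[OF sm(1)] smooth_continuous[OF sm(2)] simp: K)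
  have i1: "integrable lebesgue (\<lambda>x. g x * partial_deriv i \<phi> x)"
    by (rule integrable_continuous_compact_support[OF c1 K(1)]) (simp add: K')
  have i2: "integrable lebesgue (\<lambda>x. partial_deriv i g x * \<phi> x)"
    by (rule integrable_continuous_compact_support[OF c2 K(1)]) (simp add: K)
  let ?G = "\<lambda>x. partial_deriv i g x * \<phi> x + g x * partial_deriv i \<phi> x"
  have "continuous_on K ?G" using continuous_on_add[OF c2 c1] continuous_on_subset by blast
  then obtain B where B: "\<And>x. \<bar>?G x\<bar> \<le> B"
    by (rule continuous_compact_support_bounded[OF _ K(1), of ?G]) (auto simp: K(3) K')
  have "integral\<^sup>L lebesgue ?G = 0"
  proof (rule integral_directional_deriv_zero[OF c3 K(1) _ _ B])
    fix x
    show "((\<lambda>t. g (x + t *\<^sub>R axis i 1) * \<phi> (x + t *\<^sub>R axis i 1)) has_field_derivative ?G x) (at 0)"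
    proof (cases "x \<in> \<Omega>")
      case True
      show ?thesis
        using DERIV_mult[OF Cr_on_SucD(1)[OF g True, where i=i] smooth_deriv[OF sm(1), where x=x and i=i]] by (simp add: mult.commute)
    next
      case False
      then have "x \<in> - K" using K(2) by auto
      have "((\<lambda>t. g (x + t *\<^sub>R axis i 1) * \<phi> (x + t *\<^sub>R axis i 1)) has_field_derivative 0) (at 0)"
        by (subst pderiv_cong[where f="\<lambda>x. g x * \<phi> x" and g="\<lambda>x. 0" and S="- K", OF _ \<open>x \<in> - K\<close>])
           (auto simp: K compact_imp_closed open_Compl)
      then show ?thesis using K(3)[of x] K'[of x] \<open>x \<in> - K\<close> by simp
    qed
  qed (simp add: K)
  then show ?thesis using i1 i2 by simp
qed

lemma integral_lebesgue_on_zero_off: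
  fixes h :: "'a::euclidean_space \<Rightarrow> real"
  assumes "S \<in> sets lebesgue" "\<And>x. x \<notin> S \<Longrightarrow> h x = 0"
  shows "integral\<^sup>L (lebesgue_on S) h = integral\<^sup>L lebesgue h"
    and "integrable (lebesgue_on S) h \<longleftrightarrow> integrable lebesgue h"
proof -
  have "(\<lambda>x. if x \<in> S then h x else 0) = h" using assms(2) by auto
  then show "integral\<^sup>L (lebesgue_on S) h = integral\<^sup>L lebesgue h"
    "integrable (lebesgue_on S) h \<longleftrightarrow> integrable lebesgue h"
    using Lebesgue_Measure.integral_restrict_UNIV[OF assms(1), of h] Lebesgue_Measure.integrable_restrict_UNIV[OF assms(1), of h] by simp_all
qed

lemma open_sets_lebesgue: "open S \<Longrightarrow> S \<in> sets lebesgue"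
  by (simp add: borel_open)

text \<open>Integrability is kept apart from the identity, since membership in \<open>L\<^sup>p\<close> provides it on the bounded
set \<open>\<Omega>\<close>.\<close>

definition wderiv :: "(real ^ 'd::finite) set \<Rightarrow> 'd list \<Rightarrow> (real ^ 'd \<Rightarrow> real) \<Rightarrow> (real ^ 'd \<Rightarrow> real) \<Rightarrow> bool" where
  "wderiv \<Omega> W u v \<longleftrightarrow> (\<forall>\<phi>\<in>test_functions \<Omega>.
     (\<integral>x. u x * pderivs W \<phi> x \<partial>lebesgue_on \<Omega>) = (-1) ^ length W * (\<integral>x. v x * \<phi> x \<partial>lebesgue_on \<Omega>))"

lemma has_weak_deriv_iff:
  "has_weak_deriv \<Omega> \<alpha> u v \<longleftrightarrow> locally_integrable \<Omega> u \<and> locally_integrable \<Omega> v \<and> wderiv \<Omega> (mword \<alpha>) u v"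
  by (simp add: has_weak_deriv_def wderiv_def mderiv_eq length_mword)

lemma wderiv_perm: "wderiv \<Omega> V u v \<Longrightarrow> mset V = mset W \<Longrightarrow> wderiv \<Omega> W u v"
  unfolding wderiv_def using pderivs_perm[OF test_smooth] by (metis size_mset)

lemma wderiv_Nil: "wderiv \<Omega> [] u u" by (simp add: wderiv_def)

lemma wderiv_cong:
  assumes "\<And>x. x \<in> \<Omega> \<Longrightarrow> u x = u' x" "\<And>x. x \<in> \<Omega> \<Longrightarrow> v x = v' x" "wderiv \<Omega> W u v"
  shows "wderiv \<Omega> W u' v'"
proof -
  have "(\<integral>x. u' x * g x \<partial>lebesgue_on \<Omega>) = (\<integral>x. u x * g x \<partial>lebesgue_on \<Omega>)"
    "(\<integral>x. v' x * g x \<partial>lebesgue_on \<Omega>) = (\<integral>x. v x * g x \<partial>lebesgue_on \<Omega>)" for g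
    by (auto intro!: Bochner_Integration.integral_cong simp: assms(1,2))
  then show ?thesis using assms(3) by (simp add: wderiv_def)
qed

lemma wderiv_Cons: "wderiv \<Omega> [i] u g \<Longrightarrow> wderiv \<Omega> W g h \<Longrightarrow> wderiv \<Omega> (i # W) u h"
  unfolding wderiv_def using test_pderivs[of _ \<Omega> W] by simp

lemma wderiv_Cons_D: "wderiv \<Omega> [i] u g \<Longrightarrow> wderiv \<Omega> (i # W) u h \<Longrightarrow> wderiv \<Omega> W g h"
  unfolding wderiv_def using test_pderivs[of _ \<Omega> W] by simp

lemma integrable_on_test_mult:
  assumes "\<phi> \<in> test_functions UNIV" "integrable (lebesgue_on \<Omega>) u" "\<Omega> \<in> sets lebesgue"
  shows "integrable (lebesgue_on \<Omega>) (\<lambda>x. u x * \<phi> x)" "integrable (lebesgue_on \<Omega>) (\<lambda>x. \<phi> x * u x)"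
proof -
  have "integrable lebesgue (\<lambda>x. \<phi> x * (if x \<in> \<Omega> then u x else 0))"
    using assms by (intro integrable_test_mult) (simp_all add: Lebesgue_Measure.integrable_restrict_UNIV)
  moreover have "(\<lambda>x. \<phi> x * (if x \<in> \<Omega> then u x else 0)) = (\<lambda>x. if x \<in> \<Omega> then \<phi> x * u x else 0)" by auto
  ultimately show "integrable (lebesgue_on \<Omega>) (\<lambda>x. \<phi> x * u x)"
    using Lebesgue_Measure.integrable_restrict_UNIV[OF assms(3), of "\<lambda>x. \<phi> x * u x"] by simp
  then show "integrable (lebesgue_on \<Omega>) (\<lambda>x. u x * \<phi> x)" by (simp add: mult.commute)
qed

lemma wderiv_add:
  assumes "wderiv \<Omega> W u v" "wderiv \<Omega> W u' v'" and \<Omega>: "\<Omega> \<in> sets lebesgue"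
    and i: "integrable (lebesgue_on \<Omega>) u" "integrable (lebesgue_on \<Omega>) v" "integrable (lebesgue_on \<Omega>) u'" "integrable (lebesgue_on \<Omega>) v'"
  shows "wderiv \<Omega> W (\<lambda>x. u x + u' x) (\<lambda>x. v x + v' x)"
  unfolding wderiv_def
proof
  fix \<phi> assume \<phi>: "\<phi> \<in> test_functions \<Omega>"
  note t = test_UNIV[OF \<phi>] test_pderivs[OF test_UNIV[OF \<phi>], of W]
  have "(\<integral>x. (u x + u' x) * pderivs W \<phi> x \<partial>lebesgue_on \<Omega>) =
     (\<integral>x. u x * pderivs W \<phi> x \<partial>lebesgue_on \<Omega>) + (\<integral>x. u' x * pderivs W \<phi> x \<partial>lebesgue_on \<Omega>)"
    unfolding distrib_right by (intro Bochner_Integration.integral_add integrable_on_test_mult t i \<Omega>)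
  also have "\<dots> = (-1) ^ length W * ((\<integral>x. v x * \<phi> x \<partial>lebesgue_on \<Omega>) + (\<integral>x. v' x * \<phi> x \<partial>lebesgue_on \<Omega>))"
    using assms(1,2) \<phi> by (simp add: wderiv_def distrib_left)
  also have "(\<integral>x. v x * \<phi> x \<partial>lebesgue_on \<Omega>) + (\<integral>x. v' x * \<phi> x \<partial>lebesgue_on \<Omega>) = (\<integral>x. (v x + v' x) * \<phi> x \<partial>lebesgue_on \<Omega>)"
    unfolding distrib_right by (intro Bochner_Integration.integral_add[symmetric] integrable_on_test_mult t i \<Omega>)
  finally show "(\<integral>x. (u x + u' x) * pderivs W \<phi> x \<partial>lebesgue_on \<Omega>) =
     (-1) ^ length W * (\<integral>x. (v x + v' x) * \<phi> x \<partial>lebesgue_on \<Omega>)" .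
qed

lemma wderiv_cmult:
  assumes "wderiv \<Omega> W u v"
  shows "wderiv \<Omega> W (\<lambda>x. c * u x) (\<lambda>x. c * v x)"
  using assms by (auto simp: wderiv_def mult.assoc)

text \<open>The Leibniz rule of first order: test the weak derivative of \<open>u\<close> with \<open>\<psi> \<phi>\<close>.\<close>

lemma wderiv_mult:
  assumes \<psi>: "\<psi> \<in> test_functions UNIV" and w: "wderiv \<Omega> [i] u g" and \<Omega>: "\<Omega> \<in> sets lebesgue"
    and int: "integrable (lebesgue_on \<Omega>) u" "integrable (lebesgue_on \<Omega>) g"
  shows "wderiv \<Omega> [i] (\<lambda>x. \<psi> x * u x) (\<lambda>x. partial_deriv i \<psi> x * u x + \<psi> x * g x)"
  unfolding wderiv_def
proof
  fix \<phi> assume \<phi>: "\<phi> \<in> test_functions \<Omega>"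
  let ?I = "\<lambda>f. integral\<^sup>L (lebesgue_on \<Omega>) f"
  note s = test_smooth[OF \<psi>] test_smooth[OF \<phi>]
  note tU = test_UNIV[OF \<phi>]
  have \<psi>\<phi>: "(\<lambda>x. \<psi> x * \<phi> x) \<in> test_functions \<Omega>" by (rule test_mult[OF s(1) \<phi>])
  have i1: "integrable (lebesgue_on \<Omega>) (\<lambda>x. u x * (partial_deriv i \<psi> x * \<phi> x))"
    by (intro integrable_on_test_mult test_mult smooth_partial s tU int \<Omega>)
  have i2: "integrable (lebesgue_on \<Omega>) (\<lambda>x. u x * (\<psi> x * partial_deriv i \<phi> x))"
    by (intro integrable_on_test_mult test_mult test_partial s tU int \<Omega>)
  have i3: "integrable (lebesgue_on \<Omega>) (\<lambda>x. g x * (\<psi> x * \<phi> x))"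
    by (intro integrable_on_test_mult test_mult s tU int \<Omega>)
  have "?I (\<lambda>x. u x * partial_deriv i (\<lambda>x. \<psi> x * \<phi> x) x) = - ?I (\<lambda>x. g x * (\<psi> x * \<phi> x))"
    using w \<psi>\<phi> unfolding wderiv_def by simp
  moreover have "?I (\<lambda>x. u x * partial_deriv i (\<lambda>x. \<psi> x * \<phi> x) x) =
    ?I (\<lambda>x. u x * (partial_deriv i \<psi> x * \<phi> x)) + ?I (\<lambda>x. u x * (\<psi> x * partial_deriv i \<phi> x))"
    unfolding partial_deriv_mult[OF s] by (subst Bochner_Integration.integral_add[OF i1 i2, symmetric]) (simp add: algebra_simps)
  moreover have "?I (\<lambda>x. (partial_deriv i \<psi> x * u x + \<psi> x * g x) * \<phi> x) =
    ?I (\<lambda>x. u x * (partial_deriv i \<psi> x * \<phi> x)) + ?I (\<lambda>x. g x * (\<psi> x * \<phi> x))"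
    by (subst Bochner_Integration.integral_add[OF i1 i3, symmetric]) (simp add: algebra_simps)
  ultimately show "?I (\<lambda>x. \<psi> x * u x * pderivs [i] \<phi> x) =
      (-1) ^ length [i] * ?I (\<lambda>x. (partial_deriv i \<psi> x * u x + \<psi> x * g x) * \<phi> x)"
    by (simp add: algebra_simps)
qed

text \<open>Integration by parts moves the derivatives from the test function to \<open>g\<close> in reverse order.  The
order is restored on the test function, where all orders of differentiation are known to commute.\<close>

lemma wderiv_classical:
  assumes \<Omega>: "open \<Omega>" and g: "Cr_on r \<Omega> g" and W: "length W \<le> r"
  shows "wderiv \<Omega> W g (pderivs W g)"
proof -
  have "wderiv \<Omega> (rev W) g (pderivs W g)" using W
  proof (induction W)
    case (Cons i V)
    have IH: "wderiv \<Omega> (rev V) g (pderivs V g)" using Cons by simp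
    have C: "Cr_on (Suc 0) \<Omega> (pderivs V g)" by (rule Cr_on_pderivs[OF g]) (use Cons in simp)
    show ?case unfolding wderiv_def
    proof
      fix \<phi> assume \<phi>: "\<phi> \<in> test_functions \<Omega>"
      have z: "x \<notin> \<Omega> \<Longrightarrow> \<phi> x = 0" "x \<notin> \<Omega> \<Longrightarrow> partial_deriv i \<phi> x = 0" for x
        using \<phi> test_partial[OF \<phi>, of i] by (auto simp: test_functions_iff)
      have "(\<integral>x. g x * pderivs (rev (i # V)) \<phi> x \<partial>lebesgue_on \<Omega>) =
        (-1) ^ length V * (\<integral>x. pderivs V g x * partial_deriv i \<phi> x \<partial>lebesgue_on \<Omega>)"
        using IH test_partial[OF \<phi>, of i] by (simp add: wderiv_def pderivs_append)
      also have "(\<integral>x. pderivs V g x * partial_deriv i \<phi> x \<partial>lebesgue_on \<Omega>) =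
         - (\<integral>x. partial_deriv i (pderivs V g) x * \<phi> x \<partial>lebesgue_on \<Omega>)"
        using integration_by_parts[OF \<Omega> C \<phi>, of i]
        by (simp add: integral_lebesgue_on_zero_off open_sets_lebesgue[OF \<Omega>] z)
      finally show "(\<integral>x. g x * pderivs (rev (i # V)) \<phi> x \<partial>lebesgue_on \<Omega>) =
        (-1) ^ length (rev (i # V)) * (\<integral>x. pderivs (i # V) g x * \<phi> x \<partial>lebesgue_on \<Omega>)" by simp
    qed
  qed (simp add: wderiv_Nil)
  then show ?thesis by (rule wderiv_perm) simp
qed

section \<open>Uniqueness of weak derivatives\<close>

text \<open>Where the kernels \<open>\<kappa> (z - x)\<close> are test functions, the mollification of \<open>v\<close> vanishes; but it is also
close to \<open>v\<close> in \<open>L\<^sup>1\<close>.\<close>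

lemma fundamental_lemma_ball:
  fixes v :: "real ^ 'd::finite \<Rightarrow> real"
  assumes v: "locally_integrable \<Omega> v" and \<Omega>: "open \<Omega>"
    and zero: "\<And>\<phi>. \<phi> \<in> test_functions \<Omega> \<Longrightarrow> (\<integral>x. v x * \<phi> x \<partial>lebesgue_on \<Omega>) = 0"
    and r: "r > 0" "cball x0 (2 * r) \<subseteq> \<Omega>"
  shows "AE x in lebesgue. x \<in> ball x0 r \<longrightarrow> v x = 0"
proof -
  define f where "f x = (if x \<in> cball x0 (2 * r) then v x else 0)" for x
  have "integrable (lebesgue_on (cball x0 (2 * r))) v"
    using v r(2) by (simp add: locally_integrable_def)
  then have fi: "integrable lebesgue f"
    unfolding f_def by (subst Lebesgue_Measure.integrable_restrict_UNIV) auto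
  note [measurable] = borel_measurable_integrable[OF fi]
  have b[measurable]: "ball x0 r \<in> sets lebesgue" by simp
  have "(\<integral>\<^sup>+x. ennreal \<bar>f x\<bar> * indicator (ball x0 r) x \<partial>lebesgue) \<le> 0 + ennreal \<epsilon>" if \<epsilon>: "\<epsilon> > 0" for \<epsilon>
  proof -
    obtain \<rho> where \<rho>: "\<rho> > 0"
      "\<And>\<kappa> :: real ^ 'd \<Rightarrow> real. \<lbrakk>\<kappa> \<in> test_functions UNIV; \<And>x. \<kappa> x \<ge> 0; integral\<^sup>L lebesgue \<kappa> = 1; \<And>v. norm v > \<rho> \<Longrightarrow> \<kappa> v = 0\<rbrakk> \<Longrightarrow>
       (\<integral>\<^sup>+x. \<bar>(\<integral>z. \<kappa> (z - x) * f z \<partial>lebesgue) - f x\<bar> powr 1 \<partial>lebesgue) \<le> ennreal \<epsilon>"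
      using mollify[of 1 f \<epsilon>] fi \<epsilon> by (auto simp: integrable_abs)
    define \<delta> where "\<delta> = min \<rho> r"
    have \<delta>: "\<delta> > 0" "\<delta> \<le> \<rho>" "\<delta> \<le> r" using \<rho> r by (auto simp: \<delta>_def)
    obtain \<kappa> :: "real ^ 'd \<Rightarrow> real" where \<kappa>: "\<kappa> \<in> test_functions UNIV" "\<And>x. \<kappa> x \<ge> 0" "integral\<^sup>L lebesgue \<kappa> = 1"
      "\<And>x. x \<notin> cball 0 \<delta> \<Longrightarrow> \<kappa> x = 0"
      using mollifier_exists[OF \<delta>(1), of 0] by metis
    have conv0: "(\<integral>z. \<kappa> (z - x) * f z \<partial>lebesgue) = 0" if x: "x \<in> ball x0 r" for x
    proof -
      have sub: "cball x \<delta> \<subseteq> cball x0 (2 * r)" using x \<delta>(3) by (auto simp: cball_subset_cball_iff dist_commute)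
      have z: "\<kappa> (z - x) = 0" if "z \<notin> cball x \<delta>" for z using that \<kappa>(4)[of "z - x"] by (simp add: dist_norm norm_minus_commute)
      have t: "(\<lambda>z. \<kappa> (z - x)) \<in> test_functions \<Omega>"
        unfolding test_functions_iff
        by (intro conjI exI[of _ "cball x \<delta>"] test_smooth[OF test_translate[OF \<kappa>(1)]]) (use sub r z in auto)
      have "\<kappa> (z - x) * f z = v z * \<kappa> (z - x)" for z
        using z[of z] sub by (cases "z \<in> cball x \<delta>") (auto simp: f_def)
      then have "(\<integral>z. \<kappa> (z - x) * f z \<partial>lebesgue) = (\<integral>z. v z * \<kappa> (z - x) \<partial>lebesgue)" by (simp only:)
      also have "\<dots> = (\<integral>z. v z * \<kappa> (z - x) \<partial>lebesgue_on \<Omega>)"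
      proof (rule integral_lebesgue_on_zero_off(1)[OF open_sets_lebesgue[OF \<Omega>], symmetric])
        fix y assume "y \<notin> \<Omega>"
        then have "y \<notin> cball x \<delta>" using sub r(2) by blast
        then show "v y * \<kappa> (y - x) = 0" using z by simp
      qed
      also have "\<dots> = 0" by (rule zero[OF t])
      finally show ?thesis .
    qed
    have "(\<integral>\<^sup>+x. ennreal \<bar>f x\<bar> * indicator (ball x0 r) x \<partial>lebesgue) \<le>
      (\<integral>\<^sup>+x. \<bar>(\<integral>z. \<kappa> (z - x) * f z \<partial>lebesgue) - f x\<bar> powr 1 \<partial>lebesgue)"
      by (rule nn_integral_mono) (auto simp: indicator_def conv0)
    also have "\<dots> \<le> ennreal \<epsilon>" by (rule \<rho>(2)) (use \<kappa> \<delta> in auto)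
    finally show ?thesis by simp
  qed
  then have "(\<integral>\<^sup>+x. ennreal \<bar>f x\<bar> * indicator (ball x0 r) x \<partial>lebesgue) \<le> 0"
    by (rule ennreal_le_epsilon)
  then have "AE x in lebesgue. ennreal \<bar>f x\<bar> * indicator (ball x0 r) x = 0"
    by (subst nn_integral_0_iff_AE[symmetric]) auto
  then show ?thesis
    by eventually_elim (use r in \<open>auto simp: f_def indicator_def split: if_splits\<close>)
qed

text \<open>Countably many of the balls of the previous lemma cover \<open>\<Omega>\<close>.\<close>

lemma fundamental_lemma:
  fixes v :: "real ^ 'd::finite \<Rightarrow> real"
  assumes v: "locally_integrable \<Omega> v" and \<Omega>: "open \<Omega>"
    and zero: "\<And>\<phi>. \<phi> \<in> test_functions \<Omega> \<Longrightarrow> (\<integral>x. v x * \<phi> x \<partial>lebesgue_on \<Omega>) = 0"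
  shows "AE x in lebesgue_on \<Omega>. v x = 0"
proof -
  define F where "F = {U. open U \<and> (AE x in lebesgue. x \<in> U \<longrightarrow> v x = 0)}"
  have "\<Omega> \<subseteq> \<Union>F"
  proof
    fix x assume "x \<in> \<Omega>"
    then obtain e where e: "e > 0" "cball x e \<subseteq> \<Omega>" using \<Omega> open_contains_cball by blast
    then have "AE y in lebesgue. y \<in> ball x (e / 2) \<longrightarrow> v y = 0"
      by (intro fundamental_lemma_ball[OF v \<Omega> zero]) auto
    then have "ball x (e / 2) \<in> F" by (simp add: F_def)
    then show "x \<in> \<Union>F" using e by (intro UnionI[of "ball x (e/2)"]) auto
  qed
  moreover obtain F' where F': "F' \<subseteq> F" "countable F'" "\<Union>F' = \<Union>F"
    using Lindelof[of F] by (auto simp: F_def)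
  have "AE x in lebesgue. \<forall>U\<in>F'. x \<in> U \<longrightarrow> v x = 0"
    using F'(1) by (subst AE_ball_countable[OF F'(2)]) (auto simp: F_def)
  ultimately have "AE x in lebesgue. x \<in> \<Omega> \<longrightarrow> v x = 0"
    using F'(3) by (auto elim!: eventually_mono)
  then show ?thesis by (simp add: AE_restrict_space_iff open_sets_lebesgue[OF \<Omega>])
qed

lemma locally_integrable_diff:
  "locally_integrable \<Omega> u \<Longrightarrow> locally_integrable \<Omega> v \<Longrightarrow> locally_integrable \<Omega> (\<lambda>x. u x - v x)"
  by (simp add: locally_integrable_def)

lemma locally_integrable_test_mult:
  assumes "locally_integrable \<Omega> u" "\<phi> \<in> test_functions \<Omega>" "open \<Omega>"
  shows "integrable (lebesgue_on \<Omega>) (\<lambda>x. u x * \<phi> x)"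
proof -
  obtain K where K: "compact K" "K \<subseteq> \<Omega>" "\<And>x. x \<notin> K \<Longrightarrow> \<phi> x = 0"
    using assms(2) by (auto simp: test_functions_iff)
  have KL: "K \<in> sets lebesgue" using K(1) by (simp add: borel_compact)
  have "integrable (lebesgue_on K) (\<lambda>x. u x * \<phi> x)"
    using assms(1) K by (intro integrable_on_test_mult test_UNIV[OF assms(2)] KL) (auto simp: locally_integrable_def)
  then have "integrable lebesgue (\<lambda>x. u x * \<phi> x)"
    using integral_lebesgue_on_zero_off(2)[OF KL, of "\<lambda>x. u x * \<phi> x"] K(3) by simp
  then show ?thesis
    using integral_lebesgue_on_zero_off(2)[OF open_sets_lebesgue[OF assms(3)], of "\<lambda>x. u x * \<phi> x"] K(2,3) by auto
qed

lemma weak_deriv_unique: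
  assumes \<Omega>: "open \<Omega>" and "has_weak_deriv \<Omega> \<alpha> u v" "has_weak_deriv \<Omega> \<alpha> u v'"
  shows "AE x in lebesgue_on \<Omega>. v x = v' x"
proof -
  have l: "locally_integrable \<Omega> v" "locally_integrable \<Omega> v'" using assms by (auto simp: has_weak_deriv_def)
  have "AE x in lebesgue_on \<Omega>. v x - v' x = 0"
  proof (rule fundamental_lemma[OF locally_integrable_diff[OF l] \<Omega>])
    fix \<phi> assume \<phi>: "\<phi> \<in> test_functions \<Omega>"
    have "(-1) ^ mdeg \<alpha> * (\<integral>x. v x * \<phi> x \<partial>lebesgue_on \<Omega>) = (-1) ^ mdeg \<alpha> * (\<integral>x. v' x * \<phi> x \<partial>lebesgue_on \<Omega>)"
      using bspec[OF conjunct2[OF conjunct2[OF assms(2)[unfolded has_weak_deriv_def]]] \<phi>]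
        bspec[OF conjunct2[OF conjunct2[OF assms(3)[unfolded has_weak_deriv_def]]] \<phi>] by (rule trans[OF sym])
    then have "(\<integral>x. v x * \<phi> x \<partial>lebesgue_on \<Omega>) = (\<integral>x. v' x * \<phi> x \<partial>lebesgue_on \<Omega>)" by simp
    then show "(\<integral>x. (v x - v' x) * \<phi> x \<partial>lebesgue_on \<Omega>) = 0"
      using locally_integrable_test_mult[OF l(1) \<phi> \<Omega>] locally_integrable_test_mult[OF l(2) \<phi> \<Omega>]
      by (simp add: left_diff_distrib)
  qed
  then show ?thesis by simp
qed

section \<open>Density of smooth functions under the segment condition\<close>

lemma is_domain_finite_measure:
  assumes "is_domain \<Omega>"
  shows "\<Omega> \<in> sets lebesgue" "emeasure lebesgue \<Omega> < \<infinity>" "integrable (lebesgue_on \<Omega>) (\<lambda>x. c :: real)"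
proof -
  show s: "\<Omega> \<in> sets lebesgue" using assms by (simp add: is_domain_def open_sets_lebesgue)
  show e: "emeasure lebesgue \<Omega> < \<infinity>"
    using assms emeasure_bounded_finite[of \<Omega>] by (simp add: is_domain_def borel_open)
  show "integrable (lebesgue_on \<Omega>) (\<lambda>x. c)"
    using finite_measure_lebesgue_on[of \<Omega>] s e finite_measure.integrable_const fmeasurableI by blast
qed

lemma Lp_integrable:
  assumes "is_domain \<Omega>" "p \<ge> 1" "f \<in> Lp_functions \<Omega> p"
  shows "integrable (lebesgue_on \<Omega>) f"
proof (rule Bochner_Integration.integrable_bound)
  show "integrable (lebesgue_on \<Omega>) (\<lambda>x. 1 + \<bar>f x\<bar> powr p)"
    using is_domain_finite_measure(3)[OF assms(1)] assms(3) by (auto simp: Lp_functions_def)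
  show "f \<in> borel_measurable (lebesgue_on \<Omega>)" using assms(3) by (simp add: Lp_functions_def)
  show "AE x in lebesgue_on \<Omega>. norm (f x) \<le> norm (1 + \<bar>f x\<bar> powr p)"
    using le_one_plus_powr[OF assms(2), of "\<bar>f x\<bar>" for x] by auto
qed

lemma Lp_locally_integrable:
  assumes "is_domain \<Omega>" "p \<ge> 1" "f \<in> Lp_functions \<Omega> p"
  shows "locally_integrable \<Omega> f"
  unfolding locally_integrable_def
proof safe
  fix K assume K: "compact K" "K \<subseteq> \<Omega>"
  have "integrable lebesgue (\<lambda>x. if x \<in> \<Omega> then f x else 0)"
    using Lp_integrable[OF assms] is_domain_finite_measure(1)[OF assms(1)]
    by (subst Lebesgue_Measure.integrable_restrict_UNIV)
  then have "integrable lebesgue (\<lambda>x. indicator K x *\<^sub>R (if x \<in> \<Omega> then f x else 0))"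
    using K by (intro integrable_mult_indicator) (simp_all add: borel_compact)
  moreover have "(\<lambda>x. indicator K x *\<^sub>R (if x \<in> \<Omega> then f x else 0)) = (\<lambda>x. if x \<in> K then f x else 0)"
    using K(2) by (auto simp: indicator_def fun_eq_iff)
  ultimately have "integrable lebesgue (\<lambda>x. if x \<in> K then f x else 0)" by simp
  then show "integrable (lebesgue_on K) f"
    using K(1) by (subst (asm) Lebesgue_Measure.integrable_restrict_UNIV) (simp_all add: borel_compact)
qed

lemma Lp_add:
  assumes "p \<ge> 1" "f \<in> Lp_functions \<Omega> p" "g \<in> Lp_functions \<Omega> p"
  shows "(\<lambda>x. f x + g x) \<in> Lp_functions \<Omega> p"
proof -
  have [measurable]: "f \<in> borel_measurable (lebesgue_on \<Omega>)" "g \<in> borel_measurable (lebesgue_on \<Omega>)"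
    using assms by (auto simp: Lp_functions_def)
  have "integrable (lebesgue_on \<Omega>) (\<lambda>x. \<bar>f x + g x\<bar> powr p)"
  proof (rule Bochner_Integration.integrable_bound)
    show "integrable (lebesgue_on \<Omega>) (\<lambda>x. 2 powr p * (\<bar>f x\<bar> powr p + \<bar>g x\<bar> powr p))"
      using assms by (auto simp: Lp_functions_def)
    show "AE x in lebesgue_on \<Omega>. norm (\<bar>f x + g x\<bar> powr p) \<le> norm (2 powr p * (\<bar>f x\<bar> powr p + \<bar>g x\<bar> powr p))"
      using powr_add_le[OF assms(1), of "f x" "g x" for x] by auto
  qed simp
  then show ?thesis by (simp add: Lp_functions_def)
qed

lemma Lp_bounded_mult:
  assumes "p \<ge> 1" "f \<in> Lp_functions \<Omega> p" "\<psi> \<in> borel_measurable (lebesgue_on \<Omega>)" "\<And>x. x \<in> \<Omega> \<Longrightarrow> \<bar>\<psi> x\<bar> \<le> B"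
  shows "(\<lambda>x. \<psi> x * f x) \<in> Lp_functions \<Omega> p"
proof -
  have [measurable]: "f \<in> borel_measurable (lebesgue_on \<Omega>)" "\<psi> \<in> borel_measurable (lebesgue_on \<Omega>)"
    using assms by (auto simp: Lp_functions_def)
  have "integrable (lebesgue_on \<Omega>) (\<lambda>x. \<bar>\<psi> x * f x\<bar> powr p)"
  proof (rule Bochner_Integration.integrable_bound)
    show "integrable (lebesgue_on \<Omega>) (\<lambda>x. B powr p * \<bar>f x\<bar> powr p)"
      using assms by (auto simp: Lp_functions_def)
    show "AE x in lebesgue_on \<Omega>. norm (\<bar>\<psi> x * f x\<bar> powr p) \<le> norm (B powr p * \<bar>f x\<bar> powr p)"
      using assms(1,4) by (intro AE_I2) (auto simp: abs_mult powr_mult intro!: mult_right_mono powr_mono2)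
  qed simp
  then show ?thesis by (simp add: Lp_functions_def)
qed

lemma test_measurable_on: "\<psi> \<in> test_functions S \<Longrightarrow> \<psi> \<in> borel_measurable (lebesgue_on \<Omega>)"
  using test_borel[of \<psi> S] by (intro measurable_restrict_space1) (auto intro: measurable_completion)

lemma Lp_test_mult:
  assumes "p \<ge> 1" "f \<in> Lp_functions \<Omega> p" "\<psi> \<in> test_functions UNIV"
  shows "(\<lambda>x. \<psi> x * f x) \<in> Lp_functions \<Omega> p"
  using test_bounded[OF assms(3)] Lp_bounded_mult[OF assms(1,2) test_measurable_on[OF assms(3)]] by metis

text \<open>Iterating the first-order rule gives the existence of weak derivatives without writing down the
general Leibniz formula.  The derivatives are moreover zero, not just almost everywhere zero, off the
support of \<open>\<psi>\<close>, which lets mollified derivatives be computed pointwise later.\<close>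

lemma leibniz_support:
  fixes \<Omega> :: "(real ^ 'd::finite) set"
  assumes \<Omega>: "is_domain \<Omega>" and p: "p \<ge> 1" and C: "closed C"
    and "\<psi> \<in> test_functions UNIV" "\<And>x. x \<notin> C \<Longrightarrow> \<psi> x = 0" "u \<in> Lp_functions \<Omega> p"
    and "\<And>V. length V \<le> length W \<Longrightarrow> \<exists>v\<in>Lp_functions \<Omega> p. wderiv \<Omega> V u v"
  shows "\<exists>v\<in>Lp_functions \<Omega> p. wderiv \<Omega> W (\<lambda>x. \<psi> x * u x) v \<and> (\<forall>x. x \<notin> C \<longrightarrow> v x = 0)"
  using assms(4-)
proof (induction W arbitrary: u \<psi>)
  case Nil
  then show ?case using wderiv_Nil Lp_test_mult[OF p Nil(3,1)] by (intro bexI[of _ "\<lambda>x. \<psi> x * u x"]) auto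
next
  case (Cons i W)
  obtain g where g: "g \<in> Lp_functions \<Omega> p" "wderiv \<Omega> [i] u g" using Cons.prems(4)[of "[i]"] by auto
  have gd: "\<exists>v\<in>Lp_functions \<Omega> p. wderiv \<Omega> V g v" if "length V \<le> length W" for V
    using Cons.prems(4)[of "i # V"] that wderiv_Cons_D[OF g(2)] by fastforce
  have t: "partial_deriv i \<psi> \<in> test_functions UNIV" using test_partial[OF Cons.prems(1)] .
  have z: "partial_deriv i \<psi> x = 0" if "x \<notin> C" for x
    using pderivs_zero_off[where K=C and f=\<psi> and x=x and W="[i]"] C Cons.prems(2) that by simp
  obtain v1 where v1: "v1 \<in> Lp_functions \<Omega> p" "wderiv \<Omega> W (\<lambda>x. partial_deriv i \<psi> x * u x) v1" "\<forall>x. x \<notin> C \<longrightarrow> v1 x = 0"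
    using Cons.IH[OF t z Cons.prems(3)] Cons.prems(4) by force
  obtain v2 where v2: "v2 \<in> Lp_functions \<Omega> p" "wderiv \<Omega> W (\<lambda>x. \<psi> x * g x) v2" "\<forall>x. x \<notin> C \<longrightarrow> v2 x = 0"
    using Cons.IH[OF Cons.prems(1,2) g(1) gd] by blast
  note m = is_domain_finite_measure(1)[OF \<Omega>] and I = Lp_integrable[OF \<Omega> p]
  have "wderiv \<Omega> W (\<lambda>x. partial_deriv i \<psi> x * u x + \<psi> x * g x) (\<lambda>x. v1 x + v2 x)"
    by (intro wderiv_add v1 v2 m I Lp_test_mult[OF p] t Cons.prems g)
  moreover have "wderiv \<Omega> [i] (\<lambda>x. \<psi> x * u x) (\<lambda>x. partial_deriv i \<psi> x * u x + \<psi> x * g x)"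
    by (intro wderiv_mult Cons.prems g m I)
  ultimately have "wderiv \<Omega> (i # W) (\<lambda>x. \<psi> x * u x) (\<lambda>x. v1 x + v2 x)" by (rule wderiv_Cons[rotated])
  then show ?case using v1 v2 Lp_add[OF p v1(1) v2(1)] by (intro bexI[of _ "\<lambda>x. v1 x + v2 x"]) auto
qed

text \<open>The weak derivatives may be chosen separately for each word, which makes approximants easy to add;
uniqueness of weak derivatives makes the choice irrelevant.  The bounds on all derivatives over the
whole space serve the Taylor remainder at nodes outside \<open>\<Omega>\<close>.\<close>

definition smooth_approximant ::
  "(real ^ 'd::finite) set \<Rightarrow> nat \<Rightarrow> real \<Rightarrow> (real ^ 'd \<Rightarrow> real) \<Rightarrow> real \<Rightarrow> (real ^ 'd \<Rightarrow> real) \<Rightarrow> bool" where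
  "smooth_approximant \<Omega> j p u \<epsilon> \<Phi> \<longleftrightarrow> smooth \<Phi> \<and> (\<forall>W. \<exists>B. \<forall>x. \<bar>pderivs W \<Phi> x\<bar> \<le> B) \<and>
     (\<forall>W. length W \<le> j \<longrightarrow> (\<exists>v\<in>Lp_functions \<Omega> p. wderiv \<Omega> W u v \<and>
        (\<integral>\<^sup>+x. \<bar>pderivs W \<Phi> x - v x\<bar> powr p \<partial>lebesgue_on \<Omega>) \<le> ennreal \<epsilon>))"

definition smooth_approximable :: "(real ^ 'd::finite) set \<Rightarrow> nat \<Rightarrow> real \<Rightarrow> (real ^ 'd \<Rightarrow> real) \<Rightarrow> bool" where
  "smooth_approximable \<Omega> j p u \<longleftrightarrow> (\<forall>\<epsilon>>0. \<exists>\<Phi>. smooth_approximant \<Omega> j p u \<epsilon> \<Phi>)"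

text \<open>As \<open>\<kappa> (z - x)\<close> is a test function of \<open>z\<close>, the derivatives on the kernel can be moved to \<open>g\<close>.  The two
signs, from the kernel and from the weak derivative, cancel.\<close>

lemma mconv_wderiv:
  assumes \<Omega>: "\<Omega> \<in> sets lebesgue" and \<kappa>: "\<kappa> \<in> test_functions UNIV"
    and g: "integrable (lebesgue_on \<Omega>) g" "wderiv \<Omega> W g v"
    and supp: "(\<lambda>z. \<kappa> (z - x)) \<in> test_functions \<Omega>"
  shows "pderivs W (mconv \<kappa> (\<lambda>z. if z \<in> \<Omega> then g z else 0)) x = mconv \<kappa> (\<lambda>z. if z \<in> \<Omega> then v z else 0) x"
proof -
  have i: "integrable lebesgue (\<lambda>z. if z \<in> \<Omega> then g z else 0)"
    using g(1) \<Omega> by (subst Lebesgue_Measure.integrable_restrict_UNIV)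
  have *: "mconv \<phi> (\<lambda>z. if z \<in> \<Omega> then f z else 0) x = (\<integral>z. f z * \<phi> (z - x) \<partial>lebesgue_on \<Omega>)" for \<phi> f
  proof -
    have "mconv \<phi> (\<lambda>z. if z \<in> \<Omega> then f z else 0) x = (\<integral>z. (if z \<in> \<Omega> then f z * \<phi> (z - x) else 0) \<partial>lebesgue)"
      unfolding mconv_def by (rule Bochner_Integration.integral_cong) auto
    also have "\<dots> = (\<integral>z. f z * \<phi> (z - x) \<partial>lebesgue_on \<Omega>)"
      by (rule Lebesgue_Measure.integral_restrict_UNIV[OF \<Omega>])
    finally show ?thesis .
  qed
  have "pderivs W (\<lambda>z. \<kappa> (z - x)) = (\<lambda>z. pderivs W \<kappa> (z - x))"
    using pderivs_translate[of W \<kappa> "- x"] by simp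
  then have "(\<integral>z. g z * pderivs W \<kappa> (z - x) \<partial>lebesgue_on \<Omega>) = (-1) ^ length W * (\<integral>z. v z * \<kappa> (z - x) \<partial>lebesgue_on \<Omega>)"
    using g(2) supp by (auto simp: wderiv_def)
  then show ?thesis
    by (simp add: mconv_pderivs[OF \<kappa> i] * power_mult_distrib[symmetric] flip: mult.assoc)
qed

lemma finite_short_words: "finite {W :: 'd::finite list. length W \<le> j}"
  using finite_lists_length_le[of "UNIV :: 'd set" j] by simp

text \<open>The kernel is centred at \<open>t y\<close>, so the mollified function averages over a small ball around
\<open>x + t y\<close>.  If the ball meets the support \<open>C\<close> of \<open>\<psi>\<close>, then \<open>x\<close> is a point of the closure of \<open>\<Omega>\<close> near \<open>C\<close>,
and by the segment condition and compactness the whole ball lies in \<open>\<Omega>\<close>; the kernel is then a test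
function on \<open>\<Omega>\<close>.  If it misses \<open>C\<close>, both sides of the identity to be shown vanish.\<close>

lemma smooth_approximable_local:
  fixes \<Omega> :: "(real ^ 'd::finite) set"
  assumes \<Omega>: "is_domain \<Omega>" and p: "p \<ge> 1" and C: "compact C" "C \<subseteq> U" "open U"
    and seg: "\<And>z t. z \<in> closure \<Omega> \<Longrightarrow> z \<in> U \<Longrightarrow> 0 < t \<Longrightarrow> t < 1 \<Longrightarrow> z + t *\<^sub>R y \<in> \<Omega>"
    and \<psi>: "\<psi> \<in> test_functions UNIV" "\<And>x. x \<notin> C \<Longrightarrow> \<psi> x = 0" and u: "u \<in> Lp_functions \<Omega> p"
    and ud: "\<And>W. length W \<le> j \<Longrightarrow> \<exists>v\<in>Lp_functions \<Omega> p. wderiv \<Omega> W u v"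
  shows "smooth_approximable \<Omega> j p (\<lambda>x. \<psi> x * u x)"
  unfolding smooth_approximable_def
proof (intro allI impI)
  fix \<epsilon> :: real assume \<epsilon>: "\<epsilon> > 0"
  note m = is_domain_finite_measure(1)[OF \<Omega>] and I = Lp_integrable[OF \<Omega> p]
  have "\<exists>v. length W \<le> j \<longrightarrow> v \<in> Lp_functions \<Omega> p \<and> wderiv \<Omega> W (\<lambda>x. \<psi> x * u x) v \<and> (\<forall>x. x \<notin> C \<longrightarrow> v x = 0)" for W
    using leibniz_support[OF \<Omega> p compact_imp_closed[OF C(1)] \<psi> u, of W] ud by (metis order_trans)
  then obtain v where v: "\<And>W. length W \<le> j \<Longrightarrow> v W \<in> Lp_functions \<Omega> p"
     "\<And>W. length W \<le> j \<Longrightarrow> wderiv \<Omega> W (\<lambda>x. \<psi> x * u x) (v W)"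
     "\<And>W x. length W \<le> j \<Longrightarrow> x \<notin> C \<Longrightarrow> v W x = 0" by metis
  define f where "f z = (if z \<in> \<Omega> then \<psi> z * u z else 0)" for z
  define F where "F W z = (if z \<in> \<Omega> then v W z else 0)" for W z
  have fi: "integrable lebesgue f"
    unfolding f_def using I[OF Lp_test_mult[OF p u \<psi>(1)]] m by (subst Lebesgue_Measure.integrable_restrict_UNIV)
  define P where "P W \<rho> \<longleftrightarrow> \<rho> > 0 \<and> (length W \<le> j \<longrightarrow> (\<forall>\<kappa>\<in>test_functions UNIV. (\<forall>x. \<kappa> x \<ge> 0) \<longrightarrow> integral\<^sup>L lebesgue \<kappa> = 1 \<longrightarrow>
     (\<forall>v. norm v > \<rho> \<longrightarrow> \<kappa> v = 0) \<longrightarrow>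
       (\<integral>\<^sup>+x. \<bar>mconv \<kappa> (F W) x - F W x\<bar> powr p \<partial>lebesgue) \<le> ennreal \<epsilon>))" for W \<rho>
  have "\<exists>\<rho>. P W \<rho>" for W
  proof (cases "length W \<le> j")
    case True
    have Fm: "F W \<in> borel_measurable lebesgue"
      unfolding F_def using v(1)[OF True] m by (subst borel_measurable_if) (auto simp: Lp_functions_def)
    have "(\<lambda>x. \<bar>F W x\<bar> powr p) = (\<lambda>x. if x \<in> \<Omega> then \<bar>v W x\<bar> powr p else 0)" by (auto simp: F_def)
    moreover have "integrable lebesgue (\<lambda>x. if x \<in> \<Omega> then \<bar>v W x\<bar> powr p else 0)"
      using v(1)[OF True] m by (subst Lebesgue_Measure.integrable_restrict_UNIV) (auto simp: Lp_functions_def)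
    ultimately have Fi: "integrable lebesgue (\<lambda>x. \<bar>F W x\<bar> powr p)" by simp
    show ?thesis
    proof (rule mollify[OF p Fm Fi \<epsilon>], goal_cases)
      case (1 \<rho>)
      then show ?case unfolding P_def mconv_def by (intro exI[of _ \<rho>]) simp
    qed
  qed (auto intro: exI[of _ 1] simp: P_def)
  then obtain \<rho>W where \<rho>P: "\<And>W. P W (\<rho>W W)" by metis
  have \<rho>W: "\<rho>W W > 0" for W using \<rho>P[of W] by (simp add: P_def)
  define \<rho> where "\<rho> = Min (\<rho>W ` {W. length W \<le> j})"
  have ne: "{W :: 'd list. length W \<le> j} \<noteq> {}" by (auto intro: exI[of _ "[]"])
  have \<rho>: "\<rho> > 0" unfolding \<rho>_def using \<rho>W ne by (subst Min_gr_iff) (auto intro: finite_short_words)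
  have \<rho>le: "\<rho> \<le> \<rho>W W" if "length W \<le> j" for W
    unfolding \<rho>_def using that by (intro Min_le finite_imageI finite_short_words) auto
  obtain e where e: "e > 0" "(\<Union>x\<in>C. cball x e) \<subseteq> U"
    using compact_subset_open_imp_cball_epsilon_subset[OF C(1,3,2)] by auto
  define K where "K = closure \<Omega> \<inter> {x + y |x y. x \<in> C \<and> y \<in> cball 0 e}"
  have Kc: "compact K" unfolding K_def
    by (intro closed_Int_compact compact_sums C) auto
  have KU: "K \<subseteq> U" using e(2) by (fastforce simp: K_def dist_norm)
  (* The +1 guards against y = 0, the vector used for interior points. *)
  define t where "t = min (1 / 2) (min \<rho> e / (2 * (norm y + 1)))"
  have t: "0 < t" "t < 1" using \<rho> e(1) by (auto simp: t_def add_nonneg_pos)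
  have "t * norm y \<le> t * (norm y + 1)" using t(1) by (intro mult_left_mono) auto
  also have "\<dots> \<le> min \<rho> e / (2 * (norm y + 1)) * (norm y + 1)"
    by (intro mult_right_mono) (auto simp: t_def)
  also have "\<dots> = min \<rho> e / 2" using norm_ge_zero[of y] by (simp add: field_simps add_nonneg_eq_0_iff)
  finally have ty: "t * norm y \<le> \<rho> / 2" "t * norm y \<le> e / 2" by auto
  have "(+) (t *\<^sub>R y) ` K \<subseteq> \<Omega>"
  proof safe
    fix x assume "x \<in> K"
    then show "t *\<^sub>R y + x \<in> \<Omega>" using seg[of x t] KU t by (auto simp: K_def add.commute)
  qed
  then obtain d where d: "d > 0" "(\<Union>x\<in>(+) (t *\<^sub>R y) ` K. cball x d) \<subseteq> \<Omega>"
    using compact_subset_open_imp_cball_epsilon_subset[OF compact_translation[OF Kc], of \<Omega> "t *\<^sub>R y"] \<Omega>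
    unfolding is_domain_def by blast
  define \<delta> where "\<delta> = min d (min (\<rho> / 2) (e / 2))"
  have \<delta>: "\<delta> > 0" "\<delta> \<le> d" "\<delta> \<le> \<rho> / 2" "\<delta> \<le> e / 2" using d(1) \<rho> e(1) by (auto simp: \<delta>_def)
  obtain \<kappa> :: "real ^ 'd \<Rightarrow> real" where \<kappa>: "\<kappa> \<in> test_functions UNIV" "\<And>x. \<kappa> x \<ge> 0" "integral\<^sup>L lebesgue \<kappa> = 1"
    "\<And>x. x \<notin> cball (t *\<^sub>R y) \<delta> \<Longrightarrow> \<kappa> x = 0"
    using mollifier_exists[OF \<delta>(1), of "t *\<^sub>R y"] by metis
  have \<kappa>\<rho>: "\<kappa> x = 0" if "norm x > \<rho>" for x
  proof -
    have "norm x \<le> norm (t *\<^sub>R y) + dist (t *\<^sub>R y) x"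
      using norm_triangle_ineq4[of "t *\<^sub>R y" "t *\<^sub>R y - x"] by (simp add: dist_norm)
    then have "x \<notin> cball (t *\<^sub>R y) \<delta>" using that ty(1) t(1) \<delta>(3) by auto
    then show ?thesis by (rule \<kappa>(4))
  qed
  have D: "pderivs W (mconv \<kappa> f) x = mconv \<kappa> (F W) x" if x: "x \<in> \<Omega>" and W: "length W \<le> j" for x W
  proof (cases "\<exists>z\<in>C. z - x \<in> cball (t *\<^sub>R y) \<delta>")
    case True
    then obtain z where z: "z \<in> C" "norm (t *\<^sub>R y - (z - x)) \<le> \<delta>" by (auto simp: dist_norm)
    have "norm (x - z) \<le> e"
      using norm_triangle_ineq4[of "t *\<^sub>R y - (z - x)" "t *\<^sub>R y"] z(2) ty(2) t(1) \<delta>(4) by simp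
    then have "x \<in> K" unfolding K_def using z(1) x closure_subset[of \<Omega>]
      by (intro IntI CollectI exI[of _ z] exI[of _ "x - z"]) auto
    then have sub: "cball (t *\<^sub>R y + x) \<delta> \<subseteq> \<Omega>" using d(2) \<delta>(2) by fastforce
    have "\<kappa> (z - x) = 0" if "z \<notin> cball (t *\<^sub>R y + x) \<delta>" for z
      using that \<kappa>(4)[of "z - x"] by (simp add: dist_norm algebra_simps)
    then have "(\<lambda>z. \<kappa> (z - x)) \<in> test_functions \<Omega>"
      unfolding test_functions_iff using sub
      by (intro conjI exI[of _ "cball (t *\<^sub>R y + x) \<delta>"] test_smooth[OF test_translate[OF \<kappa>(1)]]) auto
    then show ?thesis unfolding f_def F_def
      by (intro mconv_wderiv[OF m \<kappa>(1)] v W I Lp_test_mult[OF p u \<psi>(1)])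
  next
    case False
    then have z: "pderivs V \<kappa> (z - x) = 0" if "z \<in> C" for z V
      using that False \<kappa>(4) by (intro pderivs_zero_off[where K="cball (t *\<^sub>R y) \<delta>"]) auto
    have "pderivs W \<kappa> (z - x) * f z = 0" for z
      using z[of z W] \<psi>(2)[of z] by (cases "z \<in> C") (auto simp: f_def)
    moreover have "\<kappa> (z - x) * F W z = 0" for z
      using z[of z "[]"] v(3)[OF W, of z] by (cases "z \<in> C") (auto simp: F_def)
    ultimately show ?thesis
      unfolding mconv_pderivs[OF \<kappa>(1) fi] mconv_def by (simp only: integral_zero mult_zero_right)
  qed
  show "\<exists>\<Phi>. smooth_approximant \<Omega> j p (\<lambda>x. \<psi> x * u x) \<epsilon> \<Phi>"
    unfolding smooth_approximant_def
  proof (intro exI[of _ "mconv \<kappa> f"] conjI allI impI)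
    show "smooth (mconv \<kappa> f)" by (rule mconv_smooth[OF \<kappa>(1) fi])
    show "\<exists>B. \<forall>x. \<bar>pderivs W (mconv \<kappa> f) x\<bar> \<le> B" for W
      using mconv_bounded[OF test_pderivs[OF \<kappa>(1)] fi, of W] by (auto simp: mconv_pderivs[OF \<kappa>(1) fi] abs_mult power_abs)
    fix W :: "'d list" assume W: "length W \<le> j"
    show "\<exists>v\<in>Lp_functions \<Omega> p. wderiv \<Omega> W (\<lambda>x. \<psi> x * u x) v \<and>
        (\<integral>\<^sup>+x. \<bar>pderivs W (mconv \<kappa> f) x - v x\<bar> powr p \<partial>lebesgue_on \<Omega>) \<le> ennreal \<epsilon>"
    proof (intro bexI[of _ "v W"] conjI v W)
      have "(\<integral>\<^sup>+x. \<bar>pderivs W (mconv \<kappa> f) x - v W x\<bar> powr p \<partial>lebesgue_on \<Omega>) =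
        (\<integral>\<^sup>+x. ennreal (\<bar>pderivs W (mconv \<kappa> f) x - v W x\<bar> powr p) * indicator \<Omega> x \<partial>lebesgue)"
        using m by (simp add: nn_integral_restrict_space)
      also have "\<dots> \<le> (\<integral>\<^sup>+x. \<bar>mconv \<kappa> (F W) x - F W x\<bar> powr p \<partial>lebesgue)"
        by (rule nn_integral_mono) (auto simp: indicator_def D W F_def[of W])
      also have "\<dots> \<le> ennreal \<epsilon>"
        using \<rho>P[of W] \<rho>le[OF W] W \<kappa>(1-3) \<kappa>\<rho> by (simp add: P_def)
      finally show "(\<integral>\<^sup>+x. \<bar>pderivs W (mconv \<kappa> f) x - v W x\<bar> powr p \<partial>lebesgue_on \<Omega>) \<le> ennreal \<epsilon>" .
    qed
  qed
qed

lemma smooth_approximable_cong: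
  assumes "\<And>x. x \<in> \<Omega> \<Longrightarrow> u x = u' x" "smooth_approximable \<Omega> j p u"
  shows "smooth_approximable \<Omega> j p u'"
proof -
  have "wderiv \<Omega> W u v \<Longrightarrow> wderiv \<Omega> W u' v" for W v using wderiv_cong[OF assms(1) refl] .
  then show ?thesis using assms(2) unfolding smooth_approximable_def smooth_approximant_def by meson
qed

lemma smooth_approximable_zero: "smooth_approximable \<Omega> j p (\<lambda>x. 0)"
proof -
  have "wderiv \<Omega> W (\<lambda>x. 0) (\<lambda>x. 0)" for W by (simp add: wderiv_def)
  moreover have "(\<lambda>x. 0) \<in> Lp_functions \<Omega> p" by (simp add: Lp_functions_def)
  ultimately show ?thesis unfolding smooth_approximable_def smooth_approximant_def
    by (intro allI impI exI[of _ "\<lambda>x. 0"]) (auto simp: pderivs_const0 smooth_const intro!: bexI[of _ "\<lambda>x. 0"])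
qed

lemma continuous_measurable_on:
  assumes "continuous_on UNIV (f :: real ^ 'd::finite \<Rightarrow> real)"
  shows "f \<in> borel_measurable (lebesgue_on \<Omega>)"
  using borel_measurable_continuous_onI[OF assms]
  by (intro measurable_restrict_space1) (auto intro: measurable_completion)

lemma smooth_approximable_add:
  assumes \<Omega>: "is_domain \<Omega>" and p: "p \<ge> 1" and u: "u \<in> Lp_functions \<Omega> p" "u' \<in> Lp_functions \<Omega> p"
    and a: "smooth_approximable \<Omega> j p u" "smooth_approximable \<Omega> j p u'"
  shows "smooth_approximable \<Omega> j p (\<lambda>x. u x + u' x)"
  unfolding smooth_approximable_def
proof (intro allI impI)
  fix \<epsilon> :: real assume \<epsilon>: "\<epsilon> > 0"
  define e where "e = \<epsilon> / (2 * 2 powr p)"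
  have e: "e > 0" using \<epsilon> by (simp add: e_def)
  note m = is_domain_finite_measure(1)[OF \<Omega>] and I = Lp_integrable[OF \<Omega> p]
  obtain \<Phi> where \<Phi>: "smooth \<Phi>" "\<forall>W. \<exists>B. \<forall>x. \<bar>pderivs W \<Phi> x\<bar> \<le> B" "\<forall>W. length W \<le> j \<longrightarrow> (\<exists>v\<in>Lp_functions \<Omega> p. wderiv \<Omega> W u v \<and>
        (\<integral>\<^sup>+x. \<bar>pderivs W \<Phi> x - v x\<bar> powr p \<partial>lebesgue_on \<Omega>) \<le> ennreal e)"
    using a(1) e unfolding smooth_approximable_def smooth_approximant_def by blast
  obtain \<Phi>' where \<Phi>': "smooth \<Phi>'" "\<forall>W. \<exists>B. \<forall>x. \<bar>pderivs W \<Phi>' x\<bar> \<le> B" "\<forall>W. length W \<le> j \<longrightarrow> (\<exists>v\<in>Lp_functions \<Omega> p. wderiv \<Omega> W u' v \<and>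
        (\<integral>\<^sup>+x. \<bar>pderivs W \<Phi>' x - v x\<bar> powr p \<partial>lebesgue_on \<Omega>) \<le> ennreal e)"
    using a(2) e unfolding smooth_approximable_def smooth_approximant_def by blast
  show "\<exists>\<Phi>. smooth_approximant \<Omega> j p (\<lambda>x. u x + u' x) \<epsilon> \<Phi>"
    unfolding smooth_approximant_def
  proof (intro exI[of _ "\<lambda>x. \<Phi> x + \<Phi>' x"] conjI allI impI)
    show "smooth (\<lambda>x. \<Phi> x + \<Phi>' x)" by (rule smooth_add[OF \<Phi>(1) \<Phi>'(1)])
    show "\<exists>B. \<forall>x. \<bar>pderivs W (\<lambda>x. \<Phi> x + \<Phi>' x) x\<bar> \<le> B" for W
    proof -
      obtain B B' where "\<forall>x. \<bar>pderivs W \<Phi> x\<bar> \<le> B" "\<forall>x. \<bar>pderivs W \<Phi>' x\<bar> \<le> B'" using \<Phi>(2) \<Phi>'(2) by meson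
      then have "\<forall>x. \<bar>pderivs W \<Phi> x + pderivs W \<Phi>' x\<bar> \<le> B + B'" by (meson abs_triangle_ineq add_mono order_trans)
      then show ?thesis by (auto simp: pderivs_add[OF \<Phi>(1) \<Phi>'(1)])
    qed
    fix W :: "'a list" assume W: "length W \<le> j"
    obtain v where v: "v \<in> Lp_functions \<Omega> p" "wderiv \<Omega> W u v" "(\<integral>\<^sup>+x. \<bar>pderivs W \<Phi> x - v x\<bar> powr p \<partial>lebesgue_on \<Omega>) \<le> ennreal e"
      using \<Phi>(3) W by blast
    obtain v' where v': "v' \<in> Lp_functions \<Omega> p" "wderiv \<Omega> W u' v'" "(\<integral>\<^sup>+x. \<bar>pderivs W \<Phi>' x - v' x\<bar> powr p \<partial>lebesgue_on \<Omega>) \<le> ennreal e"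
      using \<Phi>'(3) W by blast
    have [measurable]: "v \<in> borel_measurable (lebesgue_on \<Omega>)" "v' \<in> borel_measurable (lebesgue_on \<Omega>)"
      "pderivs W \<Phi> \<in> borel_measurable (lebesgue_on \<Omega>)" "pderivs W \<Phi>' \<in> borel_measurable (lebesgue_on \<Omega>)"
      using v(1) v'(1) by (auto simp: Lp_functions_def intro!: continuous_measurable_on smooth_continuous smooth_pderivs \<Phi>(1) \<Phi>'(1))
    have "(\<integral>\<^sup>+x. \<bar>(pderivs W \<Phi> x - v x) + (pderivs W \<Phi>' x - v' x)\<bar> powr p \<partial>lebesgue_on \<Omega>) \<le> ennreal (2 powr p * (e + e))"
      using e by (intro nn_integral_powr_add_le p v(3) v'(3)) auto
    moreover have "2 powr p * (e + e) = \<epsilon>" by (simp add: e_def)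
    ultimately have "(\<integral>\<^sup>+x. \<bar>pderivs W (\<lambda>x. \<Phi> x + \<Phi>' x) x - (v x + v' x)\<bar> powr p \<partial>lebesgue_on \<Omega>) \<le> ennreal \<epsilon>"
      unfolding pderivs_add[OF \<Phi>(1) \<Phi>'(1)] by (simp add: algebra_simps)
    moreover have "wderiv \<Omega> W (\<lambda>x. u x + u' x) (\<lambda>x. v x + v' x)"
      by (intro wderiv_add v v' m I u)
    ultimately show "\<exists>v\<in>Lp_functions \<Omega> p. wderiv \<Omega> W (\<lambda>x. u x + u' x) v \<and>
        (\<integral>\<^sup>+x. \<bar>pderivs W (\<lambda>x. \<Phi> x + \<Phi>' x) x - v x\<bar> powr p \<partial>lebesgue_on \<Omega>) \<le> ennreal \<epsilon>"
      using Lp_add[OF p v(1) v'(1)] by blast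
  qed
qed

text \<open>Interior points satisfy the condition with the zero vector, so they need no separate treatment.\<close>

lemma segment_condition_closure:
  assumes "is_domain \<Omega>" "segment_condition \<Omega>" "x \<in> closure \<Omega>"
  obtains U y where "open U" "x \<in> U"
    "\<And>z t. z \<in> closure \<Omega> \<Longrightarrow> z \<in> U \<Longrightarrow> 0 < t \<Longrightarrow> t < 1 \<Longrightarrow> z + t *\<^sub>R y \<in> \<Omega>"
proof (cases "x \<in> \<Omega>")
  case True
  then show ?thesis using that[of \<Omega> 0] assms(1) by (auto simp: is_domain_def)
next
  case False
  then have "x \<in> frontier \<Omega>" using assms by (simp add: frontier_def is_domain_def interior_open)
  then show ?thesis using assms(2) that unfolding segment_condition_def by blast
qed

text \<open>Finitely many cut-off functions \<open>\<eta> a\<close>, each equal to one near its centre, cover the closure of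
\<open>\<Omega>\<close>.  By induction over these centres \<open>1 - (\<Prod>a. 1 - \<eta> a)\<close> times \<open>u\<close> is approximable: adding a centre adds
the local piece \<open>(\<Prod>a. 1 - \<eta> a) * \<eta> b * u\<close>.  For all centres together the product vanishes on \<open>\<Omega>\<close>.  No
quotient of functions is formed, unlike with a normalised partition of unity.\<close>

lemma sobolev_smooth_approximable:
  fixes \<Omega> :: "(real ^ 'd::finite) set"
  assumes \<Omega>: "is_domain \<Omega>" "segment_condition \<Omega>" and p: "p \<ge> 1" and u: "u \<in> sobolev \<Omega> j p"
  shows "smooth_approximable \<Omega> j p u"
proof -
  have uL: "u \<in> Lp_functions \<Omega> p" using u by (simp add: sobolev_def)
  have ud: "\<exists>v\<in>Lp_functions \<Omega> p. wderiv \<Omega> W u v" if "length W \<le> j" for W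
  proof -
    have "mdeg (count (mset W)) \<le> j" using that by (simp add: mdeg_count)
    then obtain v where v: "v \<in> Lp_functions \<Omega> p" "has_weak_deriv \<Omega> (count (mset W)) u v"
      using u by (auto simp: sobolev_def)
    then have "wderiv \<Omega> W u v" using wderiv_perm[OF _ mset_mword] by (auto simp: has_weak_deriv_iff)
    then show ?thesis using v by blast
  qed
  define Q where "Q a \<eta> \<rho> \<longleftrightarrow> smooth \<eta> \<and> \<rho> > 0 \<and> (\<forall>x\<in>ball a \<rho>. \<eta> x = (1::real)) \<and>
     (\<exists>C U y. compact C \<and> C \<subseteq> U \<and> open U \<and> (\<forall>x. x \<notin> C \<longrightarrow> \<eta> x = 0) \<and>
        (\<forall>z t. z \<in> closure \<Omega> \<longrightarrow> z \<in> U \<longrightarrow> 0 < t \<longrightarrow> t < 1 \<longrightarrow> z + t *\<^sub>R y \<in> \<Omega>))" for a :: "real ^ 'd" and \<eta> \<rho>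
  have "\<exists>\<eta> \<rho>. Q a \<eta> \<rho>" if a: "a \<in> closure \<Omega>" for a
  proof -
    obtain U y where U: "open U" "a \<in> U"
      "\<And>z t. z \<in> closure \<Omega> \<Longrightarrow> z \<in> U \<Longrightarrow> 0 < t \<Longrightarrow> t < 1 \<Longrightarrow> z + t *\<^sub>R y \<in> \<Omega>"
      using segment_condition_closure[OF \<Omega> a] by metis
    obtain r where r: "r > 0" "cball a r \<subseteq> U" using U open_contains_cball by blast
    obtain \<psi> \<rho> where \<psi>: "smooth \<psi>" "\<rho> > 0" "\<And>x. x \<in> ball a \<rho> \<Longrightarrow> \<psi> x = 1" "\<And>x. x \<notin> cball a r \<Longrightarrow> \<psi> x = 0"
      using smooth_bump[OF r(1), of a] by metis
    have "Q a \<psi> \<rho>" unfolding Q_def using \<psi> r U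
      by (intro conjI exI[of _ "cball a r"] exI[of _ U] exI[of _ y]) auto
    then show ?thesis by blast
  qed
  then obtain \<eta> \<rho> where Q: "\<And>a. a \<in> closure \<Omega> \<Longrightarrow> Q a (\<eta> a) (\<rho> a)" by metis
  have cpt: "compact (closure \<Omega>)" using \<Omega>(1) by (simp add: is_domain_def compact_closure)
  have cov: "closure \<Omega> \<subseteq> (\<Union>a\<in>closure \<Omega>. ball a (\<rho> a))"
  proof
    fix x assume x: "x \<in> closure \<Omega>"
    then have "x \<in> ball x (\<rho> x)" using Q[of x] by (simp add: Q_def)
    then show "x \<in> (\<Union>a\<in>closure \<Omega>. ball a (\<rho> a))" using x by blast
  qed
  obtain D where D: "D \<subseteq> closure \<Omega>" "finite D" "closure \<Omega> \<subseteq> (\<Union>a\<in>D. ball a (\<rho> a))"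
    by (rule compactE_image[OF cpt _ cov]) (auto intro: open_ball)
  let ?P = "\<lambda>F x. \<Prod>a\<in>F. (1 - \<eta> a x)"
  have sm: "smooth (?P F)" if "F \<subseteq> closure \<Omega>" for F
    using that Q by (intro smooth_prod smooth_diff smooth_const) (auto simp: Q_def)
  have "(\<lambda>x. (1 - ?P F x) * u x) \<in> Lp_functions \<Omega> p \<and> smooth_approximable \<Omega> j p (\<lambda>x. (1 - ?P F x) * u x)"
    if "finite F" "F \<subseteq> closure \<Omega>" for F
    using that
  proof (induction F)
    case empty
    then show ?case using smooth_approximable_zero by (simp add: Lp_functions_def)
  next
    case (insert a F)
    have IH: "(\<lambda>x. (1 - ?P F x) * u x) \<in> Lp_functions \<Omega> p" "smooth_approximable \<Omega> j p (\<lambda>x. (1 - ?P F x) * u x)"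
      using insert by auto
    have Qa: "Q a (\<eta> a) (\<rho> a)" using Q insert.prems by auto
    then obtain C U y where C: "compact C" "C \<subseteq> U" "open U" "\<forall>x. x \<notin> C \<longrightarrow> \<eta> a x = 0"
      "\<forall>z t. z \<in> closure \<Omega> \<longrightarrow> z \<in> U \<longrightarrow> 0 < t \<longrightarrow> t < 1 \<longrightarrow> z + t *\<^sub>R y \<in> \<Omega>" by (auto simp: Q_def)
    let ?\<psi> = "\<lambda>x. ?P F x * \<eta> a x"
    have "\<eta> a \<in> test_functions UNIV" using Qa C by (auto simp: test_functions_iff Q_def)
    then have t: "?\<psi> \<in> test_functions UNIV" using insert.prems by (intro test_mult sm) auto
    have "smooth_approximable \<Omega> j p (\<lambda>x. ?\<psi> x * u x)"
      by (rule smooth_approximable_local[OF \<Omega>(1) p C(1-3), of y]) (use C t uL ud in auto)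
    moreover note L = Lp_test_mult[OF p uL t]
    ultimately have "smooth_approximable \<Omega> j p (\<lambda>x. (1 - ?P F x) * u x + ?\<psi> x * u x)"
      using IH by (intro smooth_approximable_add[OF \<Omega>(1) p])
    moreover have "(\<lambda>x. (1 - ?P F x) * u x + ?\<psi> x * u x) \<in> Lp_functions \<Omega> p" by (rule Lp_add[OF p IH(1) L])
    moreover have "(\<lambda>x. (1 - ?P F x) * u x + ?\<psi> x * u x) = (\<lambda>x. (1 - ?P (insert a F) x) * u x)"
      using insert.hyps by (simp add: algebra_simps fun_eq_iff)
    ultimately show ?case by simp
  qed
  from this[OF D(2,1)] have "smooth_approximable \<Omega> j p (\<lambda>x. (1 - ?P D x) * u x)" by blast
  then show ?thesis
  proof (rule smooth_approximable_cong[rotated])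
    fix x assume "x \<in> \<Omega>"
    then obtain a where "a \<in> D" "x \<in> ball a (\<rho> a)" using D(3) closure_subset[of \<Omega>] by blast
    then have "\<eta> a x = 1" using D(1) Q[of a] unfolding Q_def by blast
    then have "?P D x = 0" using \<open>a \<in> D\<close> D(2) by (intro prod_zero) auto
    then show "(1 - ?P D x) * u x = u x" by simp
  qed
qed

section \<open>Taylor polynomials\<close>

lemma DERIV_coord: "((\<lambda>t. (x + t *\<^sub>R axis l 1) $ i - a) has_field_derivative (axis l 1 $ i :: real)) (at 0)"
  by (auto intro!: derivative_eq_intros)

lemma smooth_coord: "smooth (\<lambda>x :: real ^ 'd::finite. x $ i - a)"
proof -
  have "Cr_on r UNIV (\<lambda>x :: real ^ 'd. x $ i - a)" for r
  proof (cases r)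
    case 0
    then show ?thesis by (auto intro!: continuous_intros)
  next
    case (Suc q)
    then show ?thesis
      using Cr_on_SucI[of UNIV "\<lambda>x :: real ^ 'd. x $ i - a" "\<lambda>l x. axis l 1 $ i" q, OF open_UNIV _ DERIV_coord Cr_on_const[OF open_UNIV]]
      by (simp add: continuous_intros)
  qed
  then show ?thesis by (simp add: smooth_def)
qed

text \<open>The homogeneous part of degree \<open>k\<close> of the Taylor expansion at \<open>a\<close>.  By Euler's identity for
homogeneous polynomials it is determined by its partial derivatives, which are Taylor terms of the
partial derivatives of \<open>f\<close>; the recursion turns this into a definition without multiindex factorials.\<close>

primrec taylor_term :: "nat \<Rightarrow> (real ^ 'd::finite \<Rightarrow> real) \<Rightarrow> real ^ 'd \<Rightarrow> real ^ 'd \<Rightarrow> real" where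
  "taylor_term 0 f a y = f a"
| "taylor_term (Suc k) f a y = inverse (real (Suc k)) * (\<Sum>i\<in>UNIV. (y $ i - a $ i) * taylor_term k (partial_deriv i f) a y)"

lemma smooth_taylor_term: "smooth (taylor_term k f a)"
proof (induction k arbitrary: f)
  case 0
  have "taylor_term 0 f a = (\<lambda>y. f a)" by (rule ext) simp
  then show ?case by (simp add: smooth_const)
next
  case (Suc k)
  have "taylor_term (Suc k) f a = (\<lambda>y. inverse (real (Suc k)) * (\<Sum>i\<in>UNIV. (y $ i - a $ i) * taylor_term k (partial_deriv i f) a y))"
    by (rule ext) simp
  then show ?case using Suc by (simp only: smooth_cmult smooth_sum smooth_mult smooth_coord)
qed

text \<open>The induction step is the product rule, where symmetry of the second derivatives lets the sum over
\<open>i\<close> be recognised as \<open>Suc k\<close> times a Taylor term of the partial derivative.\<close>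

lemma taylor_term_deriv:
  assumes "smooth f"
  shows "partial_deriv l (taylor_term (Suc k) f a) y = taylor_term k (partial_deriv l f) a y"
  using assms
proof (induction k arbitrary: f y)
  case 0
  have "((\<lambda>t. taylor_term (Suc 0) f a (y + t *\<^sub>R axis l 1)) has_field_derivative
      (\<Sum>i\<in>UNIV. (axis l 1 $ i) * partial_deriv i f a)) (at 0)"
    unfolding taylor_term.simps
    by (auto intro!: DERIV_sum DERIV_cmult_right DERIV_coord simp del: vector_add_component vector_scaleR_component)
  then have "partial_deriv l (taylor_term (Suc 0) f a) y = (\<Sum>i\<in>UNIV. (axis l 1 $ i) * partial_deriv i f a)"
    by (rule partial_deriv_eqI)
  then show ?case by (simp add: axis_def if_distrib if_distribR sum.delta del: taylor_term.simps(2) cong: if_cong)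
next
  case (Suc k)
  let ?c = "inverse (real (Suc (Suc k)))"
  have "((\<lambda>t. taylor_term (Suc (Suc k)) f a (y + t *\<^sub>R axis l 1)) has_field_derivative
      ?c * (\<Sum>i\<in>UNIV. (axis l 1 $ i) * taylor_term (Suc k) (partial_deriv i f) a (y + 0 *\<^sub>R axis l 1)
        + partial_deriv l (taylor_term (Suc k) (partial_deriv i f) a) y * ((y + 0 *\<^sub>R axis l 1) $ i - a $ i))) (at 0)"
    unfolding taylor_term.simps(2)[of "Suc k"]
    by (intro DERIV_cmult DERIV_sum DERIV_mult DERIV_coord smooth_deriv smooth_taylor_term)
  then have "partial_deriv l (taylor_term (Suc (Suc k)) f a) y =
     ?c * (\<Sum>i\<in>UNIV. (axis l 1 $ i) * taylor_term (Suc k) (partial_deriv i f) a (y + 0 *\<^sub>R axis l 1)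
        + partial_deriv l (taylor_term (Suc k) (partial_deriv i f) a) y * ((y + 0 *\<^sub>R axis l 1) $ i - a $ i))"
    by (rule partial_deriv_eqI)
  also have "\<dots> = ?c * ((\<Sum>i\<in>UNIV. (axis l 1 $ i) * taylor_term (Suc k) (partial_deriv i f) a y)
        + (\<Sum>i\<in>UNIV. (y $ i - a $ i) * taylor_term k (partial_deriv i (partial_deriv l f)) a y))"
    unfolding Suc.IH[OF smooth_partial[OF Suc.prems]] partial_deriv_commute[OF Suc.prems, of l]
    by (simp add: sum.distrib mult.commute)
  also have "(\<Sum>i\<in>UNIV. (axis l 1 $ i) * taylor_term (Suc k) (partial_deriv i f) a y) = taylor_term (Suc k) (partial_deriv l f) a y"
    by (simp add: axis_def if_distrib if_distribR sum.delta del: taylor_term.simps cong: if_cong)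
  also have "(\<Sum>i\<in>UNIV. (y $ i - a $ i) * taylor_term k (partial_deriv i (partial_deriv l f)) a y) =
     real (Suc k) * taylor_term (Suc k) (partial_deriv l f) a y" by simp
  also have "?c * (taylor_term (Suc k) (partial_deriv l f) a y + real (Suc k) * taylor_term (Suc k) (partial_deriv l f) a y)
     = taylor_term (Suc k) (partial_deriv l f) a y"
    by (simp add: field_simps del: taylor_term.simps)
  finally show ?case .
qed

definition taylor_poly :: "nat \<Rightarrow> (real ^ 'd::finite \<Rightarrow> real) \<Rightarrow> real ^ 'd \<Rightarrow> real ^ 'd \<Rightarrow> real" where
  "taylor_poly j f a y = (\<Sum>k\<le>j. taylor_term k f a y)"

lemma smooth_taylor_poly: "smooth (taylor_poly j f a)"
  unfolding taylor_poly_def[abs_def] by (intro smooth_sum smooth_taylor_term)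

lemma taylor_poly_deriv:
  assumes "smooth f"
  shows "partial_deriv l (taylor_poly (Suc j) f a) = taylor_poly j (partial_deriv l f) a"
proof (rule ext, rule partial_deriv_eqI)
  fix y
  have "((\<lambda>t. taylor_term 0 f a (y + t *\<^sub>R axis l 1) + (\<Sum>k\<le>j. taylor_term (Suc k) f a (y + t *\<^sub>R axis l 1)))
     has_field_derivative 0 + (\<Sum>k\<le>j. partial_deriv l (taylor_term (Suc k) f a) y)) (at 0)"
    by (intro DERIV_add DERIV_sum smooth_deriv smooth_taylor_term) simp
  then show "((\<lambda>t. taylor_poly (Suc j) f a (y + t *\<^sub>R axis l 1)) has_field_derivative taylor_poly j (partial_deriv l f) a y) (at 0)"
    unfolding taylor_term_deriv[OF assms] taylor_poly_def
    by (simp add: sum.atMost_Suc_shift del: taylor_term.simps(2) sum.atMost_Suc)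
qed

lemma taylor_poly_center: "taylor_poly j f a a = f a"
proof -
  have "taylor_term k f a a = (if k = 0 then f a else 0)" for k by (cases k) auto
  then show ?thesis by (simp add: taylor_poly_def)
qed

lemma taylor_poly_pderivs:
  assumes "smooth f" "length W \<le> j"
  shows "pderivs W (taylor_poly j f a) a = pderivs W f a"
proof -
  have "pderivs W (taylor_poly j f a) = taylor_poly (j - length W) (pderivs W f) a"
    using assms(2)
  proof (induction W)
    case (Cons i W)
    then have "pderivs (i # W) (taylor_poly j f a) = partial_deriv i (taylor_poly (Suc (j - length (i # W))) (pderivs W f) a)"
      by (simp add: Suc_diff_Suc)
    then show ?case by (simp add: taylor_poly_deriv smooth_pderivs assms(1))
  qed simp
  then show ?thesis by (simp add: taylor_poly_center)
qed

text \<open>The partial derivatives of the remainder are remainders of the partial derivatives, of one degree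
less.  The induction integrates the bound for them along coordinate directions.\<close>

lemma taylor_remainder:
  fixes f :: "real ^ 'd::finite \<Rightarrow> real" and M :: real
  assumes "smooth f" "\<And>W x. length W = Suc j \<Longrightarrow> \<bar>pderivs W f x\<bar> \<le> M"
  shows "\<bar>f y - taylor_poly j f a y\<bar> \<le> real CARD('d) ^ Suc j * M * norm (y - a) ^ Suc j"
  using assms
proof (induction j arbitrary: f y)
  case 0
  have "\<bar>f y - f a\<bar> \<le> CARD('d) * M * norm (y - a)"
    by (rule smooth_lipschitz_bound[OF 0(1)]) (use 0(2)[of "[i]" for i] in simp)
  then show ?case by (simp add: taylor_poly_def)
next
  case (Suc j)
  have M0: "M \<ge> 0" using Suc.prems(2)[of "replicate (Suc (Suc j)) undefined" a] by simp
  define G where "G y = f y - taylor_poly (Suc j) f a y" for y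
  have G: "smooth G" unfolding G_def by (intro smooth_diff Suc.prems smooth_taylor_poly)
  have dG: "partial_deriv i G z = partial_deriv i f z - taylor_poly j (partial_deriv i f) a z" for i z
    unfolding G_def using taylor_poly_deriv[OF Suc.prems(1), of i j a]
    by (intro partial_deriv_eqI DERIV_diff smooth_deriv Suc.prems) (metis smooth_deriv smooth_taylor_poly)
  let ?B = "real CARD('d) ^ Suc j * M * norm (y - a) ^ Suc j"
  have "\<bar>G y - G a\<bar> \<le> CARD('d) * ?B * norm (y - a)"
  proof (rule smooth_lipschitz_bound[OF G])
    fix i z assume z: "norm (z - a) \<le> norm (y - a)"
    have "\<bar>partial_deriv i f z - taylor_poly j (partial_deriv i f) a z\<bar> \<le> real CARD('d) ^ Suc j * M * norm (z - a) ^ Suc j"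
    proof (rule Suc.IH[OF smooth_partial[OF Suc.prems(1)]])
      fix W :: "'d list" and x assume "length W = Suc j"
      then show "\<bar>pderivs W (partial_deriv i f) x\<bar> \<le> M"
        using Suc.prems(2)[of "W @ [i]" x] by (simp add: pderivs_append)
    qed
    also have "\<dots> \<le> ?B" using z M0 by (intro mult_left_mono power_mono) auto
    finally show "\<bar>partial_deriv i G z\<bar> \<le> ?B" by (simp add: dG)
  qed
  moreover have "G a = 0" by (simp add: G_def taylor_poly_center)
  ultimately show ?case by (simp add: G_def algebra_simps)
qed

section \<open>Polynomial functions and consistency\<close>

text \<open>The linear span of the monomials of degree at most \<open>n\<close>.  The inductive form reduces consistency for
polynomials to consistency for monomials.\<close>

inductive polyfun :: "nat \<Rightarrow> (real ^ 'd::finite \<Rightarrow> real) \<Rightarrow> bool" for n where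
  zero: "polyfun n (\<lambda>x. 0)"
| add_monom: "polyfun n q \<Longrightarrow> mdeg \<gamma> \<le> n \<Longrightarrow> polyfun n (\<lambda>x. c * mpow x \<gamma> + q x)"

lemma polyfun_add: "polyfun n p \<Longrightarrow> polyfun n q \<Longrightarrow> polyfun n (\<lambda>x. p x + q x)"
  by (induction p rule: polyfun.induct) (auto simp: add.assoc intro: polyfun.intros)

lemma polyfun_cmult: "polyfun n q \<Longrightarrow> polyfun n (\<lambda>x. b * q x)"
proof (induction rule: polyfun.induct)
  case (add_monom q \<gamma> c)
  then show ?case using polyfun.add_monom[of n "\<lambda>x. b * q x" \<gamma> "b * c"] by (simp add: algebra_simps)
qed (simp add: polyfun.zero)

lemma polyfun_mono: "polyfun m q \<Longrightarrow> m \<le> n \<Longrightarrow> polyfun n q"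
  by (induction rule: polyfun.induct) (auto intro: polyfun.intros)

lemma polyfun_sum: "(\<And>a. a \<in> A \<Longrightarrow> polyfun n (f a)) \<Longrightarrow> polyfun n (\<lambda>x. \<Sum>a\<in>A. f a x)"
  by (induction A rule: infinite_finite_induct) (auto intro: polyfun_add polyfun.zero)

lemma polyfun_const: "polyfun n (\<lambda>x. c)"
  using polyfun.add_monom[OF polyfun.zero, of "\<lambda>_. 0" n c] by (simp add: mpow_def mdeg_def)

lemma polyfun_times_coord: "polyfun n q \<Longrightarrow> polyfun (Suc n) (\<lambda>x. x $ i * q x)"
proof (induction rule: polyfun.induct)
  case (add_monom q \<gamma> c)
  let ?\<gamma> = "\<gamma>(i := Suc (\<gamma> i))"
  have "mdeg ?\<gamma> = Suc (mdeg \<gamma>)"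
    unfolding mdeg_def by (subst (1 2) sum.remove[of UNIV i]) (auto intro: sum.cong)
  moreover have "x $ i * mpow x \<gamma> = mpow x ?\<gamma>" for x
    unfolding mpow_def by (subst (1 2) prod.remove[of UNIV i]) (auto intro: prod.cong)
  ultimately show ?case
    using polyfun.add_monom[OF add_monom(3), of ?\<gamma> c] add_monom(2) by (simp add: algebra_simps)
qed (simp add: polyfun.zero)

lemma polyfun_taylor_term: "polyfun k (taylor_term k f a)"
proof (induction k arbitrary: f)
  case 0
  have "taylor_term 0 f a = (\<lambda>y. f a)" by (rule ext) simp
  then show ?case by (simp add: polyfun_const)
next
  case (Suc k)
  have "polyfun (Suc k) (\<lambda>y. (y $ i - a $ i) * taylor_term k (partial_deriv i f) a y)" for i
    using polyfun_add[OF polyfun_times_coord[OF Suc, of i] polyfun_mono[OF polyfun_cmult[OF Suc, of "- (a $ i)"]]]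
    by (simp add: left_diff_distrib)
  then have "polyfun (Suc k) (\<lambda>y. inverse (real (Suc k)) * (\<Sum>i\<in>UNIV. (y $ i - a $ i) * taylor_term k (partial_deriv i f) a y))"
    by (intro polyfun_cmult polyfun_sum)
  moreover have "taylor_term (Suc k) f a = (\<lambda>y. inverse (real (Suc k)) * (\<Sum>i\<in>UNIV. (y $ i - a $ i) * taylor_term k (partial_deriv i f) a y))"
    by (rule ext) simp
  ultimately show ?case by (simp only:)
qed

lemma polyfun_taylor_poly: "polyfun j (taylor_poly j f a)"
  unfolding taylor_poly_def[abs_def] by (intro polyfun_sum polyfun_mono[OF polyfun_taylor_term]) auto

lemma consistent_polyfun:
  assumes "consistent n \<Omega> I w X" "polyfun n q" "x \<in> \<Omega>"
  shows "q x = (\<Sum>a\<in>I. q (X a) * w a x)"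
  using assms(2)
proof (induction rule: polyfun.induct)
  case (add_monom q \<gamma> c)
  have "mpow x \<gamma> = (\<Sum>a\<in>I. mpow (X a) \<gamma> * w a x)" using assms(1,3) add_monom(2) by (simp add: consistent_def)
  then show ?case using add_monom(3) by (simp add: sum_distrib_left sum.distrib algebra_simps)
qed simp

text \<open>The polynomial \<open>q\<close> is fixed when differentiating.  In the application \<open>q\<close> is the Taylor polynomial at
the very point \<open>x\<close>, but it is inserted only after the differentiation.\<close>

lemma consistent_polyfun_pderivs:
  assumes "consistent n \<Omega> I w X" "polyfun n q" "x \<in> \<Omega>" "open \<Omega>"
    and "\<And>a. a \<in> I \<Longrightarrow> Cr_on r \<Omega> (w a)" "length W \<le> r"
  shows "pderivs W q x = (\<Sum>a\<in>I. q (X a) * pderivs W (w a) x)"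
  using pderivs_cong[OF assms(4) consistent_polyfun[OF assms(1,2)] assms(3)]
    pderivs_sum_on[OF assms(4) assms(5) assms(6,3)] by simp

section \<open>Lattice sums over point sets of bounded density\<close>

lemma sum_over_finite_int_le:
  fixes g :: "nat \<Rightarrow> real"
  assumes "summable g" "\<And>n. g n \<ge> 0" "finite B"
  shows "(\<Sum>m\<in>B. g (nat \<bar>m\<bar>)) \<le> 2 * suminf g"
proof -
  have half: "(\<Sum>m\<in>C. g (nat \<bar>m\<bar>)) \<le> suminf g" if "finite C" "inj_on (\<lambda>m. nat \<bar>m\<bar>) C" for C
  proof -
    have "(\<Sum>m\<in>C. g (nat \<bar>m\<bar>)) = (\<Sum>n\<in>(\<lambda>m. nat \<bar>m\<bar>) ` C. g n)"
      using that(2) by (simp add: sum.reindex)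
    also have "\<dots> \<le> suminf g" using assms that by (intro sum_le_suminf) auto
    finally show ?thesis .
  qed
  have "B = {m\<in>B. m \<ge> 0} \<union> {m\<in>B. m < 0}" by auto
  then have "(\<Sum>m\<in>B. g (nat \<bar>m\<bar>)) = (\<Sum>m\<in>{m\<in>B. m \<ge> 0} \<union> {m\<in>B. m < 0}. g (nat \<bar>m\<bar>))" by simp
  also have "\<dots> = (\<Sum>m\<in>{m\<in>B. m \<ge> 0}. g (nat \<bar>m\<bar>)) + (\<Sum>m\<in>{m\<in>B. m < 0}. g (nat \<bar>m\<bar>))"
    using assms(3) by (intro sum.union_disjoint) auto
  also have "\<dots> \<le> suminf g + suminf g"
    using assms(3) by (intro add_mono half) (auto simp: inj_on_def)
  finally show ?thesis by simp
qed

text \<open>Each factor dominates the corresponding root of the left-hand side.  The product form makes the sum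
over a lattice factorise into one-dimensional series.\<close>

lemma one_plus_norm_sq_powr_le:
  fixes z :: "real ^ 'd::finite"
  assumes "\<sigma> \<ge> 0"
  shows "(1 + (norm z)\<^sup>2) powr (- \<sigma>) \<le> (\<Prod>i\<in>UNIV. (1 + (z $ i)\<^sup>2) powr (- (\<sigma> / CARD('d))))"
proof -
  have "(\<Prod>i\<in>(UNIV :: 'd set). (1 + (norm z)\<^sup>2) powr (- (\<sigma> / CARD('d)))) \<le> (\<Prod>i\<in>UNIV. (1 + (z $ i)\<^sup>2) powr (- (\<sigma> / CARD('d))))"
  proof (rule prod_mono)
    fix i
    have "(z $ i)\<^sup>2 \<le> (norm z)\<^sup>2" using component_le_norm_cart[of z i] by (metis abs_ge_zero power2_abs power_mono)
    then show "0 \<le> (1 + (norm z)\<^sup>2) powr (- (\<sigma> / CARD('d))) \<and>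
      (1 + (norm z)\<^sup>2) powr (- (\<sigma> / CARD('d))) \<le> (1 + (z $ i)\<^sup>2) powr (- (\<sigma> / CARD('d)))"
      using assms by (intro conjI powr_mono2') (auto intro: add_pos_nonneg)
  qed
  moreover have "(\<Prod>i\<in>(UNIV :: 'd set). (1 + (norm z)\<^sup>2) powr (- (\<sigma> / CARD('d)))) = (1 + (norm z)\<^sup>2) powr (- \<sigma>)"
    using add_pos_nonneg[OF zero_less_one zero_le_power2[of "norm z"]]
    by (simp add: powr_realpow[symmetric] powr_powr del: powr_powr_swap)
  ultimately show ?thesis by simp
qed

lemma one_plus_sq_lower:
  fixes t N :: real and k :: int
  assumes "k = \<lfloor>N * t\<rfloor>" "N \<ge> 0"
  shows "(1 + real (nat \<bar>k\<bar>))\<^sup>2 \<le> 2 * (N + 2)\<^sup>2 * (1 + t\<^sup>2)"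
proof -
  have "\<bar>real_of_int k\<bar> \<le> N * \<bar>t\<bar> + 1"
    using assms floor_correct[of "N * t"] abs_mult[of N t] by linarith
  then have "1 + real (nat \<bar>k\<bar>) \<le> (N + 2) * (1 + \<bar>t\<bar>)"
    using assms(2) by (simp add: algebra_simps)
  then have "(1 + real (nat \<bar>k\<bar>))\<^sup>2 \<le> ((N + 2) * (1 + \<bar>t\<bar>))\<^sup>2" by (intro power_mono) auto
  also have "\<dots> = (N + 2)\<^sup>2 * (1 + \<bar>t\<bar>)\<^sup>2" by (simp add: power_mult_distrib)
  also have "\<dots> \<le> (N + 2)\<^sup>2 * (2 * (1 + t\<^sup>2))"
    using sum_squares_bound[of 1 "\<bar>t\<bar>"] by (intro mult_left_mono zero_le_power2) (simp add: power2_sum)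
  finally show ?thesis by (simp only: mult_ac)
qed

text \<open>Cubes of side \<open>h / d\<close> sort the points into cells with integer labels.  A cell lies in a ball of radius
\<open>h\<close>, so it contains at most \<open>\<tau>\<close> points; and on a cell the summand is bounded by a product of powers of
the coordinates of the label, with exponent \<open>2\<sigma>/d > 1\<close>, so that the sum over all labels is a power of a
convergent series.\<close>

lemma density_sum_bound:
  fixes \<tau> \<sigma> :: real
  assumes \<sigma>: "2 * \<sigma> > CARD('d::finite)" and \<tau>: "\<tau> > 0"
  obtains S where "S \<ge> 0" "\<And>h P (x :: real ^ 'd). h > 0 \<Longrightarrow> finite P \<Longrightarrow> density_bounded h \<tau> P \<Longrightarrow>
    (\<Sum>p\<in>P. (1 + (norm ((x - p) /\<^sub>R h))\<^sup>2) powr (- \<sigma>)) \<le> S"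
proof -
  define N where "N = real CARD('d)"
  have N: "N > 0" by (simp add: N_def)
  define A where "A = (2 * (N + 2)\<^sup>2) powr (\<sigma> / N)"
  define q where "q = 2 * \<sigma> / N"
  have q: "q > 1" using \<sigma> N by (simp add: q_def N_def field_simps)
  have \<sigma>0: "\<sigma> > 0" using \<sigma> by (simp add: order_le_less_trans[of 0])
  define g where "g n = A * (1 + real n) powr (- q)" for n :: nat
  have g0: "g n \<ge> 0" for n by (simp add: g_def A_def)
  have "summable (\<lambda>n. real (Suc n) powr (- q))"
    using q summable_real_powr_iff[of "- q"] by (subst summable_Suc_iff) auto
  then have gs: "summable g" unfolding g_def by (intro summable_mult) (simp add: add.commute)
  define S where "S = \<tau> * (2 * suminf g) ^ CARD('d)"
  show thesis
  proof (rule that)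
    show "S \<ge> 0" using \<tau> gs g0 by (simp add: S_def suminf_nonneg)
    fix h :: real and P :: "(real ^ 'd) set" and x :: "real ^ 'd"
    assume h: "h > 0" and P: "finite P" and dens: "density_bounded h \<tau> P"
    define cell where "cell p = (\<lambda>i. \<lfloor>N * ((x - p) /\<^sub>R h) $ i\<rfloor>)" for p
    define B where "B = (\<Union>p\<in>P. range (cell p))"
    define T where "T = Pi\<^sub>E (UNIV :: 'd set) (\<lambda>_. B)"
    have finB: "finite B" using P by (auto simp: B_def)
    have finT: "finite T" unfolding T_def by (intro finite_PiE finB) auto
    have PT: "cell ` P \<subseteq> T" by (auto simp: T_def B_def)
    have fiber: "real (card {p \<in> P. cell p = k}) \<le> \<tau>" for k
    proof -
      (* The corner of the cell with label k. *)
      define c where "c = x - (h / N) *\<^sub>R (\<chi> i. real_of_int (k i))"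
      have "{p \<in> P. cell p = k} \<subseteq> P \<inter> cball c h"
      proof safe
        fix p assume "k = cell p"
        then have ki: "\<bar>N * ((x - p) /\<^sub>R h) $ i - real_of_int (k i)\<bar> \<le> 1" for i
          unfolding cell_def using floor_correct[of "N * ((x - p) /\<^sub>R h) $ i"] by (simp add: abs_le_iff) linarith
        have "\<bar>(c - p) $ i\<bar> \<le> h / N" for i
        proof -
          have "(c - p) $ i = (h / N) * (N * ((x - p) /\<^sub>R h) $ i - real_of_int (k i))"
            using h N by (simp add: c_def field_simps)
          then have "\<bar>(c - p) $ i\<bar> = (h / N) * \<bar>N * ((x - p) /\<^sub>R h) $ i - real_of_int (k i)\<bar>"
            using h N by (simp add: abs_mult)
          also have "\<dots> \<le> (h / N) * 1" using ki h N by (intro mult_left_mono) auto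
          finally show ?thesis by simp
        qed
        then have "(\<Sum>i\<in>UNIV. \<bar>(c - p) $ i\<bar>) \<le> (\<Sum>i\<in>(UNIV :: 'd set). h / N)" by (intro sum_mono)
        also have "\<dots> = h" by (simp add: N_def)
        finally show "p \<in> cball c h" using norm_le_l1_cart[of "c - p"] by (simp add: dist_norm)
      qed
      then have "card {p \<in> P. cell p = k} \<le> card (P \<inter> cball c h)" using P by (intro card_mono) auto
      then show ?thesis using dens unfolding density_bounded_def by (meson of_nat_le_iff order_trans)
    qed
    have pt: "(1 + (norm ((x - p) /\<^sub>R h))\<^sup>2) powr (- \<sigma>) \<le> (\<Prod>i\<in>UNIV. g (nat \<bar>cell p i\<bar>))" for p
    proof -
      have "(1 + (norm ((x - p) /\<^sub>R h))\<^sup>2) powr (- \<sigma>) \<le> (\<Prod>i\<in>UNIV. (1 + (((x - p) /\<^sub>R h) $ i)\<^sup>2) powr (- (\<sigma> / N)))"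
        unfolding N_def by (rule one_plus_norm_sq_powr_le) (use \<sigma>0 in simp)
      also have "\<dots> \<le> (\<Prod>i\<in>UNIV. g (nat \<bar>cell p i\<bar>))"
      proof (rule prod_mono, intro conjI)
        fix i
        let ?t = "((x - p) /\<^sub>R h) $ i" and ?m = "1 + real (nat \<bar>cell p i\<bar>)"
        have m: "?m > 0" by simp
        have c: "2 * (N + 2)\<^sup>2 > 0" using N by simp
        have "?m\<^sup>2 / (2 * (N + 2)\<^sup>2) \<le> 1 + ?t\<^sup>2"
          using one_plus_sq_lower[of "cell p i" N ?t] N c by (simp add: cell_def field_simps)
        then have "(1 + ?t\<^sup>2) powr (- (\<sigma> / N)) \<le> (?m\<^sup>2 / (2 * (N + 2)\<^sup>2)) powr (- (\<sigma> / N))"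
          using \<sigma>0 N m c by (intro powr_mono2') auto
        also have "\<dots> = (?m\<^sup>2) powr (- (\<sigma> / N)) / (2 * (N + 2)\<^sup>2) powr (- (\<sigma> / N))"
          by (rule powr_divide)
        also have "(2 * (N + 2)\<^sup>2) powr (- (\<sigma> / N)) = inverse A"
          unfolding A_def by (rule powr_minus)
        also have "?m\<^sup>2 = ?m powr 2" using powr_numeral[of ?m] m by simp
        also have "(?m powr 2) powr (- (\<sigma> / N)) = ?m powr (- q)"
          unfolding powr_powr by (simp add: q_def)
        finally show "(1 + ?t\<^sup>2) powr (- (\<sigma> / N)) \<le> g (nat \<bar>cell p i\<bar>)"
          by (simp only: g_def divide_inverse inverse_inverse_eq mult.commute)
      qed simp
      finally show ?thesis .
    qed
    have "(\<Sum>p\<in>P. (1 + (norm ((x - p) /\<^sub>R h))\<^sup>2) powr (- \<sigma>)) \<le> (\<Sum>p\<in>P. \<Prod>i\<in>UNIV. g (nat \<bar>cell p i\<bar>))"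
      by (intro sum_mono pt)
    also have "\<dots> = (\<Sum>k\<in>T. \<Sum>p\<in>{p \<in> P. cell p = k}. \<Prod>i\<in>UNIV. g (nat \<bar>cell p i\<bar>))"
      by (rule sum.group[OF P finT PT, symmetric])
    also have "\<dots> = (\<Sum>k\<in>T. real (card {p \<in> P. cell p = k}) * (\<Prod>i\<in>UNIV. g (nat \<bar>k i\<bar>)))"
      by (intro sum.cong refl) simp
    also have "\<dots> \<le> (\<Sum>k\<in>T. \<tau> * (\<Prod>i\<in>UNIV. g (nat \<bar>k i\<bar>)))"
      by (intro sum_mono mult_right_mono fiber prod_nonneg g0)
    also have "\<dots> = \<tau> * (\<Prod>i\<in>(UNIV :: 'd set). \<Sum>m\<in>B. g (nat \<bar>m\<bar>))"
      unfolding T_def by (subst prod_sum_PiE) (auto simp: finB sum_distrib_left)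
    also have "\<dots> = \<tau> * (\<Sum>m\<in>B. g (nat \<bar>m\<bar>)) ^ CARD('d)" by simp
    also have "\<dots> \<le> S"
      unfolding S_def using \<tau> by (intro mult_left_mono power_mono sum_over_finite_int_le gs g0 finB sum_nonneg) auto
    finally show "(\<Sum>p\<in>P. (1 + (norm ((x - p) /\<^sub>R h))\<^sup>2) powr (- \<sigma>)) \<le> S" .
  qed
qed

section \<open>Approximation by shape functions\<close>

lemma polynomial_decayD:
  assumes "polynomial_decay r s c h \<Omega> I w X" "a \<in> I" "x \<in> \<Omega>" "mdeg \<alpha> \<le> r" "h > 0"
  shows "(1 + (norm ((x - X a) /\<^sub>R h))\<^sup>2) powr s * h ^ mdeg \<alpha> * \<bar>mderiv \<alpha> (w a) x\<bar> < c"
proof -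
  let ?t = "\<lambda>\<alpha> x a. ennreal ((1 + (norm ((x - X a) /\<^sub>R h))\<^sup>2) powr s * h ^ mdeg \<alpha> * \<bar>mderiv \<alpha> (w a) x\<bar>)"
  have "?t \<alpha> x a \<le> (SUP a\<in>I. ?t \<alpha> x a)" using assms(2) by (rule SUP_upper)
  also have "\<dots> \<le> (SUP x\<in>\<Omega>. SUP a\<in>I. ?t \<alpha> x a)" using assms(3) by (rule SUP_upper)
  also have "\<dots> \<le> (SUP \<alpha>\<in>{\<alpha>. mdeg \<alpha> \<le> r}. SUP x\<in>\<Omega>. SUP a\<in>I. ?t \<alpha> x a)"
    using assms(4) by (intro SUP_upper) simp
  also have "\<dots> < ennreal c" using assms(1) by (simp add: polynomial_decay_def)
  finally show ?thesis using assms(5) by (subst (asm) ennreal_less_iff) auto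
qed

text \<open>Subtracting the Taylor polynomial at \<open>x\<close> leaves \<open>j + 1\<close> powers of the distance to the nodes.
At most \<open>j\<close> of the resulting powers of \<open>h\<close> are consumed by \<open>D\<^sup>\<alpha>\<close>, so at least one remains.\<close>

lemma scheme_pointwise_error:
  fixes \<Omega> :: "(real ^ 'd::finite) set" and M :: real
  assumes \<Omega>: "open \<Omega>" and \<Phi>: "smooth \<Phi>" "\<And>W x. length W = Suc j \<Longrightarrow> \<bar>pderivs W \<Phi> x\<bar> \<le> M"
    and scheme: "approx_scheme I w X" "consistent n \<Omega> I w X" "polynomial_decay r s c h \<Omega> I w X"
    and j: "j \<le> n" "j \<le> r" and h: "0 < h" "h \<le> 1" and c: "c > 0"
    and S: "(\<Sum>p\<in>X ` I. (1 + (norm ((x - p) /\<^sub>R h))\<^sup>2) powr (- (s - (real j + 1) / 2))) \<le> S"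
    and x: "x \<in> \<Omega>" and \<alpha>: "mdeg \<alpha> \<le> j"
  shows "\<bar>mderiv \<alpha> (\<lambda>x. \<Sum>a\<in>I. \<Phi> (X a) * w a x) x - mderiv \<alpha> \<Phi> x\<bar> \<le> real CARD('d) ^ Suc j * M * c * S * h"
proof -
  let ?W = "mword \<alpha>" and ?K = "real CARD('d) ^ Suc j * M"
  define Q where "Q a = 1 + (norm ((x - X a) /\<^sub>R h))\<^sup>2" for a
  have Q: "Q a \<ge> 1" for a by (simp add: Q_def)
  have M0: "M \<ge> 0" using \<Phi>(2)[of "replicate (Suc j) undefined" x] by simp
  have C: "Cr_on r \<Omega> (w a)" if "a \<in> I" for a using scheme(3) that by (simp add: polynomial_decay_def)
  have W: "length ?W \<le> r" "length ?W \<le> j" using \<alpha> j(2) by (simp_all add: length_mword)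
  let ?T = "taylor_poly j \<Phi> x"
  have "mderiv \<alpha> (\<lambda>x. \<Sum>a\<in>I. \<Phi> (X a) * w a x) x = (\<Sum>a\<in>I. \<Phi> (X a) * pderivs ?W (w a) x)"
    unfolding mderiv_eq by (rule pderivs_sum_on[OF \<Omega> C W(1) x])
  moreover have "mderiv \<alpha> \<Phi> x = (\<Sum>a\<in>I. ?T (X a) * pderivs ?W (w a) x)"
    using consistent_polyfun_pderivs[OF scheme(2) polyfun_mono[OF polyfun_taylor_poly j(1)] x \<Omega> C W(1), of \<Phi> x]
    by (simp add: mderiv_eq taylor_poly_pderivs[OF \<Phi>(1) W(2)])
  ultimately have "\<bar>mderiv \<alpha> (\<lambda>x. \<Sum>a\<in>I. \<Phi> (X a) * w a x) x - mderiv \<alpha> \<Phi> x\<bar> =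
     \<bar>\<Sum>a\<in>I. (\<Phi> (X a) - ?T (X a)) * pderivs ?W (w a) x\<bar>"
    by (simp add: left_diff_distrib sum_subtractf)
  also have "\<dots> \<le> (\<Sum>a\<in>I. \<bar>(\<Phi> (X a) - ?T (X a)) * pderivs ?W (w a) x\<bar>)" by (rule sum_abs)
  also have "\<dots> \<le> (\<Sum>a\<in>I. (?K * c * h) * Q a powr (- (s - (real j + 1) / 2)))"
  proof (rule sum_mono)
    fix a assume a: "a \<in> I"
    have R: "\<bar>\<Phi> (X a) - ?T (X a)\<bar> \<le> ?K * norm (X a - x) ^ Suc j"
      by (rule taylor_remainder[OF \<Phi>])
    have "norm (X a - x) = h * norm ((x - X a) /\<^sub>R h)" using h by (simp add: norm_minus_commute)
    also have "norm ((x - X a) /\<^sub>R h) = sqrt ((norm ((x - X a) /\<^sub>R h))\<^sup>2)" by simp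
    also have "\<dots> \<le> sqrt (Q a)" unfolding Q_def by (intro real_sqrt_le_mono) simp
    finally have "norm (X a - x) \<le> h * sqrt (Q a)" using h by (simp add: mult_left_mono)
    then have "norm (X a - x) ^ Suc j \<le> (h * sqrt (Q a)) ^ Suc j" by (intro power_mono) auto
    also have "\<dots> = h ^ Suc j * Q a powr ((real j + 1) / 2)"
    proof -
      have "sqrt (Q a) ^ Suc j = (Q a powr (1 / 2)) powr real (Suc j)"
        using Q[of a] by (subst powr_realpow) (auto simp: powr_half_sqrt)
      also have "\<dots> = Q a powr ((real j + 1) / 2)" by (simp add: powr_powr add.commute)
      finally show ?thesis by (simp only: power_mult_distrib)
    qed
    finally have "?K * norm (X a - x) ^ Suc j \<le> ?K * (h ^ Suc j * Q a powr ((real j + 1) / 2))"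
      using M0 by (intro mult_left_mono) auto
    with R have R': "\<bar>\<Phi> (X a) - ?T (X a)\<bar> \<le> ?K * (h ^ Suc j * Q a powr ((real j + 1) / 2))" by linarith
    have "Q a powr s * h ^ mdeg \<alpha> * \<bar>pderivs ?W (w a) x\<bar> \<le> c"
      using polynomial_decayD[OF scheme(3) a x _ h(1), of \<alpha>] \<alpha> j(2) by (simp add: Q_def mderiv_eq)
    then have D: "\<bar>pderivs ?W (w a) x\<bar> \<le> c * (Q a powr (- s) / h ^ mdeg \<alpha>)"
      using Q[of a] h(1) by (simp add: powr_minus field_simps)
    have "\<bar>(\<Phi> (X a) - ?T (X a)) * pderivs ?W (w a) x\<bar> \<le>
       (?K * (h ^ Suc j * Q a powr ((real j + 1) / 2))) * (c * (Q a powr (- s) / h ^ mdeg \<alpha>))"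
      unfolding abs_mult using R' D M0 h by (intro mult_mono) auto
    also have "\<dots> = ?K * c * (h ^ Suc j / h ^ mdeg \<alpha>) * (Q a powr ((real j + 1) / 2) * Q a powr (- s))"
      by simp
    also have "Q a powr ((real j + 1) / 2) * Q a powr (- s) = Q a powr (- (s - (real j + 1) / 2))"
      by (simp flip: powr_add)
    also have "h ^ Suc j / h ^ mdeg \<alpha> = h ^ (Suc j - mdeg \<alpha>)" using h \<alpha> by (subst power_diff) auto
    also have "?K * c * h ^ (Suc j - mdeg \<alpha>) * Q a powr (- (s - (real j + 1) / 2)) \<le> ?K * c * h * Q a powr (- (s - (real j + 1) / 2))"
    proof -
      have "h ^ (Suc j - mdeg \<alpha>) \<le> h ^ 1" using h \<alpha> by (intro power_decreasing) auto
      then show ?thesis using M0 c by (intro mult_right_mono mult_left_mono) auto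
    qed
    finally show "\<bar>(\<Phi> (X a) - ?T (X a)) * pderivs ?W (w a) x\<bar> \<le> (?K * c * h) * Q a powr (- (s - (real j + 1) / 2))" .
  qed
  also have "\<dots> = (?K * c * h) * (\<Sum>p\<in>X ` I. (1 + (norm ((x - p) /\<^sub>R h))\<^sup>2) powr (- (s - (real j + 1) / 2)))"
    using scheme(1) by (simp add: sum_distrib_left approx_scheme_def sum.reindex Q_def o_def)
  also have "\<dots> \<le> (?K * c * h) * S" using S M0 c h by (intro mult_left_mono) auto
  finally show ?thesis by (simp add: mult_ac)
qed

lemma Lp_bounded:
  assumes "is_domain \<Omega>" "p \<ge> 1" "f \<in> borel_measurable (lebesgue_on \<Omega>)" "\<And>x. x \<in> \<Omega> \<Longrightarrow> \<bar>f x\<bar> \<le> B"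
  shows "f \<in> Lp_functions \<Omega> p"
proof -
  have "(\<lambda>x. 1) \<in> Lp_functions \<Omega> p" using is_domain_finite_measure(3)[OF assms(1)] by (simp add: Lp_functions_def)
  from Lp_bounded_mult[OF assms(2) this assms(3,4)] show ?thesis by simp
qed

lemma shape_span_derivs:
  assumes \<Omega>: "is_domain \<Omega>" and p: "p \<ge> 1" and U: "U \<in> shape_span I w"
    and decay: "polynomial_decay r s c h \<Omega> I w X" and h: "h > 0" and s: "s \<ge> 0" and \<alpha>: "mdeg \<alpha> \<le> r"
  shows "mderiv \<alpha> U \<in> Lp_functions \<Omega> p" "wderiv \<Omega> (mword \<alpha>) U (mderiv \<alpha> U)"
proof -
  have op: "open \<Omega>" using \<Omega> by (simp add: is_domain_def)
  obtain b where b: "U = (\<lambda>x. \<Sum>a\<in>I. b a * w a x)" using U by (auto simp: shape_span_def)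
  have C: "Cr_on r \<Omega> (w a)" if "a \<in> I" for a using decay that by (simp add: polynomial_decay_def)
  have CU: "Cr_on r \<Omega> U" unfolding b by (intro Cr_on_sum Cr_on_cmult op C)
  have W: "length (mword \<alpha>) \<le> r" using \<alpha> by (simp add: length_mword)
  show "wderiv \<Omega> (mword \<alpha>) U (mderiv \<alpha> U)"
    unfolding mderiv_eq by (rule wderiv_classical[OF op CU W])
  have "continuous_on \<Omega> (mderiv \<alpha> U)"
    using Cr_on_pderivs[OF CU, of 0 "mword \<alpha>"] W by (simp add: mderiv_eq)
  then have m: "mderiv \<alpha> U \<in> borel_measurable (lebesgue_on \<Omega>)"
    using op by (intro continuous_imp_measurable_on_sets_lebesgue) (auto simp: open_sets_lebesgue)
  show "mderiv \<alpha> U \<in> Lp_functions \<Omega> p"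
  proof (rule Lp_bounded[OF \<Omega> p m])
    fix x assume x: "x \<in> \<Omega>"
    have "mderiv \<alpha> U x = (\<Sum>a\<in>I. b a * mderiv \<alpha> (w a) x)"
      unfolding mderiv_eq b by (rule pderivs_sum_on[OF op C W x])
    also have "\<bar>\<dots>\<bar> \<le> (\<Sum>a\<in>I. \<bar>b a * mderiv \<alpha> (w a) x\<bar>)" by (rule sum_abs)
    also have "\<dots> \<le> (\<Sum>a\<in>I. \<bar>b a\<bar> * (c / h ^ mdeg \<alpha>))"
    proof (rule sum_mono)
      fix a assume a: "a \<in> I"
      let ?q = "(1 + (norm ((x - X a) /\<^sub>R h))\<^sup>2) powr s"
      have "1 \<le> ?q" using s by (intro ge_one_powr_ge_zero) auto
      then have "1 * (h ^ mdeg \<alpha> * \<bar>mderiv \<alpha> (w a) x\<bar>) \<le> ?q * (h ^ mdeg \<alpha> * \<bar>mderiv \<alpha> (w a) x\<bar>)"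
        using h by (intro mult_right_mono) auto
      also have "\<dots> \<le> c" using polynomial_decayD[OF decay a x \<alpha> h] by (simp add: mult.assoc)
      finally have "\<bar>mderiv \<alpha> (w a) x\<bar> \<le> c / h ^ mdeg \<alpha>" using h by (simp add: field_simps)
      then show "\<bar>b a * mderiv \<alpha> (w a) x\<bar> \<le> \<bar>b a\<bar> * (c / h ^ mdeg \<alpha>)" 
        unfolding abs_mult by (rule mult_left_mono) simp
    qed
    finally show "\<bar>mderiv \<alpha> U x\<bar> \<le> (\<Sum>a\<in>I. \<bar>b a\<bar> * (c / h ^ mdeg \<alpha>))" .
  qed
qed

lemma mword_zero: "mword (\<lambda>_. 0) = []"
  using length_mword[of "\<lambda>_. 0"] by (simp add: mdeg_def)

lemma sobolevI:
  assumes \<Omega>: "is_domain \<Omega>" and p: "p \<ge> 1" and u: "u \<in> Lp_functions \<Omega> p"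
    and d: "\<And>\<alpha>. mdeg \<alpha> \<le> j \<Longrightarrow> \<exists>v\<in>Lp_functions \<Omega> p. wderiv \<Omega> (mword \<alpha>) u v"
  shows "u \<in> sobolev \<Omega> j p"
  using u d Lp_locally_integrable[OF \<Omega> p] unfolding sobolev_def has_weak_deriv_iff by blast

text \<open>The chosen weak derivative in the norm agrees almost everywhere with any other one.\<close>

lemma sobolev_norm_le:
  fixes \<Omega> :: "(real ^ 'd::finite) set"
  assumes \<Omega>: "is_domain \<Omega>" and p: "p \<ge> 1" and u: "u \<in> Lp_functions \<Omega> p" and e: "e \<ge> 0"
    and d: "\<And>\<alpha>. mdeg \<alpha> \<le> j \<Longrightarrow> \<exists>v\<in>Lp_functions \<Omega> p. wderiv \<Omega> (mword \<alpha>) u v \<and> (\<integral>\<^sup>+x. \<bar>v x\<bar> powr p \<partial>lebesgue_on \<Omega>) \<le> ennreal e"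
  shows "sobolev_norm \<Omega> j p u \<le> (real (card {\<alpha> :: 'd mindex. mdeg \<alpha> \<le> j}) * e) powr (1 / p)"
proof -
  have op: "open \<Omega>" using \<Omega> by (simp add: is_domain_def)
  have one: "(\<integral>x. \<bar>weak_deriv \<Omega> \<alpha> u x\<bar> powr p \<partial>lebesgue_on \<Omega>) \<le> e" if \<alpha>: "mdeg \<alpha> \<le> j" for \<alpha>
  proof -
    obtain v where v: "v \<in> Lp_functions \<Omega> p" "wderiv \<Omega> (mword \<alpha>) u v"
      "(\<integral>\<^sup>+x. \<bar>v x\<bar> powr p \<partial>lebesgue_on \<Omega>) \<le> ennreal e" using d[OF \<alpha>] by blast
    have hv: "has_weak_deriv \<Omega> \<alpha> u v"
      using v Lp_locally_integrable[OF \<Omega> p] u by (simp add: has_weak_deriv_iff)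
    then have "has_weak_deriv \<Omega> \<alpha> u (weak_deriv \<Omega> \<alpha> u)" unfolding weak_deriv_def by (rule someI[where P="has_weak_deriv \<Omega> \<alpha> u"])
    from weak_deriv_unique[OF op this hv]
    have "(\<integral>\<^sup>+x. \<bar>weak_deriv \<Omega> \<alpha> u x\<bar> powr p \<partial>lebesgue_on \<Omega>) = (\<integral>\<^sup>+x. \<bar>v x\<bar> powr p \<partial>lebesgue_on \<Omega>)"
      by (intro nn_integral_cong_AE) auto
    with v(3) have n: "(\<integral>\<^sup>+x. \<bar>weak_deriv \<Omega> \<alpha> u x\<bar> powr p \<partial>lebesgue_on \<Omega>) \<le> ennreal e" by simp
    show ?thesis
    proof (cases "integrable (lebesgue_on \<Omega>) (\<lambda>x. \<bar>weak_deriv \<Omega> \<alpha> u x\<bar> powr p)")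
      case True
      then show ?thesis using n e by (simp add: nn_integral_eq_integral)
    qed (use e in \<open>simp add: not_integrable_integral_eq\<close>)
  qed
  have "(\<Sum>\<alpha> | mdeg \<alpha> \<le> j. \<integral>x. \<bar>weak_deriv \<Omega> \<alpha> u x\<bar> powr p \<partial>lebesgue_on \<Omega>) \<le> (\<Sum>\<alpha> | mdeg (\<alpha> :: 'd mindex) \<le> j. e)"
    by (intro sum_mono one) simp
  then show ?thesis unfolding sobolev_norm_def using p
    by (intro powr_mono2) (auto intro!: sum_nonneg integral_nonneg_AE)
qed

text \<open>First fix a smooth function close to \<open>u\<close>, then let the scheme approximate it.  The estimate holds for
large \<open>k\<close> depending on \<open>\<epsilon>\<close>.\<close>

lemma shape_span_eventually_close:
  fixes \<Omega> :: "(real ^ 'd::finite) set"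
    and I :: "nat \<Rightarrow> 'i set" and w :: "nat \<Rightarrow> 'i \<Rightarrow> real ^ 'd \<Rightarrow> real" and X :: "nat \<Rightarrow> 'i \<Rightarrow> real ^ 'd"
  assumes \<Omega>: "is_domain \<Omega>" and seg: "segment_condition \<Omega>" and p: "p \<ge> 1" and j: "j \<le> n" "j \<le> r"
    and scheme: "\<And>k. approx_scheme (I k) (w k) (X k)" "\<And>k. consistent n \<Omega> (I k) (w k) (X k)"
      "\<And>k. polynomial_decay r s c (h k) \<Omega> (I k) (w k) (X k)" "\<And>k. density_bounded (h k) \<tau> (X k ` I k)"
    and h: "\<And>k. h k > 0" "h \<longlonglongrightarrow> 0" and const: "\<tau> > 0" "c > 0" "2 * s > real CARD('d) + real j + 1"
    and u: "u \<in> sobolev \<Omega> j p" and \<epsilon>: "\<epsilon> > 0"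
  shows "\<forall>\<^sub>F k in sequentially. \<exists>U\<in>shape_span (I k) (w k). sobolev_norm \<Omega> j p (\<lambda>x. U x - u x) \<le> \<epsilon>"
proof -
  have op: "open \<Omega>" using \<Omega> by (simp add: is_domain_def)
  have uL: "u \<in> Lp_functions \<Omega> p" using u by (simp add: sobolev_def)
  note m = is_domain_finite_measure(1)[OF \<Omega>] and I = Lp_integrable[OF \<Omega> p]
  have s0: "s \<ge> 0" using const(3) by (smt (verit) of_nat_0_le_iff)
  define N where "N = real (card {\<alpha> :: 'd mindex. mdeg \<alpha> \<le> j})"
  have "(\<lambda>_. 0) \<in> {\<alpha> :: 'd mindex. mdeg \<alpha> \<le> j}" by (simp add: mdeg_def)
  then have N: "N > 0" using finite_mdeg_le[of j] unfolding N_def by (metis card_gt_0_iff empty_iff of_nat_0_less_iff)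
  (* Chosen so that N derivatives with p-th power error 2^p (e + e) have total norm \<epsilon>. *)
  define e where "e = \<epsilon> powr p / (N * (2 * 2 powr p))"
  have e: "e > 0" using \<epsilon> N by (simp add: e_def)
  have e2: "(N * (2 powr p * (e + e))) powr (1 / p) = \<epsilon>"
  proof -
    have "N * (2 powr p * (e + e)) = \<epsilon> powr p" using N by (simp add: e_def)
    then show ?thesis using \<epsilon> p by (simp add: powr_powr)
  qed
  obtain \<Phi> where \<Phi>: "smooth \<Phi>" "\<forall>W. \<exists>B. \<forall>x. \<bar>pderivs W \<Phi> x\<bar> \<le> B" "\<forall>W. length W \<le> j \<longrightarrow> (\<exists>v\<in>Lp_functions \<Omega> p. wderiv \<Omega> W u v \<and>
        (\<integral>\<^sup>+x. \<bar>pderivs W \<Phi> x - v x\<bar> powr p \<partial>lebesgue_on \<Omega>) \<le> ennreal e)"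
    using sobolev_smooth_approximable[OF \<Omega> seg p u] e unfolding smooth_approximable_def smooth_approximant_def by blast
  obtain B where B: "\<And>W x. \<bar>pderivs W \<Phi> x\<bar> \<le> B W" using \<Phi>(2) by metis
  (* Finitely many words: one bound for all derivatives of order j + 1. *)
  define M where "M = (\<Sum>W | length (W :: 'd list) \<le> Suc j. B W)"
  have B0: "B W \<ge> 0" for W using B[of W 0] by (meson abs_ge_zero order_trans)
  have M: "\<bar>pderivs W \<Phi> x\<bar> \<le> M" if "length W = Suc j" for W x
    using B[of W x] member_le_sum[of W "{W. length W \<le> Suc j}" B] that B0 finite_short_words
    unfolding M_def by fastforce
  have \<sigma>: "2 * (s - (real j + 1) / 2) > CARD('d)" using const(3) by (simp add: field_simps)
  obtain S where S: "S \<ge> 0" "\<And>h P (x :: real ^ 'd). h > 0 \<Longrightarrow> finite P \<Longrightarrow> density_bounded h \<tau> P \<Longrightarrow>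
    (\<Sum>p\<in>P. (1 + (norm ((x - p) /\<^sub>R h))\<^sup>2) powr (- (s - (real j + 1) / 2))) \<le> S"
    using density_sum_bound[OF \<sigma> const(1)] by metis
  define K where "K = real CARD('d) ^ Suc j * M * c * S"
  have K: "K \<ge> 0" unfolding K_def M_def using const S(1) B0 by (intro mult_nonneg_nonneg sum_nonneg) auto
  define V where "V = measure lebesgue \<Omega>"
  have "(\<lambda>k. (K * h k) powr p * V) \<longlonglongrightarrow> (K * 0) powr p * V"
    using p K by (intro tendsto_intros h(2)) (auto intro!: always_eventually mult_nonneg_nonneg less_imp_le[OF h(1)])
  then have "(\<lambda>k. (K * h k) powr p * V) \<longlonglongrightarrow> 0" by simp
  then have "\<forall>\<^sub>F k in sequentially. (K * h k) powr p * V < e" using e by (rule order_tendstoD(2))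
  moreover have "\<forall>\<^sub>F k in sequentially. h k < 1" using h(2) by (rule order_tendstoD(2)) simp
  ultimately show ?thesis
  proof eventually_elim
    case (elim k)
    define U where "U x = (\<Sum>a\<in>I k. \<Phi> (X k a) * w k a x)" for x
    have Us: "U \<in> shape_span (I k) (w k)" unfolding shape_span_def U_def[abs_def] 
      by (intro CollectI exI[of _ "\<lambda>a. \<Phi> (X k a)"] conjI refl TrueI)
    have err: "\<bar>mderiv \<alpha> U x - mderiv \<alpha> \<Phi> x\<bar> \<le> K * h k" if "x \<in> \<Omega>" "mdeg \<alpha> \<le> j" for x \<alpha>
      unfolding U_def K_def
      by (rule scheme_pointwise_error[OF op \<Phi>(1) M scheme(1-3) j h(1) _ const(2) S(2)[OF h(1)] that])
         (use elim scheme in \<open>auto simp: approx_scheme_def\<close>)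
    note UD = shape_span_derivs[OF \<Omega> p Us scheme(3) h(1) s0]
    have UL: "U \<in> Lp_functions \<Omega> p"
      using UD(1)[of "\<lambda>_. 0"] by (simp add: mderiv_eq mword_zero mdeg_def)
    have muL: "(\<lambda>x. (-1) * v x) \<in> Lp_functions \<Omega> p" if "v \<in> Lp_functions \<Omega> p" for v
      using Lp_bounded_mult[OF p that, of "\<lambda>_. -1" 1] by simp
    have "sobolev_norm \<Omega> j p (\<lambda>x. U x + (-1) * u x) \<le> (N * (2 powr p * (e + e))) powr (1 / p)"
      unfolding N_def
    proof (rule sobolev_norm_le[OF \<Omega> p])
      show "(\<lambda>x. U x + (-1) * u x) \<in> Lp_functions \<Omega> p" by (intro Lp_add p UL muL uL)
      show "2 powr p * (e + e) \<ge> 0" using e by simp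
      fix \<alpha> :: "'d mindex" assume \<alpha>: "mdeg \<alpha> \<le> j"
      then have \<alpha>r: "mdeg \<alpha> \<le> r" using j by simp
      obtain v where v: "v \<in> Lp_functions \<Omega> p" "wderiv \<Omega> (mword \<alpha>) u v"
        "(\<integral>\<^sup>+x. \<bar>mderiv \<alpha> \<Phi> x - v x\<bar> powr p \<partial>lebesgue_on \<Omega>) \<le> ennreal e"
        using \<Phi>(3)[rule_format, of "mword \<alpha>"] \<alpha> unfolding length_mword mderiv_eq by blast
      note D = UD[OF \<alpha>r]
      have [measurable]: "v \<in> borel_measurable (lebesgue_on \<Omega>)" "mderiv \<alpha> U \<in> borel_measurable (lebesgue_on \<Omega>)"
        "mderiv \<alpha> \<Phi> \<in> borel_measurable (lebesgue_on \<Omega>)"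
        using v(1) D(1) by (auto simp: Lp_functions_def mderiv_eq intro!: continuous_measurable_on smooth_continuous smooth_pderivs \<Phi>(1))
      have "(\<integral>\<^sup>+x. \<bar>mderiv \<alpha> U x - mderiv \<alpha> \<Phi> x\<bar> powr p \<partial>lebesgue_on \<Omega>) \<le> (\<integral>\<^sup>+x. ennreal ((K * h k) powr p) \<partial>lebesgue_on \<Omega>)"
        using err \<alpha> p by (intro nn_integral_mono ennreal_leI powr_mono2) auto
      also have "\<dots> = ennreal ((K * h k) powr p) * emeasure lebesgue \<Omega>"
        using m by (simp add: emeasure_restrict_space)
      also have "\<dots> = ennreal ((K * h k) powr p * V)"
        unfolding V_def using is_domain_finite_measure(2)[OF \<Omega>] by (simp add: ennreal_mult emeasure_eq_ennreal_measure)
      also have "\<dots> \<le> ennreal e" using elim(1) by (intro ennreal_leI) simp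
      finally have "(\<integral>\<^sup>+x. \<bar>(mderiv \<alpha> U x - mderiv \<alpha> \<Phi> x) + (mderiv \<alpha> \<Phi> x - v x)\<bar> powr p \<partial>lebesgue_on \<Omega>) \<le> ennreal (2 powr p * (e + e))"
        using e by (intro nn_integral_powr_add_le p v(3)) auto
      then have "(\<integral>\<^sup>+x. \<bar>mderiv \<alpha> U x + (-1) * v x\<bar> powr p \<partial>lebesgue_on \<Omega>) \<le> ennreal (2 powr p * (e + e))" by simp
      moreover have "wderiv \<Omega> (mword \<alpha>) (\<lambda>x. U x + (-1) * u x) (\<lambda>x. mderiv \<alpha> U x + (-1) * v x)"
        by (intro wderiv_add wderiv_cmult D v m I UL muL uL)
      moreover have "(\<lambda>x. mderiv \<alpha> U x + (-1) * v x) \<in> Lp_functions \<Omega> p" by (intro Lp_add p D muL v)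
      ultimately show "\<exists>v\<in>Lp_functions \<Omega> p. wderiv \<Omega> (mword \<alpha>) (\<lambda>x. U x + (-1) * u x) v \<and>
          (\<integral>\<^sup>+x. \<bar>v x\<bar> powr p \<partial>lebesgue_on \<Omega>) \<le> ennreal (2 powr p * (e + e))" by blast
    qed
    then have "sobolev_norm \<Omega> j p (\<lambda>x. U x - u x) \<le> \<epsilon>" unfolding e2 by simp
    then show ?case using Us by blast
  qed
qed

text \<open>The infimum of the distances from \<open>u\<close> to the \<open>k\<close>-th span tends to zero, and the \<open>k\<close>-th function is
chosen optimal up to \<open>1 / (k + 1)\<close>.\<close>

theorem corollary2:
  fixes \<Omega> :: "(real ^ 'd::finite) set"
    and n r l m j :: nat
    and I :: "nat \<Rightarrow> 'i set"
    and w :: "nat \<Rightarrow> 'i \<Rightarrow> real ^ 'd \<Rightarrow> real"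
    and X :: "nat \<Rightarrow> 'i \<Rightarrow> real ^ 'd"
    and h :: "nat \<Rightarrow> real"
    and \<tau> c s p :: real
  assumes "is_domain \<Omega>" and "segment_condition \<Omega>"
    and "l \<ge> min n r" and "m = min n l"
    and "\<And>k. approx_scheme (I k) (w k) (X k)"
    and "\<And>k. h k > 0" and "h \<longlonglongrightarrow> 0"
    and "\<tau> > 0" and "c > 0" and "2 * s > real CARD('d) + real m + 1"
    and "\<And>k. consistent n \<Omega> (I k) (w k) (X k)"
    and "\<And>k. density_bounded (h k) \<tau> (X k ` I k)"
    and "\<And>k. polynomial_decay r s c (h k) \<Omega> (I k) (w k) (X k)"
    and "1 \<le> p" and "j = min n r"
  shows "\<forall>u\<in>sobolev \<Omega> j p. \<exists>U. (\<forall>k. U k \<in> shape_span (I k) (w k)) \<and> tendsto_sobolev \<Omega> j p U u"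
proof
  fix u assume u: "u \<in> sobolev \<Omega> j p"
  have j: "j \<le> n" "j \<le> r" "j \<le> m" using assms(3,4,15) by auto
  have s: "2 * s > real CARD('d) + real j + 1" using assms(10) j(3) by linarith
  have s0: "s \<ge> 0" using s by (smt (verit) of_nat_0_le_iff)
  define dist where "dist k U = sobolev_norm \<Omega> j p (\<lambda>x. U x - u x)" for k :: nat and U
  have dist0: "dist k U \<ge> 0" for k U by (simp add: dist_def sobolev_norm_def)
  define D where "D k = dist k ` shape_span (I k) (w k)" for k
  have D: "D k \<noteq> {}" "bdd_below (D k)" for k
    using dist0 by (auto simp: D_def shape_span_def intro!: bdd_belowI[of _ 0])
  have "\<exists>U\<in>shape_span (I k) (w k). dist k U < Inf (D k) + inverse (real (Suc k))" for k
    using cInf_lessD[OF D(1)[of k], of "Inf (D k) + inverse (real (Suc k))"] by (auto simp: D_def)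
  then obtain U where U: "\<And>k. U k \<in> shape_span (I k) (w k)" "\<And>k. dist k (U k) < Inf (D k) + inverse (real (Suc k))"
    by metis
  have lim: "(\<lambda>k. dist k (U k)) \<longlonglongrightarrow> 0"
  proof (rule order_tendstoI)
    fix a :: real assume "a < 0"
    then show "\<forall>\<^sub>F k in sequentially. a < dist k (U k)" using dist0 by (intro always_eventually allI) (meson less_le_trans)
  next
    fix \<epsilon> :: real assume \<epsilon>: "0 < \<epsilon>"
    have "\<forall>\<^sub>F k in sequentially. \<exists>U\<in>shape_span (I k) (w k). dist k U \<le> \<epsilon> / 2"
      unfolding dist_def
      by (rule shape_span_eventually_close[OF assms(1,2,14) j(1,2) assms(5,11,13,12,6,7,8,9) s u]) (use \<epsilon> in simp)
    moreover have "\<forall>\<^sub>F k in sequentially. inverse (real (Suc k)) < \<epsilon> / 2"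
      using LIMSEQ_inverse_real_of_nat by (rule order_tendstoD(2)) (use \<epsilon> in simp)
    ultimately show "\<forall>\<^sub>F k in sequentially. dist k (U k) < \<epsilon>"
    proof eventually_elim
      case (elim k)
      then have "Inf (D k) \<le> \<epsilon> / 2" using cInf_lower[OF _ D(2)[of k]] by (force simp: D_def)
      then show ?case using U(2)[of k] elim(2) by linarith
    qed
  qed
  have "U k \<in> sobolev \<Omega> j p" for k
  proof -
    note UD = shape_span_derivs[OF assms(1) assms(14) U(1)[of k] assms(13) assms(6) s0]
    have "U k \<in> Lp_functions \<Omega> p" using UD(1)[of "\<lambda>_. 0"] by (simp add: mderiv_eq mword_zero mdeg_def)
    then show ?thesis
      by (rule sobolevI[OF assms(1) assms(14)]) (use UD j(2) order_trans in blast)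
  qed
  then show "\<exists>U. (\<forall>k. U k \<in> shape_span (I k) (w k)) \<and> tendsto_sobolev \<Omega> j p U u"
    using U(1) u lim unfolding tendsto_sobolev_def dist_def by blast
qed

end
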